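(* Let $d\ge 1$ be an integer. For every $\delta>0$ there exists a constant $C>0$, depending only on $\delta$ (and the dimension $d$), such that the following holds. If $L\ge 1$ is an integer and $E\subset\mathbb{S}^d$ is a measurable set with $$\inf\{\,h_z(E): z\in\mathbb{R}^{d+1},\ |z|<1,\ 1-|z|=1/L\,\}=\delta,$$ then for every $f\in L^2(\mathbb{S}^d)$, $$\int_{\mathbb{S}^d}|f(u)|^2\,d\sigma(u)\le C\left(\int_E|f(u)|^2\,d\sigma(u)+\sum_{\ell>L}\|P_\ell(f)\|^2\right).$$
   Context: $\mathbb{S}^d$ is the unit sphere of $\mathbb{R}^{d+1}$, $\sigma$ is its surface measure, $L^2(\mathbb{S}^d)=L^2(\sigma)$ and $\|\cdot\|$ is its norm. $\mathcal{H}_\ell$ is the space of spherical harmonics of degree $\ell$, i.e. restrictions to $\mathbb{S}^d$ of homogeneous harmonic polynomials of degree $\ell$ in $d+1$ variables, and $P_\ell$ is the orthogonal projection from $L^2(\mathbb{S}^d)$ onto $\mathcal{H}_\ell$. For $z\in\mathbb{R}^{d+1}$ with $|z|<1$ and measurable $F\subset\mathbb{S}^d$, $$h_z(F)=\frac{1}{\sigma(\mathbb{S}^d)}\int_F\frac{1-|z|^2}{|z-u|^{d+1}}\,d\sigma(u)$$ is the harmonic measure of $F$ with respect to $z$. *)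

theory Defs
  imports "HOL-Analysis.Analysis"
begin

text \<open>
  Surface measure on the unit sphere of \<open>\<real>\<^sup>n\<close>, \<open>n = CARD('n)\<close>, in polar coordinates:
  \<open>\<sigma>(A)\<close> is \<open>n\<close> times the volume of the cone of all \<open>t u\<close> with \<open>0 < t \<le> 1\<close> and \<open>u \<in> A\<close>
  (see \<open>emeasure_sphere_measure\<close> below). It is completed, so measurable sets and functions on
  the sphere are the Lebesgue measurable ones, not only the Borel ones.
\<close>
definition sphere_measure :: "(real ^ 'n) measure" where
  "sphere_measure = completion (scale_measure (of_nat CARD('n))
     (distr (restrict_space lborel (cball 0 1 - {0})) (restrict_space borel (sphere 0 1))
       (\<lambda>x. x /\<^sub>R norm x)))"

lemma space_sphere_measure: "space (sphere_measure :: (real ^ 'n) measure) = sphere 0 1"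
  by (simp add: sphere_measure_def space_restrict_space space_scale_measure)

lemma emeasure_sphere_measure:
  fixes A :: "(real ^ 'n) set"
  assumes A: "A \<in> sets borel" "A \<subseteq> sphere 0 1"
  shows "emeasure sphere_measure A =
    of_nat CARD('n) * emeasure lborel {t *\<^sub>R u | t u. 0 < t \<and> t \<le> 1 \<and> u \<in> A}"
proof -
  let ?B = "cball 0 1 - {0} :: (real ^ 'n) set"
  let ?M = "restrict_space lborel ?B" and ?N = "restrict_space borel (sphere 0 1 :: (real ^ 'n) set)"
  let ?g = "\<lambda>x :: real ^ 'n. x /\<^sub>R norm x"
  have g: "?g \<in> measurable ?M ?N"
    by (rule measurable_restrict_space3) (auto simp: borel_measurable_divide)
  have AN: "A \<in> sets ?N"
    using A by (auto simp: sets_restrict_space_iff)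
  have eq: "?g -` A \<inter> space ?M = {t *\<^sub>R u | t u. 0 < t \<and> t \<le> 1 \<and> u \<in> A}" (is "?L = ?R")
  proof
    show "?L \<subseteq> ?R"
    proof
      fix x assume x: "x \<in> ?L"
      then have "x = norm x *\<^sub>R ?g x" "0 < norm x" "norm x \<le> 1" "?g x \<in> A"
        by (auto simp: space_restrict_space)
      then show "x \<in> ?R" by blast
    qed
    show "?R \<subseteq> ?L"
    proof
      fix x assume "x \<in> ?R"
      then obtain t u where *: "x = t *\<^sub>R u" "0 < t" "t \<le> 1" "u \<in> A" by blast
      then have "norm u = 1" using A by auto
      with * show "x \<in> ?L" by (auto simp: space_restrict_space)
    qed
  qed
  have "emeasure sphere_measure A = of_nat CARD('n) * emeasure (distr ?M ?N ?g) A"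
    using AN by (simp add: sphere_measure_def emeasure_completion)
  also have "\<dots> = of_nat CARD('n) * emeasure ?M (?g -` A \<inter> space ?M)"
    using emeasure_distr[OF g AN] by simp
  also have "emeasure ?M (?g -` A \<inter> space ?M) = emeasure lborel (?g -` A \<inter> space ?M)"
    by (rule emeasure_restrict_space) (auto simp: space_restrict_space)
  finally show ?thesis unfolding eq .
qed

definition square_integrable_sphere :: "(real ^ 'n \<Rightarrow> complex) \<Rightarrow> bool" where
  "square_integrable_sphere f \<longleftrightarrow>
     f \<in> borel_measurable sphere_measure \<and> integrable sphere_measure (\<lambda>u. (norm (f u))\<^sup>2)"

definition L2_inner_sphere :: "(real ^ 'n \<Rightarrow> complex) \<Rightarrow> (real ^ 'n \<Rightarrow> complex) \<Rightarrow> complex" where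
  "L2_inner_sphere f g = (\<integral>u. f u * cnj (g u) \<partial>sphere_measure)"

definition L2_norm_sphere :: "(real ^ 'n \<Rightarrow> complex) \<Rightarrow> real" where
  "L2_norm_sphere f = sqrt (\<integral>u. (norm (f u))\<^sup>2 \<partial>sphere_measure)"

definition homogeneous_polynomial :: "nat \<Rightarrow> (real ^ 'n \<Rightarrow> complex) \<Rightarrow> bool" where
  "homogeneous_polynomial l p \<longleftrightarrow>
     (\<exists>c :: ('n \<Rightarrow> nat) \<Rightarrow> complex.
        p = (\<lambda>x. \<Sum>\<alpha> | (\<Sum>i\<in>UNIV. \<alpha> i) = l. c \<alpha> * of_real (\<Prod>i\<in>UNIV. (x $ i) ^ \<alpha> i)))"

definition partial_derivative :: "'n \<Rightarrow> (real ^ 'n \<Rightarrow> complex) \<Rightarrow> real ^ 'n \<Rightarrow> complex" where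
  "partial_derivative i p x = vector_derivative (\<lambda>t. p (x + t *\<^sub>R axis i 1)) (at 0)"

definition laplacian :: "(real ^ 'n \<Rightarrow> complex) \<Rightarrow> real ^ 'n \<Rightarrow> complex" where
  "laplacian p x = (\<Sum>i\<in>UNIV. partial_derivative i (partial_derivative i p) x)"

definition spherical_harmonics :: "nat \<Rightarrow> (real ^ 'n \<Rightarrow> complex) set" where
  "spherical_harmonics l =
     {restrict p (sphere 0 1) | p. homogeneous_polynomial l p \<and> (\<forall>x. laplacian p x = 0)}"

text \<open>
  Spherical harmonics are continuous and \<open>\<sigma>\<close> charges every nonempty open subset of the sphere,
  so for square integrable \<open>f\<close> the function described here is unique.
\<close>
definition harmonic_projection :: "nat \<Rightarrow> (real ^ 'n \<Rightarrow> complex) \<Rightarrow> real ^ 'n \<Rightarrow> complex" where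
  "harmonic_projection l f =
     (THE g. g \<in> spherical_harmonics l \<and>
        (\<forall>h\<in>spherical_harmonics l. L2_inner_sphere (\<lambda>u. f u - g u) h = 0))"

definition harmonic_measure :: "real ^ 'n \<Rightarrow> (real ^ 'n) set \<Rightarrow> real" where
  "harmonic_measure z F =
     1 / measure sphere_measure (sphere 0 1 :: (real ^ 'n) set) *
       (LINT u:F|sphere_measure. (1 - (norm z)\<^sup>2) / norm (z - u) ^ CARD('n))"

end

(*
By Parseval it suffices to bound the norm of a sum G of spherical harmonics of degree at most L by its norm on E.
The identity "integral of Delta P = k (k + n - 2) integral of P" on the sphere, for P homogeneous of degree k in n
variables, gives both the orthogonality of different degrees and the Bernstein inequality for the gradient.
Iterating the latter, outside a set that carries at most a third of the norm of G, every point e of the sphere is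
good: the derivatives of order k of G at e are at most (b L)^k |G(e)|, so that along each great circle through e,
parametrized by L times the angle, G / G(e) extends to an entire function with a growth bound independent of L.
By compactness such functions are bounded below off a small set (a Remez inequality).  The bound on the harmonic
measure says that E has a fixed positive density in the ball of radius K / L around e, hence also on many lines
through e after passing to the cone over E.  So |G(e)|^2 is at most a constant times the mean of |G|^2 over
the part of E in that ball; now integrate over the good points.
*)
theory Submission
  imports Defs "HOL-Complex_Analysis.Great_Picard"
begin

section \<open>The surface measure and polar coordinates\<close>

text \<open>Compactness needs bounds at a single point, whereas the Bernstein inequality bounds only
  integrals over the sphere. Goodness therefore asks for all orders k at once with an extra factor
  \<open>4 ^ k\<close>: the exceptional sets then get the weights (1/4)^k, k \<ge> 1, with sum below
  1/3, and the price is only a larger base b. The power L^k cancels against the factor 1/L in the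
  angle, so that one compact family serves every degree and no explicit Remez constant has to be
  found. Volumes are preferred to surface measure because the latter is defined by cones, so that
  dilations, coverings by balls and Fubini along lines are those of Lebesgue measure, and because a
  straight line through a multiple of e, not passing through 0, spans with 0 a plane: its directions
  run along a great circle through e. The angle is a distorted parameter on the line. Compactness
  controls small values only up to discs in the angle, so the distortion must not compress; this is
  why a thin tube around the axis is removed, and why n \<ge> 2 matters for its volume.\<close>

abbreviation sphm :: "(real ^ 'n) measure" where "sphm \<equiv> sphere_measure"
abbreviation unit_sphere :: "(real ^ 'n) set" where "unit_sphere \<equiv> sphere 0 1"

text \<open>The measure before completion: push-forward and scaling rules apply to it for Borel
  integrands, and \<open>nn_integral_completion\<close> and \<open>integral_completion\<close> carry
  the results over.\<close>

definition sphere_measure_borel :: "(real ^ 'n) measure" where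
  "sphere_measure_borel = scale_measure (of_nat CARD('n))
     (distr (restrict_space lborel (cball 0 1 - {0})) (restrict_space borel (sphere 0 1))
       (\<lambda>x. x /\<^sub>R norm x))"

lemma sphm_completion: "sphm = completion sphere_measure_borel"
  by (simp add: sphere_measure_def sphere_measure_borel_def)

lemma sets_sphere_measure_borel: "sets (sphere_measure_borel :: (real^'n) measure) = sets (restrict_space borel unit_sphere)"
  by (simp add: sphere_measure_borel_def)

lemma space_sphere_measure_borel: "space (sphere_measure_borel :: (real^'n) measure) = unit_sphere"
  by (simp add: sphere_measure_borel_def space_restrict_space space_scale_measure)

lemma measurable_sphm0I:
  "h \<in> borel_measurable borel \<Longrightarrow> h \<in> borel_measurable (sphere_measure_borel :: (real^'n) measure)"
  by (subst measurable_cong_sets[OF sets_sphere_measure_borel refl]) (rule measurable_restrict_space1)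

lemma measurable_sphmI:
  "h \<in> borel_measurable borel \<Longrightarrow> h \<in> borel_measurable (sphm :: (real^'n) measure)"
  unfolding sphm_completion by (intro measurable_completion measurable_sphm0I)

lemma sets_sphmI: "A \<in> sets borel \<Longrightarrow> A \<subseteq> unit_sphere \<Longrightarrow> A \<in> sets (sphm :: (real^'n) measure)"
  unfolding sphm_completion
  by (rule sets_completionI_sets) (auto simp: sets_sphere_measure_borel sets_restrict_space_iff)

section \<open>Integrals over the sphere as Lebesgue integrals over balls\<close>

lemma proj_measurable:
  "(\<lambda>x. x /\<^sub>R norm x) \<in> measurable (restrict_space lborel (cball 0 1 - {0 :: real^'n})) (restrict_space borel unit_sphere)"
  by (rule measurable_restrict_space3) (auto simp: borel_measurable_divide)

lemma sgn_measurable[measurable (raw)]: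
  fixes f :: "'a \<Rightarrow> real^'n"
  assumes [measurable]: "f \<in> borel_measurable M"
  shows "(\<lambda>x. sgn (f x)) \<in> borel_measurable M"
  unfolding sgn_div_norm by measurable

declare borel_closed[OF closed_cball, measurable]

lemma emeasure_cball_less_top[simp]: "emeasure lborel (cball a r :: (real^'n) set) < top"
  using emeasure_lborel_cball_finite[of a r] by simp

text \<open>Polar coordinates with a total map: \<open>sgn x\<close> is
  \<open>x /\<^sub>R norm x\<close> off 0, and the origin is a null set. The integrand lives on the
  whole space, so that its measurability is plain Borel measurability.\<close>

lemma nn_integral_sphm:
  fixes h :: "real^'n \<Rightarrow> ennreal"
  assumes h[measurable]: "h \<in> borel_measurable borel"
  shows "(\<integral>\<^sup>+u. h u \<partial>sphm) = of_nat CARD('n) * (\<integral>\<^sup>+x. h (sgn x) * indicator (cball 0 1) x \<partial>lborel)"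
proof -
  let ?M = "restrict_space lborel (cball 0 1 - {0 :: real^'n})"
  let ?N = "restrict_space borel unit_sphere :: (real^'n) measure"
  have hN: "h \<in> borel_measurable ?N" by (rule measurable_restrict_space1) simp
  have "(\<integral>\<^sup>+u. h u \<partial>sphm) = (\<integral>\<^sup>+u. h u \<partial>sphere_measure_borel)"
    unfolding sphm_completion by (rule nn_integral_completion)
  also have "\<dots> = of_nat CARD('n) * (\<integral>\<^sup>+u. h u \<partial>distr ?M ?N (\<lambda>x. x /\<^sub>R norm x))"
    unfolding sphere_measure_borel_def by (rule nn_integral_scale_measure) (use hN in simp)
  also have "(\<integral>\<^sup>+u. h u \<partial>distr ?M ?N (\<lambda>x. x /\<^sub>R norm x)) = (\<integral>\<^sup>+x. h (x /\<^sub>R norm x) \<partial>?M)"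
    by (rule nn_integral_distr[OF proj_measurable]) (use hN in simp)
  also have "\<dots> = (\<integral>\<^sup>+x. h (x /\<^sub>R norm x) * indicator (cball 0 1 - {0}) x \<partial>lborel)"
    by (subst nn_integral_restrict_space) (auto simp: space_restrict_space)
  also have "\<dots> = (\<integral>\<^sup>+x. h (sgn x) * indicator (cball 0 1) x \<partial>lborel)"
  proof (rule nn_integral_cong_AE)
    have "AE x in lborel. x \<noteq> (0 :: real^'n)" by (rule AE_lborel_singleton)
    then show "AE x in lborel. h (x /\<^sub>R norm x) * indicator (cball 0 1 - {0}) x
       = h (sgn x) * indicator (cball 0 1) x"
      by eventually_elim (auto simp: sgn_div_norm indicator_def)
  qed
  finally show ?thesis .
qed

lemma scale_measure_density:
  "r < \<infinity> \<Longrightarrow> scale_measure r M = density M (\<lambda>_. r)"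
  by (rule measure_eqI) (auto simp: emeasure_density_const)

lemma integral_sphm:
  fixes h :: "real^'n \<Rightarrow> complex"
  assumes h[measurable]: "h \<in> borel_measurable borel"
  shows "(\<integral>u. h u \<partial>sphm) = of_nat CARD('n) * (\<integral>x. indicator (cball 0 1) x *\<^sub>R h (sgn x) \<partial>lborel)"
proof -
  let ?M = "restrict_space lborel (cball 0 1 - {0 :: real^'n})"
  let ?N = "restrict_space borel unit_sphere :: (real^'n) measure"
  let ?D = "distr ?M ?N (\<lambda>x. x /\<^sub>R norm x)"
  have hN: "h \<in> borel_measurable ?N" by (rule measurable_restrict_space1) simp
  have eq: "(sphere_measure_borel :: (real^'n) measure) = density ?D (\<lambda>_. ennreal (real CARD('n)))"
    unfolding sphere_measure_borel_def by (subst scale_measure_density) (auto simp: ennreal_of_nat_eq_real_of_nat)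
  have "(\<integral>u. h u \<partial>sphm) = (\<integral>u. h u \<partial>sphere_measure_borel)"
    unfolding sphm_completion by (rule integral_completion) (rule measurable_sphm0I[OF h])
  also have "\<dots> = (\<integral>u. real CARD('n) *\<^sub>R h u \<partial>?D)"
    unfolding eq by (rule integral_density) (use hN in auto)
  also have "\<dots> = of_nat CARD('n) * (\<integral>u. h u \<partial>?D)"
    by (simp add: scaleR_conv_of_real)
  also have "(\<integral>u. h u \<partial>?D) = (\<integral>x. h (x /\<^sub>R norm x) \<partial>?M)"
    by (rule integral_distr[OF proj_measurable hN])
  also have "\<dots> = (\<integral>x. indicator (cball 0 1 - {0}) x *\<^sub>R h (x /\<^sub>R norm x) \<partial>lborel)"
    by (subst integral_restrict_space) (auto simp: space_restrict_space)
  also have "\<dots> = (\<integral>x. indicator (cball 0 1) x *\<^sub>R h (sgn x) \<partial>lborel)"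
  proof (rule integral_cong_AE)
    have "AE x in lborel. x \<noteq> (0 :: real^'n)" by (rule AE_lborel_singleton)
    then show "AE x in lborel. indicator (cball 0 1 - {0}) x *\<^sub>R h (x /\<^sub>R norm x)
       = indicator (cball 0 1) x *\<^sub>R h (sgn x)"
      by eventually_elim (auto simp: sgn_div_norm indicator_def)
  qed simp_all
  finally show ?thesis .
qed

lemma emeasure_unit_sphere_finite: "emeasure (sphm :: (real^'n) measure) unit_sphere < \<infinity>"
proof -
  have "emeasure (sphm :: (real^'n) measure) unit_sphere = (\<integral>\<^sup>+u. indicator unit_sphere u \<partial>(sphm :: (real^'n) measure))"
    using sets_sphmI[of "unit_sphere :: (real^'n) set"] by (subst nn_integral_indicator) auto
  also have "\<dots> = of_nat CARD('n) * (\<integral>\<^sup>+x. indicator unit_sphere (sgn x) * indicator (cball 0 1) x \<partial>(lborel :: (real^'n) measure))"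
    by (rule nn_integral_sphm) (auto intro!: borel_measurable_indicator)
  also have "\<dots> \<le> of_nat CARD('n) * (\<integral>\<^sup>+x. indicator (cball 0 1) x \<partial>(lborel :: (real^'n) measure))"
    by (intro mult_left_mono nn_integral_mono) (auto simp: indicator_def)
  also have "\<dots> < \<infinity>"
    by (simp add: ennreal_mult_less_top of_nat_less_top)
  finally show ?thesis .
qed

lemma finite_measure_sphm: "finite_measure (sphm :: (real^'n) measure)"
  by (rule finite_measureI) (use emeasure_unit_sphere_finite[where 'n='n] in \<open>auto simp: space_sphere_measure\<close>)

interpretation sphm: finite_measure "sphm :: (real^'n) measure"
  by (rule finite_measure_sphm)

lemma nn_integral_scale_lborel:
  fixes h :: "real^'n \<Rightarrow> ennreal"
  assumes h[measurable]: "h \<in> borel_measurable borel" and r: "r > 0"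
  shows "(\<integral>\<^sup>+x. h x \<partial>lborel) = ennreal (r ^ CARD('n)) * (\<integral>\<^sup>+x. h (r *\<^sub>R x) \<partial>lborel)"
proof -
  have "(\<integral>\<^sup>+x. h x \<partial>lborel) = (\<integral>\<^sup>+x. h x \<partial>density (distr lborel borel (\<lambda>x. 0 + r *\<^sub>R x)) (\<lambda>x. ennreal (\<bar>r\<bar> ^ DIM(real^'n))))"
    using lborel_affine[of r "0 :: real^'n"] r by simp
  also have "\<dots> = (\<integral>\<^sup>+x. ennreal (\<bar>r\<bar> ^ DIM(real^'n)) * h x \<partial>(distr lborel borel (\<lambda>x. 0 + r *\<^sub>R x)))"
    by (rule nn_integral_density) auto
  also have "\<dots> = (\<integral>\<^sup>+x. ennreal (\<bar>r\<bar> ^ DIM(real^'n)) * h (r *\<^sub>R x) \<partial>lborel)"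
    by (subst nn_integral_distr) auto
  also have "\<dots> = ennreal (r ^ CARD('n)) * (\<integral>\<^sup>+x. h (r *\<^sub>R x) \<partial>lborel)"
    using r by (subst nn_integral_cmult) (auto simp: abs_of_pos)
  finally show ?thesis .
qed

lemma integral_scale_lborel:
  fixes h :: "real^'n \<Rightarrow> complex"
  assumes h[measurable]: "h \<in> borel_measurable borel" and r: "r > 0"
  shows "(\<integral>x. h x \<partial>lborel) = (r ^ CARD('n)) *\<^sub>R (\<integral>x. h (r *\<^sub>R x) \<partial>lborel)"
proof -
  have "(\<integral>x. h x \<partial>lborel) = (\<integral>x. h x \<partial>density (distr lborel borel (\<lambda>x. 0 + r *\<^sub>R x)) (\<lambda>x. ennreal (\<bar>r\<bar> ^ DIM(real^'n))))"
    using lborel_affine[of r "0 :: real^'n"] r by simp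
  also have "\<dots> = (\<integral>x. (\<bar>r\<bar> ^ DIM(real^'n)) *\<^sub>R h x \<partial>(distr lborel borel (\<lambda>x. 0 + r *\<^sub>R x)))"
    by (rule integral_density) auto
  also have "\<dots> = (\<integral>x. (\<bar>r\<bar> ^ DIM(real^'n)) *\<^sub>R h (r *\<^sub>R x) \<partial>lborel)"
    by (subst integral_distr) auto
  also have "\<dots> = (r ^ CARD('n)) *\<^sub>R (\<integral>x. h (r *\<^sub>R x) \<partial>lborel)"
    using r by (simp add: abs_of_pos)
  finally show ?thesis .
qed

text \<open>\<open>h (sgn x)\<close> is constant along rays, so a dilation by r costs only the
  Jacobian \<open>r ^ CARD('n)\<close>.\<close>

lemma nn_integral_cball_sgn:
  fixes h :: "real^'n \<Rightarrow> ennreal"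
  assumes h[measurable]: "h \<in> borel_measurable borel" and r: "r > 0"
  shows "of_nat CARD('n) * (\<integral>\<^sup>+x. h (sgn x) * indicator (cball 0 r) x \<partial>lborel) = ennreal (r ^ CARD('n)) * (\<integral>\<^sup>+u. h u \<partial>sphm)"
proof -
  have "(\<integral>\<^sup>+x. h (sgn x) * indicator (cball 0 r) x \<partial>lborel) =
     ennreal (r ^ CARD('n)) * (\<integral>\<^sup>+x. h (sgn (r *\<^sub>R x)) * indicator (cball 0 r) (r *\<^sub>R x) \<partial>lborel)"
    by (rule nn_integral_scale_lborel[OF _ r]) measurable
  also have "(\<integral>\<^sup>+x. h (sgn (r *\<^sub>R x)) * indicator (cball 0 r) (r *\<^sub>R x) \<partial>lborel) = (\<integral>\<^sup>+x. h (sgn x) * indicator (cball 0 1) x \<partial>lborel)"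
    using r by (intro nn_integral_cong) (auto simp: sgn_scaleR indicator_def)
  finally show ?thesis by (simp add: nn_integral_sphm mult_ac)
qed

lemma integral_cball_sgn:
  fixes h :: "real^'n \<Rightarrow> complex"
  assumes h[measurable]: "h \<in> borel_measurable borel" and r: "r > 0"
  shows "(\<integral>x. indicator (cball 0 r) x *\<^sub>R h (sgn x) \<partial>lborel) = (r ^ CARD('n)) *\<^sub>R (\<integral>x. indicator (cball 0 1) x *\<^sub>R h (sgn x) \<partial>lborel)"
proof -
  have "(\<integral>x. indicator (cball 0 r) x *\<^sub>R h (sgn x) \<partial>lborel) =
     (r ^ CARD('n)) *\<^sub>R (\<integral>x. indicator (cball 0 r) (r *\<^sub>R x) *\<^sub>R h (sgn (r *\<^sub>R x)) \<partial>lborel)"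
    by (rule integral_scale_lborel[OF _ r]) measurable
  also have "(\<integral>x. indicator (cball 0 r) (r *\<^sub>R x) *\<^sub>R h (sgn (r *\<^sub>R x)) \<partial>lborel) = (\<integral>x. indicator (cball 0 1) x *\<^sub>R h (sgn x) \<partial>lborel)"
    using r by (intro Bochner_Integration.integral_cong) (auto simp: sgn_scaleR indicator_def)
  finally show ?thesis .
qed

text \<open>Layer cake: \<open>\<bar>x\<bar>\<^sup>k = \<integral>\<^sub>0\<^sup>1 k s\<^sup>k\<^sup>-\<^sup>1 [s \<le> \<bar>x\<bar>] ds\<close> on the unit ball.\<close>
lemma integral_cball_norm_power:
  fixes h :: "real^'n \<Rightarrow> complex"
  assumes h[measurable]: "h \<in> borel_measurable borel" and bnd: "\<And>u. norm u \<le> 1 \<Longrightarrow> norm (h u) \<le> B" and k: "k > 0"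
  shows "of_nat (CARD('n) + k) * (\<integral>x. indicator (cball 0 1) x *\<^sub>R (norm x ^ k *\<^sub>R h (sgn x)) \<partial>lborel)
     = of_nat CARD('n) * (\<integral>x. indicator (cball 0 1) x *\<^sub>R h (sgn x) \<partial>lborel)"
proof -
  let ?n = "CARD('n)"
  define v where "v = (\<integral>x. indicator (cball 0 1) x *\<^sub>R h (sgn x) \<partial>lborel)"
  \<comment> \<open>Joint integrand of the layer cake formula. Integrating out s first produces the
    power of |x|; integrating out x first leaves the difference of the balls of radius 1 and
    s.\<close>
  define F where "F = (\<lambda>(x, s::real). (indicator (cball 0 1) x * (indicator {0<..norm x} s * (real k * s^(k-1)))) *\<^sub>R h (sgn x))"
  have Fm[measurable]: "F \<in> borel_measurable (lborel \<Otimes>\<^sub>M lborel)"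
  proof -
    have "(\<lambda>(x::real^'n, s::real). indicator {0<..norm x} s :: real) = (\<lambda>(x,s). if 0 < s \<and> s \<le> norm x then 1 else 0)"
      by (auto simp: indicator_def fun_eq_iff)
    then have [measurable]: "(\<lambda>(x::real^'n, s::real). indicator {0<..norm x} s :: real) \<in> borel_measurable (lborel \<Otimes>\<^sub>M lborel)"
      by simp
    have [measurable]: "(\<lambda>z::(real^'n)\<times>real. h (sgn (fst z))) \<in> borel_measurable (lborel \<Otimes>\<^sub>M lborel)"
      by measurable
    have "F = (\<lambda>z. (indicator (cball 0 1) (fst z) * ((case z of (x,s) \<Rightarrow> indicator {0<..norm x} s) * (real k * (snd z)^(k-1)))) *\<^sub>R h (sgn (fst z)))"
      by (auto simp: F_def fun_eq_iff)
    then show ?thesis by (simp del: split_beta)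
  qed
  have B0: "0 \<le> B" using bnd[of 0] norm_ge_zero[of "h 0"] by (simp del: norm_ge_zero)
  have Fint: "integrable (lborel \<Otimes>\<^sub>M lborel) F"
  proof (rule Bochner_Integration.integrable_bound)
    have "integrable (lborel \<Otimes>\<^sub>M lborel) (indicator (cball (0::real^'n) 1 \<times> {0..1::real}) :: _ \<Rightarrow> real)"
      by (rule integrable_real_indicator) (auto simp: lborel.emeasure_pair_measure_Times ennreal_mult_less_top emeasure_lborel_cball_finite)
    then show "integrable (lborel \<Otimes>\<^sub>M lborel) (\<lambda>z::(real^'n)\<times>real. (real k * B) * indicator (cball (0::real^'n) 1 \<times> {0..1::real}) z)"
      by (rule integrable_mult_right)
    show "AE z in lborel \<Otimes>\<^sub>M lborel. norm (F z) \<le> norm (real k * B * indicator (cball (0::real^'n) 1 \<times> {0..1::real}) z)"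
    proof (rule AE_I2, clarify)
      fix x :: "real^'n" and s :: real
      show "norm (F (x,s)) \<le> norm (real k * B * indicator (cball (0::real^'n) 1 \<times> {0..1::real}) (x,s))"
      proof (cases "norm x \<le> 1 \<and> 0 < s \<and> s \<le> norm x")
        case True
        have "norm (sgn x) \<le> 1" by (simp add: norm_sgn)
        then have "norm (h (sgn x)) \<le> B" by (rule bnd)
        moreover have "s^(k-1) \<le> 1" using True by (intro power_le_one) auto
        ultimately have "s^(k-1) * norm (h (sgn x)) \<le> 1 * B" using True by (intro mult_mono) auto
        then have "real k * (s^(k-1) * norm (h (sgn x))) \<le> real k * B" by (intro mult_left_mono) auto
        then show ?thesis using True B0 by (auto simp: F_def indicator_def abs_mult mult_ac)
      qed (auto simp: F_def indicator_def B0)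
    qed
  qed simp
  have i1: "(\<integral>s. F (x,s) \<partial>lborel) = indicator (cball 0 1) x *\<^sub>R (norm x ^ k *\<^sub>R h (sgn x))" for x :: "real^'n"
  proof -
    have "(\<integral>s. indicator {0<..norm x} s * (real k * s^(k-1)) \<partial>lborel) = (\<integral>s. (real k * s^(k-1)) * indicator {0..norm x} s \<partial>lborel)"
      by (rule integral_cong_AE, simp, simp)
         (use AE_lborel_singleton[of "0::real"] in \<open>eventually_elim, auto simp: indicator_def\<close>)
    also have "\<dots> = norm x ^ k - 0 ^ k"
      by (rule integral_FTC_Icc_real[where F="\<lambda>s. s^k"]) (auto intro!: derivative_eq_intros continuous_intros)
    finally have *: "(\<integral>s. indicator {0<..norm x} s * (real k * s^(k-1)) \<partial>lborel) = norm x ^ k" using k by simp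
    have "(\<integral>s. F (x,s) \<partial>lborel) = (\<integral>s. (indicator (cball 0 1) x * (indicator {0<..norm x} s * (real k * s^(k-1)))) *\<^sub>R h (sgn x) \<partial>lborel)"
      by (simp add: F_def)
    also have "\<dots> = (\<integral>s. indicator (cball 0 1) x * (indicator {0<..norm x} s * (real k * s^(k-1))) \<partial>lborel) *\<^sub>R h (sgn x)"
    proof (cases "h (sgn x) = 0")
      case False
      have "integrable lborel (\<lambda>s. indicator {0<..norm x} s * (real k * s^(k-1)))"
      proof (rule Bochner_Integration.integrable_bound)
        show "integrable lborel (\<lambda>s. indicator {0..norm x} s *\<^sub>R (real k * s^(k-1)))"
          by (rule borel_integrable_compact) (auto intro!: continuous_intros)
      qed (auto simp: indicator_def)
      then show ?thesis by (intro integral_scaleR_left) (auto intro: integrable_mult_right)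
    qed simp
    also have "\<dots> = indicator (cball 0 1) x *\<^sub>R (norm x ^ k *\<^sub>R h (sgn x))"
      using * by simp
    finally show ?thesis .
  qed
  \<comment> \<open>At s = 0 the left side is 0, whereas for k = 1 the right side is v because
    \<open>0 ^ 0 = 1\<close>. A single point is negligible.\<close>
  have i2: "(\<integral>x. F (x,s) \<partial>lborel) = (indicator {0..1} s * (real k * s^(k-1) - real k * s^(?n+k-1))) *\<^sub>R v" if s0: "s \<noteq> 0" for s :: real
  proof (cases "0 < s \<and> s \<le> 1")
    case True
    have hb: "integrable lborel (\<lambda>x. indicator (cball 0 r) x *\<^sub>R h (sgn x))" for r
    proof (rule Bochner_Integration.integrable_bound)
      show "integrable lborel (\<lambda>x::real^'n. B * indicator (cball 0 r) x)"
        by (intro integrable_mult_right integrable_real_indicator) (auto simp: emeasure_lborel_cball_finite)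
      show "AE x in lborel. norm (indicator (cball 0 r) x *\<^sub>R h (sgn x)) \<le> norm (B * indicator (cball 0 r) x)"
        using bnd B0 by (auto simp: indicator_def norm_sgn)
    qed simp
    have sb: "AE x in lborel. norm (x :: real^'n) \<noteq> s"
    proof -
      have "negligible (sphere (0::real^'n) s)" by (rule negligible_sphere)
      then have "sphere (0::real^'n) s \<in> null_sets lborel"
        by (simp add: negligible_iff_null_sets null_sets_completion_iff)
      from AE_not_in[OF this] show ?thesis by eventually_elim auto
    qed
    have "(\<integral>x. F (x,s) \<partial>lborel) = (\<integral>x. (real k * s^(k-1)) *\<^sub>R (indicator (cball 0 1) x *\<^sub>R h (sgn x) - indicator (cball 0 s) x *\<^sub>R h (sgn x)) \<partial>lborel)"
    proof (rule integral_cong_AE)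
      show "(\<lambda>x. F (x, s)) \<in> borel_measurable lborel" 
        using measurable_compose[OF measurable_Pair2'[of s lborel lborel] Fm] by simp
      show "AE x in lborel. F (x, s) = (real k * s^(k-1)) *\<^sub>R (indicator (cball 0 1) x *\<^sub>R h (sgn x) - indicator (cball 0 s) x *\<^sub>R h (sgn x))"
        using sb by eventually_elim (use True in \<open>auto simp: F_def indicator_def\<close>)
    qed simp
    also have "\<dots> = (real k * s^(k-1)) *\<^sub>R (v - s^?n *\<^sub>R v)"
      using integral_cball_sgn[OF h, of s] True
      by (simp add: Bochner_Integration.integral_diff[OF hb hb] v_def)
    also have "\<dots> = (indicator {0..1} s * (real k * s^(k-1) - real k * s^(?n+k-1))) *\<^sub>R v"
    proof -
      have "?n + k - 1 = (k-1) + ?n" using k by simp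
      then have "s^(?n+k-1) = s^(k-1) * s^?n" by (simp add: power_add)
      then show ?thesis using True by (simp add: algebra_simps)
    qed
    finally show ?thesis .
  next
    case False
    then have "F (x,s) = 0" for x by (auto simp: F_def indicator_def)
    then show ?thesis using False s0 by (auto simp: indicator_def)
  qed
  have "(\<integral>x. indicator (cball 0 1) x *\<^sub>R (norm x ^ k *\<^sub>R h (sgn x)) \<partial>lborel) = (\<integral>x. (\<integral>s. F (x,s) \<partial>lborel) \<partial>lborel)"
    by (simp add: i1)
  also have "\<dots> = (\<integral>s. (\<integral>x. F (x,s) \<partial>lborel) \<partial>lborel)"
    by (rule lborel_pair.Fubini_integral[symmetric]) (use Fint in simp)
  also have "\<dots> = (\<integral>s. (indicator {0..1} s * (real k * s^(k-1) - real k * s^(?n+k-1))) *\<^sub>R v \<partial>lborel)"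
  proof (rule integral_cong_AE)
    show "(\<lambda>s. \<integral>x. F (x,s) \<partial>lborel) \<in> borel_measurable lborel"
      by (rule lborel.borel_measurable_lebesgue_integral) (rule measurable_pair_swap[OF Fm])
    show "AE s in lborel. (\<integral>x. F (x,s) \<partial>lborel) = (indicator {0..1} s * (real k * s^(k-1) - real k * s^(?n+k-1))) *\<^sub>R v"
      using AE_lborel_singleton[of "0::real"] by eventually_elim (rule i2)
  qed simp
  also have "\<dots> = (\<integral>s. indicator {0..1} s * (real k * s^(k-1) - real k * s^(?n+k-1)) \<partial>lborel) *\<^sub>R v"
  proof (cases "v = 0")
    case False
    have "integrable lborel (\<lambda>s::real. indicator {0..1} s *\<^sub>R (real k * s^(k-1) - real k * s^(?n+k-1)))"
      by (rule borel_integrable_compact) (auto intro!: continuous_intros)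
    then show ?thesis by (intro integral_scaleR_left) auto
  qed simp
  also have "(\<integral>s. indicator {0..1} s * (real k * s^(k-1) - real k * s^(?n+k-1)) \<partial>lborel)
     = (\<integral>s. (real k * s^(k-1) - real k * s^(?n+k-1)) * indicator {0..1} s \<partial>lborel)"
    by (simp add: mult.commute)
  also have "\<dots> = (1 ^ k - real k / real (?n+k) * 1 ^ (?n+k)) - (0 ^ k - real k / real (?n+k) * 0 ^ (?n+k))"
    by (rule integral_FTC_Icc_real[where F="\<lambda>s. s^k - real k / real (?n+k) * s^(?n+k)"])
       (use k in \<open>auto intro!: derivative_eq_intros continuous_intros\<close>)
  also have "\<dots> = real ?n / real (?n+k)" 
  proof -
    have "(0::real) ^ k = 0" "(0::real) ^ (?n+k) = 0" using k by auto
    then show ?thesis using k by (simp only: power_one) (simp add: field_simps)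
  qed
  finally show ?thesis using k unfolding v_def[symmetric] by (simp add: scaleR_conv_of_real field_simps del: of_nat_add)
qed


text \<open>The points of the open punctured ball whose direction lies where h is nonzero form an
  open set. The vanishing integral makes it null, but it would contain u / 2.\<close>

lemma sphm_charges_open:
  fixes h :: "real^'n \<Rightarrow> complex"
  assumes c: "continuous_on UNIV h" and z: "(\<integral>\<^sup>+u. ennreal ((norm (h u))\<^sup>2) \<partial>sphm) = 0" and u: "norm u = 1"
  shows "h u = 0"
proof (rule ccontr)
  assume nz: "h u \<noteq> 0"
  have hm[measurable]: "h \<in> borel_measurable borel" by (rule borel_measurable_continuous_onI[OF c])
  have "of_nat CARD('n) * (\<integral>\<^sup>+x. ennreal ((norm (h (sgn x)))\<^sup>2) * indicator (cball 0 1) x \<partial>lborel) = 0"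
    by (subst nn_integral_sphm[symmetric]) (use z in auto)
  then have "(\<integral>\<^sup>+x. ennreal ((norm (h (sgn x)))\<^sup>2) * indicator (cball 0 1) x \<partial>lborel) = 0" by simp
  then have AE: "AE x in lborel. ennreal ((norm (h (sgn x)))\<^sup>2) * indicator (cball 0 1) x = 0"
    by (subst (asm) nn_integral_0_iff_AE) auto
  define U where "U = {x \<in> ball 0 1 - {0}. h (x /\<^sub>R norm x) \<noteq> 0}"
  have oU: "open U"
  proof -
    have "continuous_on (ball 0 1 - {0}) (\<lambda>x. h (x /\<^sub>R norm x))"
      by (rule continuous_on_compose2[OF c]) (auto intro!: continuous_intros)
    then have "open ((\<lambda>x. h (x /\<^sub>R norm x)) -` (- {0}) \<inter> (ball 0 1 - {0}))"
      by (subst Int_commute) (intro continuous_open_preimage, auto)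
    then show ?thesis unfolding U_def by (rule back_subst[where P="open"]) auto
  qed
  have "(1/2) *\<^sub>R u \<in> U" using u nz by (auto simp: U_def)
  moreover have "AE x in lborel. x \<notin> U"
    using AE by eventually_elim (auto simp: U_def sgn_div_norm indicator_def)
  then have "U \<in> null_sets lborel" using oU
    by (subst (asm) AE_iff_null_sets[symmetric]) auto
  then have "negligible U" by (simp add: negligible_iff_null_sets null_sets_completionI)
  ultimately show False using open_not_negligible[OF oU] by auto
qed

section \<open>Homogeneous polynomials and the Laplacian\<close>

text \<open>An inductive description of homogeneous polynomials: facts about them are proved by
  induction on the construction instead of by handling coefficients.
  \<open>homogeneous_polynomial_iff\<close> identifies it with the given definition.\<close>

inductive homog :: "nat \<Rightarrow> (real^'n \<Rightarrow> complex) \<Rightarrow> bool" where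
  homog_const: "homog 0 (\<lambda>_. c)"
| homog_var: "homog k p \<Longrightarrow> homog (Suc k) (\<lambda>x. of_real (x $ i) * p x)"
| homog_add: "homog k p \<Longrightarrow> homog k q \<Longrightarrow> homog k (\<lambda>x. p x + q x)"

abbreviation pd :: "'n \<Rightarrow> (real ^ 'n \<Rightarrow> complex) \<Rightarrow> real ^ 'n \<Rightarrow> complex" where
  "pd \<equiv> partial_derivative"

lemma homog_zero: "homog k (\<lambda>_. 0)"
proof (induction k)
  case (Suc k)
  from homog_var[OF this, of undefined] show ?case by simp
qed (rule homog_const)

lemma homog_cmult: "homog k p \<Longrightarrow> homog k (\<lambda>x. c * p x)"
proof (induction rule: homog.induct)
  case (homog_const d)
  show ?case by (rule homog.homog_const)
next
  case (homog_var k p i)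
  from homog.homog_var[OF homog_var.IH, of i] show ?case by (simp add: mult_ac)
next
  case (homog_add k p q)
  from homog.homog_add[OF homog_add.IH] show ?case by (simp add: distrib_left)
qed

lemma homog_diff: "homog k p \<Longrightarrow> homog k q \<Longrightarrow> homog k (\<lambda>x. p x - q x)"
  using homog_add[OF _ homog_cmult[of k q "-1"]] by simp

lemma homog_sum: "(\<And>a. a \<in> A \<Longrightarrow> homog k (p a)) \<Longrightarrow> homog k (\<lambda>x. \<Sum>a\<in>A. p a x)"
proof (induction A rule: infinite_finite_induct)
  case (insert a A)
  then show ?case using homog_add[of k "p a"] by simp
qed (simp_all add: homog_zero)

lemma homog_mult: "homog k p \<Longrightarrow> homog m q \<Longrightarrow> homog (k + m) (\<lambda>x. p x * q x)"
proof (induction rule: homog.induct)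
  case (homog_const d)
  then show ?case by (simp add: homog_cmult)
next
  case (homog_var k p i)
  from homog.homog_var[OF homog_var.IH[OF homog_var.prems], of i] show ?case by (simp add: mult_ac)
next
  case (homog_add k p r)
  from homog.homog_add[OF homog_add.IH(1)[OF homog_add.prems] homog_add.IH(2)[OF homog_add.prems]] show ?case
    by (simp add: distrib_right)
qed

lemma homog_cnj: "homog k p \<Longrightarrow> homog k (\<lambda>x. cnj (p x))"
proof (induction rule: homog.induct)
  case (homog_const d)
  show ?case by (rule homog.homog_const)
next
  case (homog_var k p i)
  from homog.homog_var[OF homog_var.IH, of i] show ?case by simp
next
  case (homog_add k p q)
  from homog.homog_add[OF homog_add.IH] show ?case by simp
qed

lemma homog_scale: "homog k p \<Longrightarrow> p (t *\<^sub>R x) = of_real t ^ k * p x"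
  by (induction rule: homog.induct) (simp_all add: algebra_simps)

lemma homog_continuous: "homog k p \<Longrightarrow> continuous_on UNIV p"
  by (induction rule: homog.induct) (auto intro!: continuous_intros)

lemma homog_measurable[measurable_dest]: "homog k p \<Longrightarrow> p \<in> borel_measurable borel"
  by (intro borel_measurable_continuous_onI homog_continuous)

lemma homog_monomial: "homog (\<Sum>i\<in>UNIV. \<alpha> i) (\<lambda>x::real^'n. of_real (\<Prod>i\<in>UNIV. (x $ i) ^ \<alpha> i))"
proof -
  have pw: "homog m (\<lambda>x::real^'n. of_real (x $ i) ^ m)" for i m
  proof (induction m)
    case (Suc m)
    from homog_var[OF this, of i] show ?case by simp
  qed (simp add: homog_const)
  have "homog (\<Sum>i\<in>A. \<alpha> i) (\<lambda>x::real^'n. \<Prod>i\<in>A. of_real (x $ i) ^ \<alpha> i)" if "finite A" for A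
    using that
  proof induction
    case (insert a A)
    from homog_mult[OF pw[of "\<alpha> a" a] insert.IH] insert.hyps show ?case by simp
  qed (simp add: homog_const)
  from this[of UNIV] show ?thesis by simp
qed

lemma finite_multiindices: "finite {\<alpha> :: 'n::finite \<Rightarrow> nat. (\<Sum>i\<in>UNIV. \<alpha> i) = l}"
proof (rule finite_subset)
  show "{\<alpha> :: 'n \<Rightarrow> nat. (\<Sum>i\<in>UNIV. \<alpha> i) = l} \<subseteq> {\<alpha>. \<alpha> ` UNIV \<subseteq> {..l} \<and> (\<forall>x. x \<notin> UNIV \<longrightarrow> \<alpha> x = undefined)}"
    by (auto intro!: member_le_sum)
  show "finite {\<alpha> :: 'n \<Rightarrow> nat. \<alpha> ` UNIV \<subseteq> {..l} \<and> (\<forall>x. x \<notin> UNIV \<longrightarrow> \<alpha> x = undefined)}"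
    using finite_PiE[of "UNIV :: 'n set" "\<lambda>_. {..l}"]
    by (rule rev_finite_subset) (auto simp: PiE_def extensional_def)
qed

text \<open>The direction that needs work is from the generators back to coefficients:
  multiplication by a coordinate raises one exponent and so shifts the coefficient family.\<close>

lemma homogeneous_polynomial_iff: "homogeneous_polynomial l p \<longleftrightarrow> homog l p"
proof
  assume "homogeneous_polynomial l p"
  then obtain c where p: "p = (\<lambda>x. \<Sum>\<alpha> | (\<Sum>i\<in>UNIV. \<alpha> i) = l. c \<alpha> * of_real (\<Prod>i\<in>UNIV. (x $ i) ^ \<alpha> i))"
    unfolding homogeneous_polynomial_def by blast
  show "homog l p" unfolding p
  proof (intro homog_sum homog_cmult)
    fix \<alpha> :: "'a \<Rightarrow> nat" assume "\<alpha> \<in> {\<alpha>. (\<Sum>i\<in>UNIV. \<alpha> i) = l}"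
    then show "homog l (\<lambda>x. of_real (\<Prod>i\<in>UNIV. (x $ i) ^ \<alpha> i))" using homog_monomial[of \<alpha>] by simp
  qed
next
  assume "homog l p"
  then show "homogeneous_polynomial l p"
  proof (induction rule: homog.induct)
    case (homog_const c)
    have "{\<alpha> :: 'a \<Rightarrow> nat. (\<Sum>i\<in>UNIV. \<alpha> i) = 0} = {\<lambda>_. 0}" by auto
    then show ?case unfolding homogeneous_polynomial_def by (intro exI[of _ "\<lambda>_. c"]) simp
  next
    case (homog_var k p i)
    then obtain c where p: "p = (\<lambda>x. \<Sum>\<alpha> | (\<Sum>i\<in>UNIV. \<alpha> i) = k. c \<alpha> * of_real (\<Prod>i\<in>UNIV. (x $ i) ^ \<alpha> i))"
      unfolding homogeneous_polynomial_def by blast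
    \<comment> \<open>Coefficients after multiplication by the i-th coordinate: the exponent at i is
      lowered, and monomials free of that coordinate get 0.\<close>
    define c' where "c' = (\<lambda>\<alpha>. if \<alpha> i > 0 then c (\<alpha>(i := \<alpha> i - 1)) else 0)"
    show ?case unfolding homogeneous_polynomial_def
    proof (intro exI[of _ c'] ext)
      fix x :: "real^'a"
      let ?m = "\<lambda>\<alpha>. complex_of_real (\<Prod>i\<in>UNIV. (x $ i) ^ \<alpha> i)"
      let ?s = "\<lambda>\<alpha> :: 'a \<Rightarrow> nat. \<alpha>(i := Suc (\<alpha> i))"
      have sum_s: "(\<Sum>j\<in>UNIV. ?s \<alpha> j) = Suc (\<Sum>j\<in>UNIV. \<alpha> j)" for \<alpha>
        by (simp add: sum.remove[of UNIV i] cong: sum.cong_simp)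
      have m_s: "?m (?s \<alpha>) = of_real (x $ i) * ?m \<alpha>" for \<alpha>
        by (simp add: prod.remove[of UNIV i] cong: prod.cong_simp)
      have img: "?s ` {\<alpha>. (\<Sum>i\<in>UNIV. \<alpha> i) = k} = {\<alpha>. (\<Sum>i\<in>UNIV. \<alpha> i) = Suc k \<and> \<alpha> i > 0}"
      proof (intro set_eqI iffI)
        fix \<beta> assume "\<beta> \<in> {\<alpha>. (\<Sum>i\<in>UNIV. \<alpha> i) = Suc k \<and> \<alpha> i > 0}"
        then have *: "(\<Sum>i\<in>UNIV. \<beta> i) = Suc k" "\<beta> i > 0" by auto
        then have "\<beta> = ?s (\<beta>(i := \<beta> i - 1))" by auto
        moreover from this have "(\<Sum>j\<in>UNIV. (\<beta>(i := \<beta> i - 1)) j) = k" using sum_s[of "\<beta>(i := \<beta> i - 1)"] *(1) by simp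
        ultimately show "\<beta> \<in> ?s ` {\<alpha>. (\<Sum>i\<in>UNIV. \<alpha> i) = k}" by blast
      next
        fix \<beta> assume "\<beta> \<in> ?s ` {\<alpha>. (\<Sum>i\<in>UNIV. \<alpha> i) = k}"
        then obtain \<alpha> where \<alpha>: "(\<Sum>i\<in>UNIV. \<alpha> i) = k" "\<beta> = ?s \<alpha>" by auto
        then show "\<beta> \<in> {\<alpha>. (\<Sum>i\<in>UNIV. \<alpha> i) = Suc k \<and> \<alpha> i > 0}" using sum_s[of \<alpha>] by simp
      qed
      have inj: "inj_on ?s A" for A
      proof (rule inj_onI)
        fix \<alpha> \<beta> assume e: "?s \<alpha> = ?s \<beta>"
        show "\<alpha> = \<beta>"
        proof
          fix j show "\<alpha> j = \<beta> j" using fun_cong[OF e, of j] by (cases "j = i") auto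
        qed
      qed
      have "(\<Sum>\<alpha> | (\<Sum>i\<in>UNIV. \<alpha> i) = Suc k. c' \<alpha> * ?m \<alpha>) = (\<Sum>\<alpha> | (\<Sum>i\<in>UNIV. \<alpha> i) = Suc k \<and> \<alpha> i > 0. c' \<alpha> * ?m \<alpha>)"
        by (rule sum.mono_neutral_right) (auto simp: finite_multiindices c'_def)
      also have "\<dots> = (\<Sum>\<alpha> | (\<Sum>i\<in>UNIV. \<alpha> i) = k. c' (?s \<alpha>) * ?m (?s \<alpha>))"
        unfolding img[symmetric] by (subst sum.reindex[OF inj]) simp
      also have "\<dots> = (\<Sum>\<alpha> | (\<Sum>i\<in>UNIV. \<alpha> i) = k. of_real (x $ i) * (c \<alpha> * ?m \<alpha>))"
        by (intro sum.cong refl) (simp only: m_s, simp add: c'_def)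
      also have "\<dots> = of_real (x $ i) * p x" by (simp add: p sum_distrib_left)
      finally show "of_real (x $ i) * p x = (\<Sum>\<alpha> | (\<Sum>i\<in>UNIV. \<alpha> i) = Suc k. c' \<alpha> * ?m \<alpha>)" ..
    qed
  next
    case (homog_add k p q)
    then obtain c d where p: "p = (\<lambda>x. \<Sum>\<alpha> | (\<Sum>i\<in>UNIV. \<alpha> i) = k. c \<alpha> * of_real (\<Prod>i\<in>UNIV. (x $ i) ^ \<alpha> i))"
      and q: "q = (\<lambda>x. \<Sum>\<alpha> | (\<Sum>i\<in>UNIV. \<alpha> i) = k. d \<alpha> * of_real (\<Prod>i\<in>UNIV. (x $ i) ^ \<alpha> i))"
      unfolding homogeneous_polynomial_def by blast
    show ?case unfolding homogeneous_polynomial_def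
      by (intro exI[of _ "\<lambda>\<alpha>. c \<alpha> + d \<alpha>"]) (simp add: p q distrib_right sum.distrib)
  qed
qed

section \<open>Partial derivatives of homogeneous polynomials\<close>

lemma sum_axis: "(\<Sum>j\<in>UNIV. complex_of_real (axis i 1 $ j) * D j) = D (i :: 'n :: finite)"
proof -
  have "(\<Sum>j\<in>UNIV. complex_of_real (axis i 1 $ j) * D j) = (\<Sum>j\<in>UNIV. if j = i then D j else 0)"
    by (intro sum.cong) (auto simp: axis_def)
  then show ?thesis by simp
qed

text \<open>\<open>partial_derivative\<close> is a choice term that has a value even without
  differentiability; a total derivative with coefficients \<open>D i\<close> pins it down.\<close>

lemma pd_eqI:
  assumes "(p has_derivative (\<lambda>u. \<Sum>i\<in>UNIV. of_real (u $ i) * D i)) (at (x :: real^'n))"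
  shows "pd i p x = D i"
proof -
  have "((\<lambda>t. p (x + t *\<^sub>R axis i 1)) has_derivative (\<lambda>t. \<Sum>j\<in>UNIV. of_real ((t *\<^sub>R axis i 1) $ j) * D j)) (at 0)"
    by (rule has_derivative_compose[where f="\<lambda>t. x + t *\<^sub>R axis i 1" and g=p]) (use assms in \<open>auto intro!: derivative_eq_intros\<close>)
  moreover have "(\<lambda>t. \<Sum>j\<in>UNIV. of_real ((t *\<^sub>R axis i 1) $ j) * D j) = (\<lambda>t. t *\<^sub>R D i)"
  proof
    fix t
    have "(\<Sum>j\<in>UNIV. of_real ((t *\<^sub>R axis i 1) $ j) * D j) = of_real t * (\<Sum>j\<in>UNIV. complex_of_real (axis i 1 $ j) * D j)"
      by (simp add: sum_distrib_left mult_ac)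
    then show "(\<Sum>j\<in>UNIV. of_real ((t *\<^sub>R axis i 1) $ j) * D j) = t *\<^sub>R D i"
      by (simp only: sum_axis) (simp add: scaleR_conv_of_real)
  qed
  ultimately have "((\<lambda>t. p (x + t *\<^sub>R axis i 1)) has_vector_derivative D i) (at 0)"
    by (simp add: has_vector_derivative_def)
  then show ?thesis unfolding partial_derivative_def by (rule vector_derivative_at)
qed

text \<open>The derivative is first exhibited with candidate polynomials, since \<open>pd\<close>
  can be evaluated only once differentiability is known. The case k = 0 is recorded apart: by
  truncated subtraction \<open>k - 1\<close> is then 0, and homogeneity of degree 0 would only say
  constant.\<close>

lemma homog_deriv_ex: "homog k (p :: real^'n \<Rightarrow> complex) \<Longrightarrow>
  \<exists>D. (\<forall>i. homog (k - 1) (D i)) \<and> (k = 0 \<longrightarrow> (\<forall>i x. D i x = 0)) \<and>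
   (\<forall>x. (p has_derivative (\<lambda>u. \<Sum>i\<in>UNIV. of_real (u $ i) * D i x)) (at x))"
proof (induction rule: homog.induct)
  case (homog_const c)
  show ?case by (rule exI[of _ "\<lambda>i x. 0"]) (auto simp: homog.homog_const)
next
  case (homog_var k p j)
  then obtain D where D: "\<And>i. homog (k - 1) (D i)" "k = 0 \<longrightarrow> (\<forall>i x. D i x = 0)"
    "\<And>x. (p has_derivative (\<lambda>u. \<Sum>i\<in>UNIV. of_real (u $ i) * D i x)) (at x)" by blast
  define D' where "D' = (\<lambda>i x. (if i = j then p x else 0) + of_real (x $ j) * D i x)"
  have "homog k (D' i)" for i
  proof -
    have 1: "homog k (\<lambda>x. if i = j then p x else 0)" using homog_var.hyps homog_zero[of k] by (cases "i = j") auto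
    have 2: "homog k (\<lambda>x. of_real (x $ j) * D i x)"
    proof (cases k)
      case 0 then show ?thesis using D(2) by (simp add: homog_zero)
    next
      case (Suc m) then show ?thesis using homog.homog_var[OF D(1)[of i], of j] by simp
    qed
    show ?thesis unfolding D'_def by (rule homog.homog_add[OF 1 2])
  qed
  moreover have "((\<lambda>x. of_real (x $ j) * p x) has_derivative (\<lambda>u. \<Sum>i\<in>UNIV. of_real (u $ i) * D' i x)) (at x)" for x
  proof -
    have "((\<lambda>x. complex_of_real (x $ j) * p x) has_derivative (\<lambda>u. of_real (x $ j) * (\<Sum>i\<in>UNIV. of_real (u $ i) * D i x) + of_real (u $ j) * p x)) (at x)"
      by (auto intro!: derivative_eq_intros D(3) bounded_linear.has_derivative[OF bounded_linear_vec_nth])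
    moreover have "(\<lambda>u. of_real (x $ j) * (\<Sum>i\<in>UNIV. of_real (u $ i) * D i x) + of_real (u $ j) * p x) = (\<lambda>u. \<Sum>i\<in>UNIV. of_real (u $ i) * D' i x)"
    proof
      fix u :: "real^'n"
      have "(\<Sum>i\<in>UNIV. of_real (u $ i) * D' i x) = (\<Sum>i\<in>UNIV. (if i = j then of_real (u $ i) * p x else 0) + of_real (x $ j) * (of_real (u $ i) * D i x))"
        by (intro sum.cong) (auto simp: D'_def algebra_simps)
      also have "\<dots> = of_real (u $ j) * p x + of_real (x $ j) * (\<Sum>i\<in>UNIV. of_real (u $ i) * D i x)"
        by (simp add: sum.distrib sum_distrib_left)
      finally show "of_real (x $ j) * (\<Sum>i\<in>UNIV. of_real (u $ i) * D i x) + of_real (u $ j) * p x = (\<Sum>i\<in>UNIV. of_real (u $ i) * D' i x)" by simp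
    qed
    ultimately show ?thesis by simp
  qed
  ultimately show ?case by (intro exI[of _ D']) auto
next
  case (homog_add k p q)
  then obtain D D' where D: "\<And>i. homog (k - 1) (D i)" "k = 0 \<longrightarrow> (\<forall>i x. D i x = 0)"
    "\<And>x. (p has_derivative (\<lambda>u. \<Sum>i\<in>UNIV. of_real (u $ i) * D i x)) (at x)"
   and D': "\<And>i. homog (k - 1) (D' i)" "k = 0 \<longrightarrow> (\<forall>i x. D' i x = 0)"
    "\<And>x. (q has_derivative (\<lambda>u. \<Sum>i\<in>UNIV. of_real (u $ i) * D' i x)) (at x)" by blast
  have "((\<lambda>x. p x + q x) has_derivative (\<lambda>u. \<Sum>i\<in>UNIV. of_real (u $ i) * (D i x + D' i x))) (at x)" for x
    using has_derivative_add[OF D(3) D'(3)] by (simp add: distrib_left sum.distrib)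
  then show ?case using D(1,2) D'(1,2) by (intro exI[of _ "\<lambda>i x. D i x + D' i x"]) (auto intro!: homog.homog_add)
qed

lemma homog_pd_all:
  assumes "homog k (p :: real^'n \<Rightarrow> complex)"
  shows "(\<forall>i. homog (k - 1) (pd i p)) \<and> (\<forall>x. (p has_derivative (\<lambda>u. \<Sum>i\<in>UNIV. of_real (u $ i) * pd i p x)) (at x))
     \<and> (k = 0 \<longrightarrow> (\<forall>i. pd i p = (\<lambda>_. 0)))"
proof -
  obtain D where D: "\<And>i. homog (k - 1) (D i)" "k = 0 \<longrightarrow> (\<forall>i x. D i x = 0)"
    "\<And>x. (p has_derivative (\<lambda>u. \<Sum>i\<in>UNIV. of_real (u $ i) * D i x)) (at x)"
    using homog_deriv_ex[OF assms] by blast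
  have e: "pd i p = D i" for i using pd_eqI[OF D(3)] by (intro ext)
  show ?thesis unfolding e using D by auto
qed

lemma homog_pd: "homog k p \<Longrightarrow> homog (k - 1) (pd i p)"
  and homog_has_derivative: "homog k p \<Longrightarrow> (p has_derivative (\<lambda>u. \<Sum>i\<in>UNIV. of_real (u $ i) * pd i p x)) (at x)"
  and pd_homog_0: "homog k p \<Longrightarrow> k = 0 \<Longrightarrow> pd i p = (\<lambda>_. 0)"
  using homog_pd_all by blast+

lemma pd_add:
  assumes "homog k p" "homog m q" shows "pd i (\<lambda>x. p x + q x) = (\<lambda>x. pd i p x + pd i q x)"
proof
  fix x
  show "pd i (\<lambda>x. p x + q x) x = pd i p x + pd i q x"
    by (rule pd_eqI) (use has_derivative_add[OF homog_has_derivative[OF assms(1)] homog_has_derivative[OF assms(2)], of x]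
       in \<open>simp add: distrib_left sum.distrib\<close>)
qed

lemma pd_zero: "pd i (\<lambda>_. 0) = (\<lambda>_. 0)"
  by (rule pd_homog_0[OF homog_const refl])

lemma pd_cmult:
  assumes "homog k p" shows "pd i (\<lambda>x. c * p x) = (\<lambda>x. c * pd i p x)"
proof
  fix x
  show "pd i (\<lambda>x. c * p x) x = c * pd i p x"
    by (rule pd_eqI) (use has_derivative_mult_right[OF homog_has_derivative[OF assms(1)], of c x]
       in \<open>simp add: sum_distrib_left mult_ac\<close>)
qed

lemma pd_sum:
  assumes "finite A" "\<And>a. a \<in> A \<Longrightarrow> homog (k a) (p a)"
  shows "pd i (\<lambda>x. \<Sum>a\<in>A. p a x) = (\<lambda>x. \<Sum>a\<in>A. pd i (p a) x)"
proof
  fix x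
  show "pd i (\<lambda>x. \<Sum>a\<in>A. p a x) x = (\<Sum>a\<in>A. pd i (p a) x)"
  proof (rule pd_eqI)
    have "((\<lambda>x. \<Sum>a\<in>A. p a x) has_derivative (\<lambda>u. \<Sum>a\<in>A. \<Sum>i\<in>UNIV. of_real (u $ i) * pd i (p a) x)) (at x)"
      by (rule has_derivative_sum) (rule homog_has_derivative[OF assms(2)])
    then show "((\<lambda>x. \<Sum>a\<in>A. p a x) has_derivative (\<lambda>u. \<Sum>i\<in>UNIV. of_real (u $ i) * (\<Sum>a\<in>A. pd i (p a) x))) (at x)"
      by (subst (asm) sum.swap) (simp add: sum_distrib_left)
  qed
qed

lemma pd_mult:
  assumes "homog k p" "homog m q" shows "pd i (\<lambda>x. p x * q x) = (\<lambda>x. p x * pd i q x + pd i p x * q x)"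
proof
  fix x
  show "pd i (\<lambda>x. p x * q x) x = p x * pd i q x + pd i p x * q x"
    by (rule pd_eqI) (use has_derivative_mult[OF homog_has_derivative[OF assms(1)] homog_has_derivative[OF assms(2)], of x]
       in \<open>simp add: algebra_simps sum.distrib sum_distrib_left\<close>)
qed

lemma homog_coord: "homog 1 (\<lambda>x. of_real (x $ i))"
  using homog_var[OF homog_const[of 1], of i] by simp

lemma pd_coord: "pd i (\<lambda>x::real^'n. of_real (x $ j)) = (\<lambda>_. if i = j then 1 else 0)"
proof
  fix x
  have e: "(\<lambda>u :: real^'n. complex_of_real (u $ j)) = (\<lambda>u. \<Sum>i\<in>UNIV. of_real (u $ i) * (if i = j then 1 else 0))"
    by (simp add: if_distrib[of "\<lambda>t. _ * t"] cong: if_cong)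
  show "pd i (\<lambda>x::real^'n. of_real (x $ j)) x = (if i = j then 1 else 0)"
    by (rule pd_eqI[where D="\<lambda>i. if i = j then 1 else 0"], unfold e[symmetric])
       (auto intro!: derivative_eq_intros bounded_linear.has_derivative[OF bounded_linear_vec_nth])
qed

lemma pd_var:
  assumes "homog k p"
  shows "pd i (\<lambda>x. of_real (x $ j) * p x) = (\<lambda>x. of_real (x $ j) * pd i p x + (if i = j then p x else 0))"
  using pd_mult[OF homog_coord assms, of i j] by (auto simp: pd_coord fun_eq_iff)

text \<open>Induction on the polynomial instead of the symmetry of second derivatives: the product
  rule with a coordinate yields an expression symmetric in i and j.\<close>

lemma pd_commute: "homog k p \<Longrightarrow> pd i (pd j p) = pd j (pd i p)"
proof (induction rule: homog.induct)
  case (homog_const c)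
  show ?case by (simp add: pd_homog_0[OF homog.homog_const refl])
next
  case (homog_var k p l)
  have 1: "pd i (\<lambda>x. of_real (x $ l) * pd j p x + (if j = l then p x else 0)) = (\<lambda>x. (of_real (x $ l) * pd i (pd j p) x + (if i = l then pd j p x else 0)) + (if j = l then pd i p x else 0))" for i j
  proof -
    have r: "homog k (\<lambda>x. if j = l then p x else 0)" using homog_var.hyps homog_zero[of k] by (cases "j = l") auto
    have "pd i (\<lambda>x. if j = l then p x else 0) = (\<lambda>x. if j = l then pd i p x else 0)"
      by (auto simp: pd_zero)
    then show ?thesis
      by (subst pd_add[OF homog.homog_var[OF homog_pd[OF homog_var.hyps]] r]) (simp add: pd_var[OF homog_pd[OF homog_var.hyps]])
  qed
  show ?case unfolding pd_var[OF homog_var.hyps] 1 homog_var.IH by (auto simp: fun_eq_iff)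
next
  case (homog_add k p q)
  then show ?case
    by (simp add: pd_add[OF homog_add.hyps] pd_add[OF homog_pd homog_pd, OF homog_add.hyps])
qed

lemma euler: "homog k p \<Longrightarrow> (\<Sum>i\<in>UNIV. of_real (x $ i) * pd i p x) = of_nat k * p x"
proof (induction rule: homog.induct)
  case (homog_const c)
  show ?case by (simp add: pd_homog_0[OF homog.homog_const refl])
next
  case (homog_var k p j)
  have "(\<Sum>i\<in>UNIV. of_real (x $ i) * (of_real (x $ j) * pd i p x + (if i = j then p x else 0))) = 
     of_real (x $ j) * (\<Sum>i\<in>UNIV. of_real (x $ i) * pd i p x) + (\<Sum>i\<in>UNIV. if i = j then of_real (x $ i) * p x else 0)"
    unfolding sum_distrib_left sum.distrib[symmetric] by (intro sum.cong) (auto simp: algebra_simps)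
  then show ?case unfolding pd_var[OF homog_var.hyps] by (simp only: homog_var.IH) (simp add: algebra_simps)
next
  case (homog_add k p q)
  then show ?case by (simp add: pd_add[OF homog_add.hyps] distrib_left sum.distrib)
qed

section \<open>The Laplacian, solid harmonics and the harmonic decomposition\<close>

lemma homog_laplacian: "homog k p \<Longrightarrow> homog (k - 2) (laplacian p)"
  unfolding laplacian_def[abs_def] using homog_pd[OF homog_pd, of k p] by (intro homog_sum) (simp add: numeral_2_eq_2)

lemma laplacian_small: "homog k p \<Longrightarrow> k < 2 \<Longrightarrow> laplacian p x = 0"
  unfolding laplacian_def by (subst pd_homog_0[OF homog_pd, of k p]) auto

lemma laplacian_add: "homog k p \<Longrightarrow> homog m q \<Longrightarrow> laplacian (\<lambda>x. p x + q x) x = laplacian p x + laplacian q x"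
  unfolding laplacian_def by (subst pd_add, assumption, assumption, subst pd_add[OF homog_pd homog_pd], assumption, assumption) (simp add: sum.distrib)

lemma laplacian_cmult: "homog k p \<Longrightarrow> laplacian (\<lambda>x. c * p x) x = c * laplacian p x"
  unfolding laplacian_def by (subst pd_cmult, assumption, subst pd_cmult[OF homog_pd], assumption) (simp add: sum_distrib_left)

lemma laplacian_sum:
  assumes "finite A" "\<And>a. a \<in> A \<Longrightarrow> homog (k a) (p a)"
  shows "laplacian (\<lambda>x. \<Sum>a\<in>A. p a x) x = (\<Sum>a\<in>A. laplacian (p a) x)"
proof -
  have "pd i (pd i (\<lambda>x. \<Sum>a\<in>A. p a x)) x = (\<Sum>a\<in>A. pd i (pd i (p a)) x)" for i
    using pd_sum[of A k p i, OF assms] pd_sum[of A "\<lambda>a. k a - 1" "\<lambda>a. pd i (p a)" i, OF assms(1) homog_pd[OF assms(2)]]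
    by simp
  then show ?thesis unfolding laplacian_def by (simp add: sum.swap[of _ A])
qed

lemma laplacian_mult:
  assumes p: "homog k p" and q: "homog m q"
  shows "laplacian (\<lambda>x. p x * q x) x = p x * laplacian q x + laplacian p x * q x + 2 * (\<Sum>i\<in>UNIV. pd i p x * pd i q x)"
  unfolding laplacian_def pd_mult[OF p q]
  by (subst pd_add[OF homog_mult[OF p homog_pd[OF q]] homog_mult[OF homog_pd[OF p] q]])
     (simp add: pd_mult[OF p homog_pd[OF q]] pd_mult[OF homog_pd[OF p] q] sum.distrib sum_distrib_left sum_distrib_right)

text \<open>Complex valued, so that |x|^2 is itself a homogeneous polynomial of degree 2.\<close>

definition norm_sq :: "real^'n \<Rightarrow> complex" where "norm_sq x = of_real ((norm x)\<^sup>2)"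

lemma norm_sq_eq: "norm_sq = (\<lambda>x::real^'n. \<Sum>i\<in>UNIV. of_real (x $ i) * of_real (x $ i))"
  by (auto simp: norm_sq_def fun_eq_iff norm_vec_def L2_set_def sum_nonneg power2_eq_square simp flip: of_real_mult of_real_sum)

lemma homog_norm_sq: "homog 2 norm_sq"
  unfolding norm_sq_eq using homog_mult[OF homog_coord homog_coord] by (intro homog_sum) (simp add: numeral_2_eq_2)

lemma pd_norm_sq: "pd (i :: 'a::finite) norm_sq = (\<lambda>x. 2 * of_real (x $ i))"
proof -
  have "pd i norm_sq = (\<lambda>x::real^'a. \<Sum>j\<in>UNIV. pd i (\<lambda>x. of_real (x $ j) * of_real (x $ j)) x)"
    unfolding norm_sq_eq by (rule pd_sum[where k="\<lambda>_. 2"]) (use homog_mult[OF homog_coord homog_coord] in \<open>auto simp: numeral_2_eq_2\<close>)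
  also have "\<dots> = (\<lambda>x. \<Sum>j\<in>UNIV. if i = j then 2 * of_real (x $ j) else 0)"
  proof (intro ext sum.cong refl)
    fix x :: "real^'a" and j
    show "pd i (\<lambda>x. of_real (x $ j) * of_real (x $ j)) x = (if i = j then 2 * of_real (x $ j) else 0)"
      unfolding pd_mult[OF homog_coord homog_coord] by (simp add: pd_coord)
  qed
  also have "\<dots> = (\<lambda>x. 2 * of_real (x $ i))" by simp
  finally show ?thesis .
qed

lemma laplacian_norm_sq: "laplacian norm_sq (x :: real^'n) = of_nat (2 * CARD('n))"
  unfolding laplacian_def pd_norm_sq by (simp add: pd_cmult[OF homog_coord] pd_coord)

text \<open>The cross term of the product rule is 4 times the sum of x_i times the i-th derivative
  of p, hence 4 k p by Euler's identity; the term 2 n p comes from the Laplacian of |x|^2.\<close>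

lemma laplacian_norm_sq_mult:
  assumes "homog k p"
  shows "laplacian (\<lambda>x :: real^'n. norm_sq x * p x) x = norm_sq x * laplacian p x + of_nat (2 * CARD('n) + 4 * k) * p x"
  using euler[OF assms, of x]
  by (simp add: laplacian_mult[OF homog_norm_sq assms] laplacian_norm_sq pd_norm_sq mult.assoc sum_distrib_left[symmetric] algebra_simps)

text \<open>The polynomials behind \<open>spherical_harmonics\<close> before restriction:
  differentiation needs them on a neighbourhood of the sphere.\<close>

definition solid_harm :: "nat \<Rightarrow> (real^'n \<Rightarrow> complex) \<Rightarrow> bool" where
  "solid_harm k p \<longleftrightarrow> homog k p \<and> (\<forall>x. laplacian p x = 0)"

lemma spherical_harmonics_eq: "spherical_harmonics l = {restrict p unit_sphere | p. solid_harm l p}"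
  by (simp add: spherical_harmonics_def solid_harm_def homogeneous_polynomial_iff)

lemma homog_norm_sq_power: "homog k p \<Longrightarrow> homog (2 * j + k) (\<lambda>x. norm_sq x ^ j * p x)"
proof (induction j)
  case (Suc j)
  from homog_mult[OF homog_norm_sq Suc.IH[OF Suc.prems]] show ?case by (simp add: mult_ac)
qed simp

text \<open>What matters is that the factor a is positive: it can be divided by in
  \<open>harmonic_decomposition\<close>. Each further factor |x|^2 adds 2 n plus 4 times the current
  degree.\<close>

lemma laplacian_norm_sq_power:
  assumes "solid_harm k p"
  shows "\<exists>a>0. \<forall>x::real^'n. laplacian (\<lambda>x. norm_sq x ^ Suc j * p x) x = of_real a * (norm_sq x ^ j * p x)"
proof (induction j)
  case 0
  have "0 < CARD('n)" by (rule zero_less_card_finite)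
  then have "0 < real (2 * CARD('n) + 4 * k)" by linarith
  moreover have "laplacian (\<lambda>x. norm_sq x ^ Suc 0 * p x) x = of_real (real (2 * CARD('n) + 4 * k)) * (norm_sq x ^ 0 * p x)" for x :: "real^'n"
    using assms laplacian_norm_sq_mult[of k p x] by (simp add: solid_harm_def)
  ultimately show ?case by blast
next
  case (Suc j)
  then obtain a where a: "a > 0" "\<And>x::real^'n. laplacian (\<lambda>x. norm_sq x ^ Suc j * p x) x = of_real a * (norm_sq x ^ j * p x)" by blast
  have r: "homog (2 * Suc j + k) (\<lambda>x. norm_sq x ^ Suc j * p x)" using assms homog_norm_sq_power[of k p "Suc j"] by (simp add: solid_harm_def)
  have "laplacian (\<lambda>x. norm_sq x ^ Suc (Suc j) * p x) x = of_real (a + real (2 * CARD('n) + 4 * (2 * Suc j + k))) * (norm_sq x ^ Suc j * p x)" for x :: "real^'n"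
  proof -
    have "laplacian (\<lambda>x. norm_sq x ^ Suc (Suc j) * p x) x = laplacian (\<lambda>x. norm_sq x * (norm_sq x ^ Suc j * p x)) x"
      by (simp add: mult_ac)
    also have "\<dots> = norm_sq x * laplacian (\<lambda>x. norm_sq x ^ Suc j * p x) x + of_nat (2 * CARD('n) + 4 * (2 * Suc j + k)) * (norm_sq x ^ Suc j * p x)"
      by (rule laplacian_norm_sq_mult[OF r])
    also have "\<dots> = of_real (a + real (2 * CARD('n) + 4 * (2 * Suc j + k))) * (norm_sq x ^ Suc j * p x)"
      unfolding a(2) by (simp add: algebra_simps)
    finally show ?thesis .
  qed
  then show ?case using a(1) by (intro exI[of _ "a + real (2 * CARD('n) + 4 * (2 * Suc j + k))"]) auto
qed

text \<open>By induction the Laplacian of P is already decomposed. Dividing its terms by the factors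
  from \<open>laplacian_norm_sq_power\<close> and raising the power of |x|^2 by one gives Q with the
  same Laplacian as P. Thus P - Q is harmonic and becomes the term j = 0.\<close>

theorem harmonic_decomposition:
  "homog k P \<Longrightarrow> \<exists>H. (\<forall>j. 2 * j \<le> k \<longrightarrow> solid_harm (k - 2 * j) (H j)) \<and> (\<forall>x::real^'n. P x = (\<Sum>j\<le>k div 2. norm_sq x ^ j * H j x))"
proof (induction k arbitrary: P rule: less_induct)
  case (less k)
  show ?case
  proof (cases "k < 2")
    case True
    then have "k div 2 = 0" by simp
    moreover have "solid_harm k P" using less.prems laplacian_small[OF less.prems True] by (simp add: solid_harm_def)
    ultimately show ?thesis using True by (intro exI[of _ "\<lambda>_. P"]) (auto dest!: order_le_less_trans)
  next
    case False
    define m where "m = k - 2"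
    have k: "k = m + 2" using False by (simp add: m_def)
    have "homog m (laplacian P)" using homog_laplacian[OF less.prems] by (simp add: m_def)
    from less.IH[OF _ this] k obtain H where H: "\<And>j. 2 * j \<le> m \<Longrightarrow> solid_harm (m - 2 * j) (H j)"
      "\<And>x. laplacian P x = (\<Sum>j\<le>m div 2. norm_sq x ^ j * H j x)" by auto
    have "\<exists>a>0. \<forall>x. laplacian (\<lambda>x. norm_sq x ^ Suc j * H j x) x = of_real a * (norm_sq x ^ j * H j x)" if "2 * j \<le> m" for j
      by (rule laplacian_norm_sq_power[OF H(1)[OF that]])
    then obtain a where a: "\<And>j. 2 * j \<le> m \<Longrightarrow> a j > (0::real)"
      "\<And>j x. 2 * j \<le> m \<Longrightarrow> laplacian (\<lambda>x. norm_sq x ^ Suc j * H j x) x = of_real (a j) * (norm_sq x ^ j * H j x)" by metis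
    define Q where "Q = (\<lambda>x. \<Sum>j\<le>m div 2. of_real (1 / a j) * (norm_sq x ^ Suc j * H j x))"
    have rj: "homog k (\<lambda>x. norm_sq x ^ Suc j * H j x)" if "2 * j \<le> m" for j
      using homog_norm_sq_power[of "m - 2 * j" "H j" "Suc j"] H(1)[OF that] that by (simp add: solid_harm_def k)
    have rQ: "homog k Q" unfolding Q_def by (intro homog_sum homog_cmult rj) auto
    have rja: "homog k (\<lambda>x. of_real (1 / a j) * (norm_sq x ^ Suc j * H j x))" if "2 * j \<le> m" for j
      by (rule homog_cmult[OF rj[OF that]])
    have "laplacian Q x = laplacian P x" for x
    proof -
      have "laplacian Q x = (\<Sum>j\<le>m div 2. laplacian (\<lambda>x. of_real (1 / a j) * (norm_sq x ^ Suc j * H j x)) x)"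
        unfolding Q_def by (rule laplacian_sum[where k="\<lambda>_. k"], simp) (rule rja, simp)
      also have "\<dots> = (\<Sum>j\<le>m div 2. norm_sq x ^ j * H j x)"
      proof (rule sum.cong[OF refl])
        fix j assume "j \<in> {..m div 2}"
        then have j: "2 * j \<le> m" by auto
        show "laplacian (\<lambda>x. of_real (1 / a j) * (norm_sq x ^ Suc j * H j x)) x = norm_sq x ^ j * H j x"
          unfolding laplacian_cmult[OF rj[OF j]] a(2)[OF j] using a(1)[OF j] by simp
      qed
      finally show ?thesis by (simp add: H(2))
    qed
    then have lap0: "laplacian (\<lambda>x. P x - Q x) x = 0" for x
      using laplacian_add[OF less.prems homog_cmult[OF rQ, of "-1"], of x] laplacian_cmult[OF rQ, of "-1" x] by simp
    \<comment> \<open>The index moves by one to account for the additional factor |x|^2 in the terms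
      of Q.\<close>
    define H' where "H' = (\<lambda>j. case j of 0 \<Rightarrow> (\<lambda>x. P x - Q x) | Suc i \<Rightarrow> (\<lambda>x. of_real (1 / a i) * H i x))"
    have "solid_harm (k - 2 * j) (H' j)" if "2 * j \<le> k" for j
    proof (cases j)
      case 0
      then show ?thesis using lap0 homog_diff[OF less.prems rQ] by (simp add: H'_def solid_harm_def)
    next
      case (Suc i)
      then have "2 * i \<le> m" using that k by simp
      from H(1)[OF this] have "solid_harm (m - 2 * i) (\<lambda>x. of_real (1 / a i) * H i x)"
        unfolding solid_harm_def using laplacian_cmult[of "m - 2 * i" "H i" "of_real (1 / a i)"] by (auto intro: homog_cmult simp del: of_real_divide)
      then show ?thesis using Suc k by (simp add: H'_def)
    qed
    moreover have "P x = (\<Sum>j\<le>k div 2. norm_sq x ^ j * H' j x)" for x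
    proof -
      have "k div 2 = Suc (m div 2)" using k by simp
      then have "(\<Sum>j\<le>k div 2. norm_sq x ^ j * H' j x) = H' 0 x + (\<Sum>j\<le>m div 2. norm_sq x ^ Suc j * H' (Suc j) x)"
        by (simp only: sum.atMost_Suc_shift) simp
      also have "\<dots> = P x" by (simp add: H'_def Q_def mult_ac)
      finally show ?thesis ..
    qed
    ultimately show ?thesis by blast
  qed
qed


text \<open>The direction \<open>u\<close> is complex although the base point is real: this extends the restriction of a polynomial
  to a real curve holomorphically, without polynomials on complex space.\<close>
fun taylor_term :: "nat \<Rightarrow> (real^'n \<Rightarrow> complex) \<Rightarrow> real^'n \<Rightarrow> ('n \<Rightarrow> complex) \<Rightarrow> complex" where
  "taylor_term 0 p x u = p x"
| "taylor_term (Suc k) p x u = (\<Sum>i\<in>UNIV. u i * taylor_term k (pd i p) x u)"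

text \<open>The squared Hilbert-Schmidt norm of the k-th derivative. All ordered k-tuples of indices
  occur, so it iterates through \<open>pd\<close> without multinomial weights.\<close>

fun deriv_sq :: "nat \<Rightarrow> (real^'n \<Rightarrow> complex) \<Rightarrow> real^'n \<Rightarrow> real" where
  "deriv_sq 0 p x = (norm (p x))\<^sup>2"
| "deriv_sq (Suc k) p x = (\<Sum>i\<in>UNIV. deriv_sq k (pd i p) x)"

lemma deriv_sq_nonneg: "deriv_sq k p x \<ge> 0"
  by (induction k arbitrary: p) (auto intro: sum_nonneg)

text \<open>Cauchy-Schwarz in one index at a time; the \<open>L2_set\<close> term is the Euclidean
  norm of the complex increment.\<close>

lemma norm_taylor_term:
  fixes p :: "real^'n \<Rightarrow> complex"
  shows "norm (taylor_term k p x u) \<le> L2_set (\<lambda>i. norm (u i)) UNIV ^ k * sqrt (deriv_sq k p x)"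
proof (induction k arbitrary: p)
  case (Suc k)
  let ?r = "L2_set (\<lambda>i. norm (u i)) UNIV"
  have "norm (taylor_term (Suc k) p x u) \<le> (\<Sum>i\<in>UNIV. \<bar>norm (u i)\<bar> * \<bar>norm (taylor_term k (pd i p) x u)\<bar>)"
    by (auto simp flip: norm_mult intro!: norm_sum)
  also have "\<dots> \<le> ?r * L2_set (\<lambda>i. norm (taylor_term k (pd i p) x u)) UNIV"
    by (rule L2_set_mult_ineq)
  also have "\<dots> \<le> ?r * L2_set (\<lambda>i. ?r ^ k * sqrt (deriv_sq k (pd i p) x)) UNIV"
    by (intro mult_left_mono L2_set_mono) (use Suc.IH in \<open>auto simp: L2_set_nonneg\<close>)
  also have "L2_set (\<lambda>i. ?r ^ k * sqrt (deriv_sq k (pd i p) x)) UNIV = ?r ^ k * sqrt (deriv_sq (Suc k) p x)"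
  proof -
    have "L2_set (\<lambda>i. sqrt (deriv_sq k (pd i p) x)) UNIV = sqrt (deriv_sq (Suc k) p x)"
      by (simp add: L2_set_def deriv_sq_nonneg)
    then show ?thesis by (subst L2_set_right_distrib[symmetric]) (simp_all add: L2_set_nonneg)
  qed
  finally show ?case by (simp only: power_Suc mult.assoc)
qed simp

lemma taylor_term_scale: "taylor_term k p x (\<lambda>i. c * u i) = c ^ k * taylor_term k p x u"
  by (induction k arbitrary: p) (simp_all add: sum_distrib_left mult_ac)

lemma taylor_term_holomorphic:
  assumes "\<And>i. (\<lambda>s. u s i) holomorphic_on A"
  shows "(\<lambda>s. taylor_term k p x (u s)) holomorphic_on A"
  by (induction k arbitrary: p) (auto intro!: holomorphic_intros assms)

text \<open>Polynomials of degree at most L, harmonic or not. By \<open>poly_sum_pd\<close>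
  differentiation lowers L, and the Taylor expansion is an induction on this L.\<close>

definition poly_sum :: "nat \<Rightarrow> (real^'n \<Rightarrow> complex) \<Rightarrow> bool" where
  "poly_sum L G \<longleftrightarrow> (\<exists>H. (\<forall>l. homog l (H l)) \<and> G = (\<lambda>x. \<Sum>l\<le>L. H l x))"

lemma poly_sum_has_derivative:
  assumes "poly_sum L G"
  shows "(G has_derivative (\<lambda>u. \<Sum>i\<in>UNIV. of_real (u $ i) * pd i G x)) (at x)"
proof -
  obtain H where H: "\<And>l. homog l (H l)" "G = (\<lambda>x. \<Sum>l\<le>L. H l x)" using assms unfolding poly_sum_def by blast
  have "((\<lambda>x. \<Sum>l\<le>L. H l x) has_derivative (\<lambda>u. \<Sum>l\<le>L. \<Sum>i\<in>UNIV. of_real (u $ i) * pd i (H l) x)) (at x)"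
    by (rule has_derivative_sum) (rule homog_has_derivative[OF H(1)])
  then show ?thesis unfolding H(2) pd_sum[OF finite_atMost H(1)] 
    by (subst (asm) sum.swap) (simp add: sum_distrib_left)
qed

lemma poly_sum_pd:
  assumes "poly_sum (Suc L) G" shows "poly_sum L (pd i G)"
proof -
  obtain H where H: "\<And>l. homog l (H l)" "G = (\<lambda>x. \<Sum>l\<le>Suc L. H l x)" using assms unfolding poly_sum_def by blast
  have "pd i G = (\<lambda>x. \<Sum>l\<le>L. pd i (H (Suc l)) x)"
    unfolding H(2) pd_sum[OF finite_atMost H(1)] by (subst sum.atMost_Suc_shift) (simp add: pd_homog_0[OF H(1)])
  moreover have "homog l (pd i (H (Suc l)))" for l using homog_pd[OF H(1), of "Suc l"] by simp
  ultimately show ?thesis unfolding poly_sum_def by (intro exI[of _ "\<lambda>l. pd i (H (Suc l))"]) auto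
qed

text \<open>Both sides are compared along the segment from x to x + u: their derivatives agree by
  the induction hypothesis for the partial derivatives, and they agree at the starting
  point.\<close>

lemma taylor_poly_sum:
  "poly_sum L G \<Longrightarrow> G (x + u) = (\<Sum>k\<le>L. taylor_term k G x (\<lambda>i. of_real (u $ i)) / fact k)"
proof (induction L arbitrary: G u)
  case 0
  then obtain H where H: "\<And>l. homog l (H l)" "G = (\<lambda>x. \<Sum>l\<le>0. H l x)" unfolding poly_sum_def by blast
  have "H 0 (x + u) = H 0 (0 *\<^sub>R x)" "H 0 x = H 0 (0 *\<^sub>R x)"
    using homog_scale[OF H(1)[of 0], of 0 "x + u"] homog_scale[OF H(1)[of 0], of 0 x] by simp_all
  then show ?case by (simp add: H(2))
next
  case (Suc L)
  let ?u = "\<lambda>i. complex_of_real (u $ i)"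
  define \<phi> where "\<phi> = (\<lambda>t. G (x + t *\<^sub>R u))"
  define \<psi> where "\<psi> = (\<lambda>t. \<Sum>k\<le>Suc L. of_real t ^ k * taylor_term k G x ?u / fact k)"
  define D where "D = (\<lambda>t. \<Sum>i\<in>UNIV. ?u i * pd i G (x + t *\<^sub>R u))"
  have \<phi>: "(\<phi> has_vector_derivative D t) (at t)" for t
  proof -
    have "(\<phi> has_derivative (\<lambda>s. \<Sum>i\<in>UNIV. of_real ((s *\<^sub>R u) $ i) * pd i G (x + t *\<^sub>R u))) (at t)"
      unfolding \<phi>_def by (rule has_derivative_compose[where f="\<lambda>t. x + t *\<^sub>R u" and g=G])
       (auto intro!: derivative_eq_intros poly_sum_has_derivative[OF Suc.prems])
    then show ?thesis by (simp add: has_vector_derivative_def D_def scaleR_conv_of_real[where 'a=complex] sum_distrib_left mult_ac)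
  qed
  have "(\<psi> has_vector_derivative (\<Sum>k\<le>L. of_real t ^ k * taylor_term (Suc k) G x ?u / fact k)) (at t)" for t
  proof -
    have tm: "((\<lambda>t. of_real t ^ Suc k * taylor_term (Suc k) G x ?u / fact (Suc k)) has_vector_derivative (of_real t ^ k * taylor_term (Suc k) G x ?u / fact k)) (at t)" for k
    proof -
      have "((\<lambda>z. z ^ Suc k * c) has_field_derivative (of_nat (Suc k) * z ^ k * c)) (at z)" for c z :: complex
        by (rule DERIV_cmult_right[OF DERIV_cong[OF DERIV_power[OF DERIV_ident]]]) simp
      from has_vector_derivative_real_field[OF this[of "taylor_term (Suc k) G x ?u / fact (Suc k)" "of_real t"], of UNIV]
      have "((\<lambda>t. of_real t ^ Suc k * (taylor_term (Suc k) G x ?u / fact (Suc k))) has_vector_derivative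
         (of_nat (Suc k) * of_real t ^ k * (taylor_term (Suc k) G x ?u / fact (Suc k)))) (at t)" .
      moreover have "of_nat (Suc k) * of_real t ^ k * (taylor_term (Suc k) G x ?u / fact (Suc k)) = of_real t ^ k * taylor_term (Suc k) G x ?u / fact k"
        unfolding fact_Suc by (simp del: of_nat_Suc taylor_term.simps)
      ultimately show ?thesis by (simp del: taylor_term.simps fact_Suc power_Suc)
    qed
    show ?thesis unfolding \<psi>_def sum.atMost_Suc_shift power_0
      by (rule has_vector_derivative_eq_rhs, rule has_vector_derivative_add, rule has_vector_derivative_const,
          rule has_vector_derivative_sum, rule tm) simp
  qed
  moreover have "(\<Sum>k\<le>L. of_real t ^ k * taylor_term (Suc k) G x ?u / fact k) = D t" for t
  proof -
    have "D t = (\<Sum>i\<in>UNIV. ?u i * (\<Sum>k\<le>L. of_real t ^ k * taylor_term k (pd i G) x ?u / fact k))"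
      unfolding D_def Suc.IH[OF poly_sum_pd[OF Suc.prems]]
      by (simp add: taylor_term_scale)
    then show ?thesis by (simp add: sum_distrib_left sum_divide_distrib mult_ac sum.swap[of _ UNIV])
  qed
  ultimately have \<psi>: "(\<psi> has_vector_derivative D t) (at t)" for t by simp
  have "\<exists>c. \<forall>t\<in>UNIV. \<phi> t - \<psi> t = c"
    by (rule has_derivative_zero_constant) (use has_vector_derivative_diff[OF \<phi> \<psi>] in \<open>auto simp: has_vector_derivative_def\<close>)
  then obtain c where c: "\<And>t. \<phi> t - \<psi> t = c" by auto
  have "\<psi> 0 = G x" unfolding \<psi>_def by (subst sum.atMost_Suc_shift) simp
  then have "c = 0" using c[of 0] by (simp add: \<phi>_def)
  with c[of 1] show ?case by (simp add: \<phi>_def \<psi>_def)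
qed

section \<open>Orthogonality of spherical harmonics and Bernstein inequalities\<close>

definition sph_int :: "(real^'n \<Rightarrow> complex) \<Rightarrow> complex" where "sph_int p = (\<integral>u. p u \<partial>sphm)"
definition ball_int :: "(real^'n \<Rightarrow> complex) \<Rightarrow> complex" where "ball_int p = (\<integral>x. indicator (cball 0 1) x *\<^sub>R p x \<partial>lborel)"

lemma integrable_cball:
  "continuous_on UNIV (p :: real^'n \<Rightarrow> complex) \<Longrightarrow> integrable lborel (\<lambda>x. indicator (cball 0 1) x *\<^sub>R p x)"
  by (rule borel_integrable_compact) (auto intro: continuous_on_subset)

lemma integrable_sphm:
  fixes p :: "real^'n \<Rightarrow> 'b :: {banach, second_countable_topology}"
  assumes "continuous_on UNIV p" shows "integrable sphm p"
proof -
  have "compact (p ` unit_sphere)" by (intro compact_continuous_image) (use assms in \<open>auto intro: continuous_on_subset\<close>)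
  then obtain B where B: "\<And>x. x \<in> unit_sphere \<Longrightarrow> norm (p x) \<le> B"
    using compact_imp_bounded bounded_iff by (metis imageI)
  show ?thesis
    by (rule sphm.integrable_const_bound[where B=B])
       (auto intro!: AE_I2 B measurable_sphmI borel_measurable_continuous_onI assms simp: space_sphere_measure)
qed

lemma sph_int_cmult: "sph_int (\<lambda>x. c * p x) = c * sph_int p"
  unfolding sph_int_def by simp

lemma sph_int_sum: "(\<And>a. a \<in> A \<Longrightarrow> continuous_on UNIV (p a)) \<Longrightarrow> sph_int (\<lambda>x. \<Sum>a\<in>A. p a x) = (\<Sum>a\<in>A. sph_int (p a))"
  unfolding sph_int_def by (intro Bochner_Integration.integral_sum integrable_sphm)

lemma sph_int_cong: "(\<And>x. norm x = 1 \<Longrightarrow> p x = q x) \<Longrightarrow> sph_int p = sph_int q"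
  unfolding sph_int_def by (intro Bochner_Integration.integral_cong refl) (auto simp: space_sphere_measure)

text \<open>Radial integration of a function homogeneous of degree k. That the factor depends on the
  degree is what \<open>sph_int_pd\<close> exploits.\<close>

lemma ball_moment:
  assumes P: "homog k (P :: real^'n \<Rightarrow> complex)"
  shows "of_nat (CARD('n) + k) * ball_int P = sph_int P"
proof -
  have m: "P \<in> borel_measurable borel" by (rule homog_measurable[OF P])
  have sc: "P x = norm x ^ k *\<^sub>R P (sgn x)" for x
  proof -
    have "norm x *\<^sub>R sgn x = x" by (cases "x = 0") (simp_all add: sgn_div_norm)
    then show ?thesis using homog_scale[OF P, of "norm x" "sgn x"] by (simp add: scaleR_conv_of_real[where 'a=complex])
  qed
  have "compact (P ` cball 0 1)" by (intro compact_continuous_image continuous_on_subset[OF homog_continuous[OF P]]) auto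
  then obtain B where B: "\<And>x. norm x \<le> 1 \<Longrightarrow> norm (P x) \<le> B"
    using compact_imp_bounded bounded_iff by (metis imageI mem_cball_0)
  have ball_int: "ball_int P = (\<integral>x. indicator (cball 0 1) x *\<^sub>R (norm x ^ k *\<^sub>R P (sgn x)) \<partial>lborel)"
    unfolding ball_int_def by (subst sc) (rule refl)
  show ?thesis
  proof (cases "k > 0")
    case True
    show ?thesis
      unfolding sph_int_def ball_int integral_sphm[OF m] by (rule integral_cball_norm_power[OF m B True])
  next
    \<comment> \<open>\<open>integral_cball_norm_power\<close> asks for positive k; for k = 0 the
      claim is the polar formula itself.\<close>
    case False
    then show ?thesis unfolding sph_int_def ball_int integral_sphm[OF m] by simp
  qed
qed

text \<open>For the cutoff in \<open>sph_int_pd\<close>: squaring removes the corner, so that the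
  cutoff is continuously differentiable across the unit sphere.\<close>

lemma max_sq_deriv: "((\<lambda>s::real. (max 0 s)\<^sup>2) has_real_derivative 2 * max 0 s) (at s)"
proof -
  consider "s > 0" | "s < 0" | "s = 0" by linarith
  then show ?thesis
  proof cases
    case 1
    have "((\<lambda>s. s\<^sup>2) has_real_derivative 2 * s) (at s)" by (auto intro!: derivative_eq_intros)
    then have "((\<lambda>s. (max 0 s)\<^sup>2) has_real_derivative 2 * s) (at s)"
      by (rule has_field_derivative_transform_within_open[where S="{0<..}"]) (use 1 in auto)
    then show ?thesis using 1 by simp
  next
    case 2
    have "((\<lambda>s. 0) has_real_derivative 0) (at s)" by (auto intro!: derivative_eq_intros)
    then have "((\<lambda>s. (max 0 s)\<^sup>2) has_real_derivative 0) (at s)"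
      by (rule has_field_derivative_transform_within_open[where S="{..<0}"]) (use 2 in auto)
    then show ?thesis using 2 by simp
  next
    case 3
    have "((\<lambda>h. (max 0 h)\<^sup>2 / h) \<longlongrightarrow> (0::real)) (at 0)"
    proof (rule Lim_null_comparison)
      show "\<forall>\<^sub>F h in at 0. norm ((max 0 h)\<^sup>2 / h) \<le> \<bar>h\<bar>"
        by (rule always_eventually) (auto simp: max_def power2_eq_square)
      show "((\<lambda>h::real. \<bar>h\<bar>) \<longlongrightarrow> 0) (at 0)" by (rule tendsto_eq_intros refl)+ simp
    qed
    then show ?thesis using 3 by (simp add: has_field_derivative_iff)
  qed
qed

lemma integral_translate:
  fixes \<psi> :: "real^'n \<Rightarrow> complex"
  assumes [measurable]: "\<psi> \<in> borel_measurable borel"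
  shows "(\<integral>x. \<psi> (c + x) \<partial>lborel) = (\<integral>x. \<psi> x \<partial>lborel)"
proof -
  have "(\<integral>x. \<psi> x \<partial>lborel) = (\<integral>x. \<psi> x \<partial>distr lborel borel ((+) c))" by (simp add: lborel_distr_plus)
  also have "\<dots> = (\<integral>x. \<psi> (c + x) \<partial>lborel)" by (rule integral_distr) auto
  finally show ?thesis ..
qed

text \<open>Integration by parts: Lebesgue measure is invariant under translation, so the integral of the
  difference quotients of a compactly supported \<open>C\<^sup>1\<close> function vanishes.\<close>
lemma integral_deriv_zero:
  fixes \<psi> D :: "real^'n \<Rightarrow> complex"
  assumes der: "\<And>x. ((\<lambda>t. \<psi> (x + t *\<^sub>R axis i 1)) has_vector_derivative D x) (at 0)"
    and cont: "continuous_on UNIV \<psi>" "continuous_on UNIV D"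
    and supp: "\<And>x. norm x \<ge> 1 \<Longrightarrow> \<psi> x = 0" "\<And>x. norm x \<ge> 1 \<Longrightarrow> D x = 0"
  shows "(\<integral>x. D x \<partial>lborel) = 0"
proof -
  let ?e = "axis i 1 :: real^'n"
  have [measurable]: "\<psi> \<in> borel_measurable borel" "D \<in> borel_measurable borel"
    by (intro borel_measurable_continuous_onI cont)+
  have "compact (D ` cball 0 1)" by (intro compact_continuous_image continuous_on_subset[OF cont(2)]) auto
  then obtain B0 where B0: "\<And>x. norm x \<le> 1 \<Longrightarrow> norm (D x) \<le> B0"
    using compact_imp_bounded bounded_iff by (metis imageI mem_cball_0)
  define B where "B = max 0 B0"
  have B: "norm (D x) \<le> B" for x
    using B0[of x] supp(2)[of x] by (cases "norm x \<le> 1") (auto simp: B_def)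
  have der': "((\<lambda>t. \<psi> (x + t *\<^sub>R ?e)) has_vector_derivative D (x + s *\<^sub>R ?e)) (at s)" for x s
  proof -
    have "((\<lambda>t. \<psi> ((x + s *\<^sub>R ?e) + (t - s) *\<^sub>R ?e)) has_vector_derivative 1 *\<^sub>R D (x + s *\<^sub>R ?e)) (at s)"
      by (rule vector_diff_chain_at[where f="\<lambda>t. t - s" and g="\<lambda>t. \<psi> ((x + s *\<^sub>R ?e) + t *\<^sub>R ?e)", unfolded o_def])
         (auto intro!: derivative_eq_intros der)
    then show ?thesis by (simp add: algebra_simps)
  qed
  \<comment> \<open>The Lipschitz bound dominates all difference quotients by one constant.\<close>
  have lip: "norm (\<psi> (x + h *\<^sub>R ?e) - \<psi> x) \<le> B * \<bar>h\<bar>" for x h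
  proof -
    have "norm (\<psi> (x + h *\<^sub>R ?e) - \<psi> (x + 0 *\<^sub>R ?e)) \<le> B * norm (h - 0)"
    proof (rule differentiable_bound[where S=UNIV and f="\<lambda>t. \<psi> (x + t *\<^sub>R ?e)" and f'="\<lambda>s u. u *\<^sub>R D (x + s *\<^sub>R ?e)"])
      show "((\<lambda>t. \<psi> (x + t *\<^sub>R ?e)) has_derivative (\<lambda>u. u *\<^sub>R D (x + s *\<^sub>R ?e))) (at s within UNIV)" for s
        using der' by (simp add: has_vector_derivative_def)
      show "onorm (\<lambda>u::real. u *\<^sub>R D (x + s *\<^sub>R ?e)) \<le> B" for s
        by (rule onorm_le) (use B[of "x + s *\<^sub>R ?e"] in \<open>simp add: mult.commute[of B] mult_left_mono\<close>)
    qed auto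
    then show ?thesis by simp
  qed
  define h where "h = (\<lambda>k. inverse (real (Suc k)))"
  have h: "h k > 0" "h k \<le> 1" "h \<longlonglongrightarrow> 0" for k
    using LIMSEQ_inverse_real_of_nat by (auto simp: h_def field_simps)
  define q where "q = (\<lambda>k x. (\<psi> (h k *\<^sub>R ?e + x) - \<psi> x) /\<^sub>R h k)"
  have intpsi: "integrable lborel \<psi>"
  proof -
    have "integrable lborel (\<lambda>x. indicator (cball 0 1) x *\<^sub>R \<psi> x)" by (rule integrable_cball[OF cont(1)])
    moreover have "(\<lambda>x. indicator (cball 0 1) x *\<^sub>R \<psi> x) = \<psi>"
      using supp(1) by (auto simp: fun_eq_iff indicator_def)
    ultimately show ?thesis by simp
  qed
  have intpsi2: "integrable lborel (\<lambda>x. \<psi> (c + x))" for c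
    using integrable_distr[of "(+) c" lborel borel \<psi>] intpsi by (simp add: lborel_distr_plus)
  have "(\<integral>x. q k x \<partial>lborel) = 0" for k
    unfolding q_def by (simp add: Bochner_Integration.integral_diff[OF intpsi2 intpsi] integral_translate)
  moreover have "(\<lambda>k. \<integral>x. q k x \<partial>lborel) \<longlonglongrightarrow> (\<integral>x. D x \<partial>lborel)"
  \<comment> \<open>Radius 2, because the shifts \<open>h k\<close> are at most 1 and the support
    lies in the unit ball.\<close>
  proof (rule integral_dominated_convergence[where w="\<lambda>x. B * indicator (cball 0 2) x"])
    show "integrable lborel (\<lambda>x::real^'n. B * indicator (cball 0 2) x)"
      by (intro integrable_mult_right integrable_real_indicator) auto
    show "AE x in lborel. (\<lambda>k. q k x) \<longlonglongrightarrow> D x"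
    proof (rule AE_I2)
      fix x
      have 1: "((\<lambda>t. norm (\<psi> (x + (0 + t) *\<^sub>R ?e) - \<psi> (x + 0 *\<^sub>R ?e) - t *\<^sub>R D x) / norm t) \<longlongrightarrow> 0) (at 0)"
        using der[of x] unfolding has_vector_derivative_def has_derivative_at by simp
      have 2: "norm (\<psi> (x + (0 + t) *\<^sub>R ?e) - \<psi> (x + 0 *\<^sub>R ?e) - t *\<^sub>R D x) / norm t = norm ((\<psi> (x + t *\<^sub>R ?e) - \<psi> x) /\<^sub>R t - D x)"
        if "t \<noteq> 0" for t
      proof -
        have "(\<psi> (x + t *\<^sub>R ?e) - \<psi> x) /\<^sub>R t - D x = (\<psi> (x + t *\<^sub>R ?e) - \<psi> x - t *\<^sub>R D x) /\<^sub>R t"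
          using that by (simp add: scaleR_diff_right)
        then show ?thesis by (simp add: divide_inverse mult.commute)
      qed
      from 1 have "((\<lambda>t. norm ((\<psi> (x + t *\<^sub>R ?e) - \<psi> x) /\<^sub>R t - D x)) \<longlongrightarrow> 0) (at 0)"
        by (rule Lim_transform_eventually) (use 2 in \<open>auto simp: eventually_at_filter\<close>)
      then have "((\<lambda>t. (\<psi> (x + t *\<^sub>R ?e) - \<psi> x) /\<^sub>R t) \<longlongrightarrow> D x) (at 0)"
        by (subst Lim_null) (simp add: tendsto_norm_zero_iff)
      moreover have "filterlim h (at 0) sequentially"
        by (rule filterlim_atI[OF h(3)]) (use h(1) in \<open>auto simp: less_imp_neq[THEN not_sym] intro!: always_eventually less_imp_neq[THEN not_sym]\<close>)
      ultimately have "((\<lambda>k. (\<psi> (x + h k *\<^sub>R ?e) - \<psi> x) /\<^sub>R h k) \<longlongrightarrow> D x) sequentially"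
        by (rule filterlim_compose)
      then show "(\<lambda>k. q k x) \<longlonglongrightarrow> D x" by (simp add: q_def add.commute)
    qed
    show "AE x in lborel. norm (q k x) \<le> B * indicator (cball 0 2) x" for k
    proof (rule AE_I2)
      fix x :: "real^'n"
      show "norm (q k x) \<le> B * indicator (cball 0 2) x"
      proof (cases "norm x \<le> 2")
        case True
        have "norm (q k x) = norm (\<psi> (x + h k *\<^sub>R ?e) - \<psi> x) / h k"
          using h(1)[of k] by (simp add: q_def add.commute divide_inverse mult.commute)
        also have "\<dots> \<le> (B * \<bar>h k\<bar>) / h k" using lip[of x "h k"] h(1)[of k] by (intro divide_right_mono) auto
        also have "\<dots> = B" using h(1)[of k] by simp
        finally show ?thesis using True by simp
      next
        case False
        have "norm x \<le> norm (h k *\<^sub>R ?e + x) + norm (h k *\<^sub>R ?e)"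
          using norm_triangle_ineq4[of "h k *\<^sub>R ?e + x" "h k *\<^sub>R ?e"] by simp
        then have "norm (h k *\<^sub>R ?e + x) \<ge> 1" using False h(1,2)[of k] by (auto simp: norm_axis_1)
        then have "q k x = 0" using False supp(1) by (simp add: q_def)
        then show ?thesis by (simp add: B_def)
      qed
    qed
  qed (auto simp: q_def)
  ultimately show ?thesis by (simp add: LIMSEQ_const_iff)
qed

lemma has_vector_derivative_line:
  assumes "homog k Q"
  shows "((\<lambda>t. Q (x + t *\<^sub>R axis i 1)) has_vector_derivative pd i Q x) (at 0)"
proof -
  have "((\<lambda>t. Q (x + t *\<^sub>R axis i 1)) has_derivative (\<lambda>t. \<Sum>j\<in>UNIV. of_real ((t *\<^sub>R axis i 1) $ j) * pd j Q x)) (at 0)"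
    by (rule has_derivative_compose[where f="\<lambda>t. x + t *\<^sub>R axis i 1" and g=Q])
       (use homog_has_derivative[OF assms] in \<open>auto intro!: derivative_eq_intros\<close>)
  moreover have "(\<Sum>j\<in>UNIV. of_real ((t *\<^sub>R axis i 1) $ j) * pd j Q x) = t *\<^sub>R pd i Q x" for t
  proof -
    have "(\<Sum>j\<in>UNIV. of_real ((t *\<^sub>R axis i 1) $ j) * pd j Q x) = of_real t * (\<Sum>j\<in>UNIV. complex_of_real (axis i 1 $ j) * pd j Q x)"
      by (simp add: sum_distrib_left mult_ac)
    then show ?thesis by (simp only: sum_axis) (simp add: scaleR_conv_of_real)
  qed
  ultimately show ?thesis by (simp add: has_vector_derivative_def)
qed

lemma sph_int_norm_sq: "sph_int (\<lambda>x. norm_sq x * p x) = sph_int p"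
  by (rule sph_int_cong) (simp add: norm_sq_def)

text \<open>A divergence theorem on the sphere without normals or charts. The integral of the i-th
  derivative of \<open>w^2 * Q\<close> vanishes for the cutoff w = max 0 (1 - |x|^2). On the ball
  this integrand is a polynomial, and \<open>ball_moment\<close> turns each homogeneous piece into
  an integral over the sphere, where the powers of |x|^2 disappear.\<close>

lemma sph_int_pd:
  fixes Q :: "real^'n \<Rightarrow> complex"
  assumes Q: "homog j Q"
  shows "sph_int (pd i Q) = (of_nat CARD('n) + of_nat j - 1) * sph_int (\<lambda>x. of_real (x $ i) * Q x)"
proof -
  define w where "w = (\<lambda>x::real^'n. max 0 (1 - (norm x)\<^sup>2))"
  define \<psi> where "\<psi> = (\<lambda>x. of_real ((w x)\<^sup>2) * Q x)"
  define D where "D = (\<lambda>x. of_real ((w x)\<^sup>2) * pd i Q x + of_real (- 4 * x $ i * w x) * Q x)"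
  let ?X = "\<lambda>x::real^'n. complex_of_real (x $ i) * Q x"
  have der: "((\<lambda>t. \<psi> (x + t *\<^sub>R axis i 1)) has_vector_derivative D x) (at 0)" for x
  proof -
    have n: "((\<lambda>t. 1 - (norm (x + t *\<^sub>R axis i 1))\<^sup>2) has_real_derivative (- 2 * x $ i)) (at 0)"
    proof -
      have e: "(norm (x + t *\<^sub>R axis i 1))\<^sup>2 = (norm x)\<^sup>2 + 2 * t * x $ i + t\<^sup>2" for t
      proof -
        have "(norm (x + t *\<^sub>R axis i 1))\<^sup>2 = (x + t *\<^sub>R axis i 1) \<bullet> (x + t *\<^sub>R axis i 1)" by (simp add: power2_norm_eq_inner)
        also have "\<dots> = x \<bullet> x + 2 * t * (x \<bullet> axis i 1) + t\<^sup>2 * (axis i 1 \<bullet> (axis i 1 :: real^'n))"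
          by (simp add: inner_add_left inner_add_right inner_commute power2_eq_square algebra_simps)
        finally show ?thesis by (simp add: power2_norm_eq_inner inner_axis)
      qed
      show ?thesis unfolding e by (auto intro!: derivative_eq_intros)
    qed
    have "((\<lambda>t. (w (x + t *\<^sub>R axis i 1))\<^sup>2) has_real_derivative (2 * w x * (- 2 * x $ i))) (at 0)"
      using DERIV_chain2[OF max_sq_deriv n] by (simp add: w_def)
    then have "((\<lambda>t. (w (x + t *\<^sub>R axis i 1))\<^sup>2) has_vector_derivative (2 * w x * (- 2 * x $ i))) (at 0)"
      by (simp add: has_real_derivative_iff_has_vector_derivative)
    then have "((\<lambda>t. complex_of_real ((w (x + t *\<^sub>R axis i 1))\<^sup>2)) has_vector_derivative of_real (2 * w x * (- 2 * x $ i))) (at 0)"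
      by (rule bounded_linear.has_vector_derivative[OF bounded_linear_of_real])
    from has_vector_derivative_mult[OF this has_vector_derivative_line[OF Q, of x i]]
    show ?thesis unfolding \<psi>_def D_def by (rule has_vector_derivative_eq_rhs) (simp add: algebra_simps)
  qed
  have cw: "continuous_on UNIV w" unfolding w_def by (intro continuous_intros)
  have cQ: "continuous_on UNIV Q" "continuous_on UNIV (pd i Q)"
    by (rule homog_continuous[OF Q] homog_continuous[OF homog_pd[OF Q]])+
  have wz: "norm x \<ge> 1 \<Longrightarrow> w x = 0" for x by (simp add: w_def)
  have D0: "(\<integral>x. D x \<partial>lborel) = 0"
    by (rule integral_deriv_zero[OF der]) (use wz in \<open>auto simp: \<psi>_def D_def intro!: continuous_intros cQ cw\<close>)
  let ?P = "pd i Q"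
  have D_eq: "D x = indicator (cball 0 1) x *\<^sub>R (?P x) + (- 2) * (indicator (cball 0 1) x *\<^sub>R (norm_sq x * ?P x))
     + indicator (cball 0 1) x *\<^sub>R (norm_sq x * (norm_sq x * ?P x)) + (- 4) * (indicator (cball 0 1) x *\<^sub>R ?X x)
     + 4 * (indicator (cball 0 1) x *\<^sub>R (norm_sq x * ?X x))" for x
  proof (cases "norm x \<le> 1")
    case True
    then have "(norm x)\<^sup>2 \<le> 1" by (simp add: power_le_one)
    then have wr: "complex_of_real (w x) = 1 - norm_sq x" by (simp add: w_def norm_sq_def)
    show ?thesis using True unfolding D_def of_real_power of_real_mult wr by (simp add: power2_eq_square algebra_simps)
  qed (simp add: D_def wz)
  have cn: "continuous_on UNIV (norm_sq :: real^'n \<Rightarrow> complex)" by (rule homog_continuous[OF homog_norm_sq])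
  have cX: "continuous_on UNIV ?X" by (intro continuous_intros cQ)
  have "(\<integral>x. D x \<partial>lborel) = ball_int ?P + (- 2) * ball_int (\<lambda>x. norm_sq x * ?P x) + ball_int (\<lambda>x. norm_sq x * (norm_sq x * ?P x)) + (- 4) * ball_int ?X + 4 * ball_int (\<lambda>x. norm_sq x * ?X x)"
  proof -
    note a = integrable_cball[OF cQ(2)]
    note b = integrable_mult_right[OF integrable_cball[OF continuous_on_mult[OF cn cQ(2)]], of "- 2"]
    note c = integrable_cball[OF continuous_on_mult[OF cn continuous_on_mult[OF cn cQ(2)]]]
    note d = integrable_mult_right[OF integrable_cball[OF cX], of "- 4"]
    note e = integrable_mult_right[OF integrable_cball[OF continuous_on_mult[OF cn cX]], of 4]
    note ab = Bochner_Integration.integrable_add[OF a b]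
    note abc = Bochner_Integration.integrable_add[OF ab c]
    note abcd = Bochner_Integration.integrable_add[OF abc d]
    show ?thesis
      unfolding D_eq ball_int_def Bochner_Integration.integral_add[OF abcd e] Bochner_Integration.integral_add[OF abc d]
        Bochner_Integration.integral_add[OF ab c] Bochner_Integration.integral_add[OF a b] integral_mult_right_zero ..
  qed
  then have eq: "ball_int ?P - 2 * ball_int (\<lambda>x. norm_sq x * ?P x) + ball_int (\<lambda>x. norm_sq x * (norm_sq x * ?P x)) = 4 * (ball_int ?X - ball_int (\<lambda>x. norm_sq x * ?X x))"
    using D0 by (simp add: algebra_simps)
  \<comment> \<open>For j > 0 this is the factor n + degree of \<open>ball_moment\<close> for
    \<open>pd i Q\<close>. Each factor |x|^2 raises it by 2, and the product of Q with a coordinate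
    starts at a + 2.\<close>
  define a where "a = real CARD('n) + real j - 1"
  have "0 < CARD('n)" by (rule zero_less_card_finite)
  then have n1: "1 \<le> real CARD('n)" by linarith
  then have a0: "a \<ge> 0" unfolding a_def by linarith
  let ?S = "sph_int ?P" and ?T = "sph_int ?X"
  have X1: "of_real (a + 2) * ball_int ?X = ?T" "of_real (a + 4) * ball_int (\<lambda>x. norm_sq x * ?X x) = ?T"
    using ball_moment[OF homog_var[OF Q, of i]] ball_moment[OF homog_mult[OF homog_norm_sq homog_var[OF Q, of i]], unfolded sph_int_norm_sq]
    by (simp_all add: a_def algebra_simps)
  have dv: "X = T / of_real c" if "c > 0" "complex_of_real c * X = T" for c :: real and X T :: complex
    using that by (auto simp: field_simps)
  have BX: "ball_int ?X = ?T / of_real (a + 2)" "ball_int (\<lambda>x. norm_sq x * ?X x) = ?T / of_real (a + 4)"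
    by (rule dv[OF _ X1(1)] dv[OF _ X1(2)], use a0 in linarith)+
  have T: "ball_int ?X - ball_int (\<lambda>x. norm_sq x * ?X x) = ?T * of_real (2 / ((a + 2) * (a + 4)))"
  proof -
    have "1 / (a + 2) - 1 / (a + 4) = 2 / ((a + 2) * (a + 4))" using a0 by (simp add: field_simps)
    moreover have "?T / of_real (a + 2) - ?T / of_real (a + 4) = ?T * of_real (1 / (a + 2) - 1 / (a + 4))"
      by (simp add: divide_inverse right_diff_distrib)
    ultimately show ?thesis unfolding BX by simp
  qed
  show ?thesis
  proof (cases "j = 0")
    \<comment> \<open>Here the degree j - 1 is truncated and a is not the factor belonging to
      \<open>pd i Q\<close>. The derivative vanishes instead, and the identity forces the other
      integral to vanish too.\<close>
    case True
    then have P0: "?P = (\<lambda>_. 0)" by (rule pd_homog_0[OF Q])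
    then have "?T * of_real (2 / ((a + 2) * (a + 4))) = 0" using eq unfolding T by (simp add: ball_int_def)
    moreover have "2 / ((a + 2) * (a + 4)) \<noteq> 0" using a0 by simp
    ultimately have "?T = 0" by (simp only: mult_eq_0_iff of_real_eq_0_iff) simp
    then show ?thesis by (simp add: P0 sph_int_def)
  next
    case False
    then obtain m where m: "j = Suc m" by (cases j) auto
    have rP: "homog m ?P" using homog_pd[OF Q] m by simp
    have am: "a = real CARD('n) + real m" by (simp add: a_def m)
    then have a0: "a > 0" using n1 by linarith
    have P1: "of_real a * ball_int ?P = ?S" "of_real (a + 2) * ball_int (\<lambda>x. norm_sq x * ?P x) = ?S" "of_real (a + 4) * ball_int (\<lambda>x. norm_sq x * (norm_sq x * ?P x)) = ?S"
      using ball_moment[OF rP] ball_moment[OF homog_mult[OF homog_norm_sq rP], unfolded sph_int_norm_sq]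
        ball_moment[OF homog_mult[OF homog_norm_sq homog_mult[OF homog_norm_sq rP]], unfolded sph_int_norm_sq]
      by (simp_all add: am algebra_simps)
    have b: "ball_int ?P = ?S / of_real a" "ball_int (\<lambda>x. norm_sq x * ?P x) = ?S / of_real (a + 2)" "ball_int (\<lambda>x. norm_sq x * (norm_sq x * ?P x)) = ?S / of_real (a + 4)"
      by (rule dv[OF _ P1(1)] dv[OF _ P1(2)] dv[OF _ P1(3)], use a0 in linarith)+
    \<comment> \<open>Both sides are 8 / (a (a + 2) (a + 4)). After cancelling the common factor
      what remains is S = a T.\<close>
    have "1 / a - 2 / (a + 2) + 1 / (a + 4) = 4 * (2 / ((a + 2) * (a + 4))) / a"
    proof -
      have "a \<noteq> 0" "a + 2 \<noteq> 0" "a + 4 \<noteq> 0" using a0 by auto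
      then show ?thesis by (simp add: divide_simps) (simp add: algebra_simps)
    qed
    moreover have "ball_int ?P - 2 * ball_int (\<lambda>x. norm_sq x * ?P x) + ball_int (\<lambda>x. norm_sq x * (norm_sq x * ?P x)) = ?S * of_real (1 / a - 2 / (a + 2) + 1 / (a + 4))"
      unfolding b by (simp add: divide_inverse ring_distribs mult_ac)
    ultimately have "?S * of_real (4 * (2 / ((a + 2) * (a + 4))) / a) = 4 * (?T * of_real (2 / ((a + 2) * (a + 4))))"
      using eq unfolding T by simp
    then have "(of_real (2 / ((a + 2) * (a + 4))) * 4) * (?S / of_real a) = (of_real (2 / ((a + 2) * (a + 4))) * 4) * ?T"
      by (simp add: mult_ac)
    moreover have "complex_of_real (2 / ((a + 2) * (a + 4))) * 4 \<noteq> 0"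
    proof -
      have "2 / ((a + 2) * (a + 4)) \<noteq> 0" using a0 by simp
      then show ?thesis by (simp only: mult_eq_0_iff of_real_eq_0_iff) simp
    qed
    ultimately have "?S / of_real a = ?T" by (simp only: mult_cancel_left) simp
    then have "?S = of_real a * ?T" using a0 by (auto simp: field_simps)
    then show ?thesis by (simp add: a_def)
  qed
qed


text \<open>\<open>sph_int_pd\<close> for each first derivative, which has degree k - 1, followed by
  Euler's identity.\<close>

lemma sph_int_laplacian:
  fixes P :: "real^'n \<Rightarrow> complex"
  assumes P: "homog k P"
  shows "sph_int (laplacian P) = of_nat k * (of_nat k + of_nat CARD('n) - 2) * sph_int P"
proof (cases "k = 0")
  case True
  then have "laplacian P = (\<lambda>_. 0)" using laplacian_small[OF P] by (intro ext) simp
  then show ?thesis using True by (simp add: sph_int_def)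
next
  case False
  then obtain j where k: "k = Suc j" by (cases k) auto
  have rj: "homog j (pd i P)" for i using homog_pd[OF P] k by simp
  have "sph_int (laplacian P) = (\<Sum>i\<in>UNIV. sph_int (pd i (pd i P)))"
    unfolding laplacian_def[abs_def] by (rule sph_int_sum) (rule homog_continuous[OF homog_pd[OF rj]])
  also have "\<dots> = (\<Sum>i\<in>UNIV. (of_nat CARD('n) + of_nat j - 1) * sph_int (\<lambda>x. of_real (x $ i) * pd i P x))"
    by (simp add: sph_int_pd[OF rj])
  also have "\<dots> = (of_nat CARD('n) + of_nat j - 1) * sph_int (\<lambda>x. \<Sum>i\<in>UNIV. of_real (x $ i) * pd i P x)"
    by (subst sph_int_sum) (auto simp: sum_distrib_left intro!: homog_continuous[OF homog_var[OF rj]])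
  also have "\<dots> = (of_nat CARD('n) + of_nat j - 1) * (of_nat k * sph_int P)"
    by (simp add: euler[OF P] sph_int_cmult)
  finally show ?thesis by (simp add: k algebra_simps)
qed

section \<open>Orthogonality of spherical harmonics of different degrees\<close>

lemma solid_harm_homog: "solid_harm k p \<Longrightarrow> homog k p" by (simp add: solid_harm_def)
lemma solid_harm_lap: "solid_harm k p \<Longrightarrow> laplacian p = (\<lambda>_. 0)" by (auto simp: solid_harm_def)

lemma solid_harm_continuous: "solid_harm k p \<Longrightarrow> continuous_on UNIV p"
  by (intro homog_continuous solid_harm_homog)

lemma solid_harm_zero: "solid_harm k (\<lambda>_. 0)"
  by (auto simp: solid_harm_def homog_zero laplacian_def pd_zero)

lemma solid_harm_add: "solid_harm k p \<Longrightarrow> solid_harm k q \<Longrightarrow> solid_harm k (\<lambda>x. p x + q x)"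
  unfolding solid_harm_def using laplacian_add homog_add by fastforce

lemma solid_harm_cmult: "solid_harm k p \<Longrightarrow> solid_harm k (\<lambda>x. c * p x)"
  unfolding solid_harm_def using laplacian_cmult homog_cmult by fastforce

lemma pd_cnj:
  assumes "homog k p" shows "pd i (\<lambda>x. cnj (p x)) = (\<lambda>x. cnj (pd i p x))"
proof
  fix x
  show "pd i (\<lambda>x. cnj (p x)) x = cnj (pd i p x)"
    by (rule pd_eqI) (use bounded_linear.has_derivative[OF bounded_linear_cnj homog_has_derivative[OF assms], of x]
       in \<open>simp\<close>)
qed

lemma solid_harm_cnj: "solid_harm k p \<Longrightarrow> solid_harm k (\<lambda>x. cnj (p x))"
proof -
  assume h: "solid_harm k p"
  have "laplacian (\<lambda>x. cnj (p x)) x = cnj (laplacian p x)" for x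
    unfolding laplacian_def pd_cnj[OF solid_harm_homog[OF h]] by (simp add: pd_cnj[OF homog_pd[OF solid_harm_homog[OF h]]])
  then show ?thesis using h by (simp add: solid_harm_def homog_cnj)
qed

lemma solid_harm_pd:
  assumes "solid_harm k p" shows "solid_harm (k - 1) (pd i p)"
proof -
  note r = solid_harm_homog[OF assms]
  have "laplacian (pd i p) x = pd i (laplacian p) x" for x
  proof -
    have "pd i (laplacian p) = (\<lambda>x. \<Sum>j\<in>UNIV. pd i (pd j (pd j p)) x)"
      unfolding laplacian_def[abs_def] by (rule pd_sum[OF finite_class.finite_UNIV homog_pd[OF homog_pd[OF r]]])
    moreover have "pd i (pd j (pd j p)) = pd j (pd j (pd i p))" for j
      using pd_commute[OF homog_pd[OF r], of i j j] pd_commute[OF r, of i j] by simp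
    ultimately show ?thesis by (simp add: laplacian_def)
  qed
  then show ?thesis using homog_pd[OF r, of i] by (simp add: solid_harm_def solid_harm_lap[OF assms] pd_zero)
qed

lemma solid_harm_pd_0: "solid_harm 0 p \<Longrightarrow> pd i p = (\<lambda>_. 0)"
  using pd_homog_0[OF solid_harm_homog] by blast

text \<open>For harmonic factors the Laplacian of the product is twice the product of the gradients.
  The pairing is bilinear; conjugates come in through \<open>solid_harm_cnj\<close>.\<close>

lemma sph_int_grad:
  fixes p q :: "real^'n \<Rightarrow> complex"
  assumes p: "solid_harm l p" and q: "solid_harm m q"
  shows "2 * (\<Sum>i\<in>UNIV. sph_int (\<lambda>x. pd i p x * pd i q x)) = of_nat (l + m) * (of_nat (l + m) + of_nat CARD('n) - 2) * sph_int (\<lambda>x. p x * q x)"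
proof -
  have c: "continuous_on UNIV (\<lambda>x. pd i p x * pd i q x)" for i
    by (intro continuous_intros homog_continuous[OF homog_pd[OF solid_harm_homog[OF p]]] homog_continuous[OF homog_pd[OF solid_harm_homog[OF q]]])
  have "sph_int (laplacian (\<lambda>x. p x * q x)) = sph_int (\<lambda>x. 2 * (\<Sum>i\<in>UNIV. pd i p x * pd i q x))"
    by (rule sph_int_cong) (simp add: laplacian_mult[OF solid_harm_homog[OF p] solid_harm_homog[OF q]] solid_harm_lap[OF p] solid_harm_lap[OF q])
  then show ?thesis
    by (simp add: sph_int_laplacian[OF homog_mult[OF solid_harm_homog[OF p] solid_harm_homog[OF q]]] sph_int_cmult sph_int_sum[OF c])
qed

text \<open>Induction on the degree: the partial derivatives are orthogonal by hypothesis, or vanish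
  in degree 0, so the left side of \<open>sph_int_grad\<close> is 0. The factor (l + m)(l + m + n -
  2) on the right is nonzero because n \<ge> 2 and l + m \<ge> 1.\<close>

lemma harmonic_orthogonal:
  fixes p q :: "real^'n \<Rightarrow> complex"
  assumes n: "CARD('n) \<ge> 2"
  shows "solid_harm l p \<Longrightarrow> solid_harm m q \<Longrightarrow> l \<noteq> m \<Longrightarrow> sph_int (\<lambda>x. p x * q x) = 0"
proof (induction l arbitrary: p q m)
  case 0
  have "complex_of_nat m \<noteq> 0" "complex_of_nat m + of_nat CARD('n) - 2 \<noteq> 0"
  proof -
    show "complex_of_nat m \<noteq> 0" using 0 by simp
    have "complex_of_nat m + of_nat CARD('n) - 2 = of_nat (m + CARD('n) - 2)" using n by (simp add: of_nat_diff)
    moreover have "m + CARD('n) - 2 \<noteq> 0" using n 0 by linarith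
    ultimately show "complex_of_nat m + of_nat CARD('n) - 2 \<noteq> 0" by (simp only: of_nat_eq_0_iff) simp
  qed
  with sph_int_grad[OF 0(1,2)] show ?case by (simp add: solid_harm_pd_0[OF 0(1)] sph_int_def)
next
  case (Suc l)
  have "sph_int (\<lambda>x. pd i p x * pd i q x) = 0" for i
  proof (cases m)
    case 0
    then show ?thesis using Suc.prems(2) by (simp add: solid_harm_pd_0 sph_int_def)
  next
    case (Suc m')
    then show ?thesis
      using Suc.IH[of "pd i p" m' "pd i q"] solid_harm_pd[OF Suc.prems(1), of i] solid_harm_pd[OF Suc.prems(2), of i] Suc.prems(3) by simp
  qed
  moreover have "complex_of_nat (Suc l + m) \<noteq> 0" by (simp del: of_nat_Suc of_nat_add)
  moreover have "complex_of_nat (Suc l + m) + of_nat CARD('n) - 2 \<noteq> 0"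
  proof -
    have "complex_of_nat (Suc l + m) + of_nat CARD('n) - 2 = of_nat (Suc l + m + CARD('n) - 2)" using n by (simp add: of_nat_diff)
    moreover have "Suc l + m + CARD('n) - 2 \<noteq> 0" using n by linarith
    ultimately show ?thesis by (simp only: of_nat_eq_0_iff) simp
  qed
  ultimately show ?case using sph_int_grad[OF Suc.prems(1,2)] by simp
qed

section \<open>Bernstein inequalities in L2\<close>

definition normsq_sph :: "(real^'n \<Rightarrow> complex) \<Rightarrow> real" where
  "normsq_sph f = (\<integral>u. (norm (f u))\<^sup>2 \<partial>sphm)"

lemma normsq_sph_sph_int: "of_real (normsq_sph p) = sph_int (\<lambda>x. p x * cnj (p x))"
  unfolding normsq_sph_def sph_int_def complex_norm_square[symmetric] by (rule integral_complex_of_real[symmetric])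

lemma normsq_sph_nonneg: "normsq_sph f \<ge> 0"
  unfolding normsq_sph_def by simp

lemma normsq_sph_sum:
  fixes H :: "'a \<Rightarrow> real^'n \<Rightarrow> complex"
  assumes n: "CARD('n) \<ge> 2" and A: "finite A" and H: "\<And>a. a \<in> A \<Longrightarrow> solid_harm (d a) (H a)" and inj: "inj_on d A"
  shows "normsq_sph (\<lambda>x. \<Sum>a\<in>A. H a x) = (\<Sum>a\<in>A. normsq_sph (H a))"
proof -
  have c: "continuous_on UNIV (\<lambda>x. H a x * cnj (H b x))" if "a \<in> A" "b \<in> A" for a b
    by (intro continuous_intros solid_harm_continuous[OF H] that)
  have "complex_of_real (normsq_sph (\<lambda>x. \<Sum>a\<in>A. H a x)) = sph_int (\<lambda>x. \<Sum>a\<in>A. \<Sum>b\<in>A. H a x * cnj (H b x))"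
    unfolding normsq_sph_sph_int by (simp add: sum_product)
  also have "\<dots> = (\<Sum>a\<in>A. \<Sum>b\<in>A. sph_int (\<lambda>x. H a x * cnj (H b x)))"
    by (subst sph_int_sum, intro continuous_on_sum c, assumption, assumption) (intro sum.cong refl sph_int_sum c)
  also have "\<dots> = (\<Sum>a\<in>A. \<Sum>b\<in>A. if a = b then of_real (normsq_sph (H a)) else 0)"
  proof (intro sum.cong refl)
    fix a b assume ab: "a \<in> A" "b \<in> A"
    show "sph_int (\<lambda>x. H a x * cnj (H b x)) = (if a = b then of_real (normsq_sph (H a)) else 0)"
    proof (cases "a = b")
      case False
      then have "d a \<noteq> d b" using inj ab by (auto dest: inj_onD)
      from harmonic_orthogonal[OF n H[OF ab(1)] solid_harm_cnj[OF H[OF ab(2)]] this] False show ?thesis by simp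
    qed (simp add: normsq_sph_sph_int)
  qed
  also have "\<dots> = of_real (\<Sum>a\<in>A. normsq_sph (H a))" using A by simp
  finally show ?thesis by (simp only: of_real_eq_iff)
qed

text \<open>\<open>sph_int_grad\<close> with q the conjugate of p; for a single degree this is an
  equality.\<close>

lemma bernstein_solid_harm:
  fixes p :: "real^'n \<Rightarrow> complex"
  assumes p: "solid_harm l p"
  shows "(\<Sum>i\<in>UNIV. normsq_sph (pd i p)) = real l * (2 * real l + real CARD('n) - 2) * normsq_sph p"
proof -
  have "complex_of_real (2 * (\<Sum>i\<in>UNIV. normsq_sph (pd i p))) = 2 * (\<Sum>i\<in>UNIV. sph_int (\<lambda>x. pd i p x * pd i (\<lambda>x. cnj (p x)) x))"
    by (simp add: normsq_sph_sph_int pd_cnj[OF solid_harm_homog[OF p]])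
  also have "\<dots> = of_nat (l + l) * (of_nat (l + l) + of_nat CARD('n) - 2) * sph_int (\<lambda>x. p x * cnj (p x))"
    by (rule sph_int_grad[OF p solid_harm_cnj[OF p]])
  also have "\<dots> = of_real (2 * (real l * (2 * real l + real CARD('n) - 2) * normsq_sph p))"
    by (simp add: normsq_sph_sph_int algebra_simps)
  finally show ?thesis by (simp only: of_real_eq_iff)
qed

text \<open>L bounds the degrees without having to be attained: \<open>harm_sum_pd\<close> keeps the
  same L, so that the Bernstein inequality can be iterated with a constant factor.\<close>

definition harm_sum :: "nat \<Rightarrow> (real^'n \<Rightarrow> complex) \<Rightarrow> bool" where
  "harm_sum L G \<longleftrightarrow> (\<exists>H. (\<forall>l. solid_harm l (H l)) \<and> G = (\<lambda>x. \<Sum>l\<le>L. H l x))"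

lemma harm_sum_poly_sum: "harm_sum L G \<Longrightarrow> poly_sum L G"
  unfolding harm_sum_def poly_sum_def using solid_harm_homog by blast

lemma harm_sum_continuous: "harm_sum L G \<Longrightarrow> continuous_on UNIV G"
  unfolding harm_sum_def by (elim exE conjE, hypsubst) (intro continuous_on_sum solid_harm_continuous, blast)

lemma harm_sum_pd:
  assumes "harm_sum L G" shows "harm_sum L (pd i G)"
proof -
  obtain H where H: "\<And>l. solid_harm l (H l)" "G = (\<lambda>x. \<Sum>l\<le>L. H l x)" using assms unfolding harm_sum_def by blast
  define H' where "H' = (\<lambda>l. if l < L then pd i (H (Suc l)) else (\<lambda>_. 0))"
  have "solid_harm l (H' l)" for l
    using solid_harm_pd[OF H(1)[of "Suc l"], of i] by (simp add: H'_def solid_harm_zero)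
  moreover have "pd i G x = (\<Sum>l\<le>L. H' l x)" for x
  proof -
    have "pd i G x = (\<Sum>l\<le>L. pd i (H l) x)" unfolding H(2) pd_sum[OF finite_atMost solid_harm_homog[OF H(1)]] ..
    also have "\<dots> = (\<Sum>l<L. pd i (H (Suc l)) x)"
      by (simp add: sum.atMost_shift solid_harm_pd_0[OF H(1)])
    also have "\<dots> = (\<Sum>l\<le>L. H' l x)"
      by (rule sum.mono_neutral_cong_left) (auto simp: H'_def)
    finally show ?thesis .
  qed
  ultimately show ?thesis unfolding harm_sum_def by (intro exI[of _ H']) auto
qed

text \<open>The derivatives of components of different degrees again have different degrees, so both
  sides split orthogonally. The equality for single degrees applies, with one bound for the factors
  of all degrees up to L.\<close>

lemma bernstein_harm_sum:
  fixes G :: "real^'n \<Rightarrow> complex"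
  assumes n: "CARD('n) \<ge> 2" and G: "harm_sum L G"
  shows "(\<Sum>i\<in>UNIV. normsq_sph (pd i G)) \<le> real L * (2 * real L + real CARD('n)) * normsq_sph G"
proof -
  obtain H where H: "\<And>l. solid_harm l (H l)" "G = (\<lambda>x. \<Sum>l\<le>L. H l x)" using G unfolding harm_sum_def by blast
  have "normsq_sph (pd i G) = (\<Sum>l<L. normsq_sph (pd i (H (Suc l))))" for i
  proof -
    have "pd i G x = (\<Sum>l<L. pd i (H (Suc l)) x)" for x
      unfolding H(2) pd_sum[OF finite_atMost solid_harm_homog[OF H(1)]] by (simp add: sum.atMost_shift solid_harm_pd_0[OF H(1)])
    then have "pd i G = (\<lambda>x. \<Sum>l<L. pd i (H (Suc l)) x)" by (intro ext)
    moreover have "solid_harm l (pd i (H (Suc l)))" for l using solid_harm_pd[OF H(1), of "Suc l" i] by simp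
    ultimately show ?thesis using normsq_sph_sum[OF n, of "{..<L}" id "\<lambda>l. pd i (H (Suc l))"] by simp
  qed
  then have "(\<Sum>i\<in>UNIV. normsq_sph (pd i G)) = (\<Sum>l<L. \<Sum>i\<in>UNIV. normsq_sph (pd i (H (Suc l))))"
    by (simp add: sum.swap[of _ UNIV])
  also have "\<dots> = (\<Sum>l<L. real (Suc l) * (2 * real (Suc l) + real CARD('n) - 2) * normsq_sph (H (Suc l)))"
    unfolding bernstein_solid_harm[OF H(1)] ..
  also have "\<dots> \<le> (\<Sum>l<L. real L * (2 * real L + real CARD('n)) * normsq_sph (H (Suc l)))"
    by (intro sum_mono mult_right_mono mult_mono normsq_sph_nonneg) auto
  also have "\<dots> = real L * (2 * real L + real CARD('n)) * (\<Sum>l<L. normsq_sph (H (Suc l)))"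
    by (simp add: sum_distrib_left)
  also have "\<dots> \<le> real L * (2 * real L + real CARD('n)) * normsq_sph G"
  proof (rule mult_left_mono)
    have "normsq_sph G = (\<Sum>l\<le>L. normsq_sph (H l))" unfolding H(2) by (rule normsq_sph_sum[OF n, where d=id]) (auto simp: H(1))
    then show "(\<Sum>l<L. normsq_sph (H (Suc l))) \<le> normsq_sph G" by (simp add: sum.atMost_shift normsq_sph_nonneg)
  qed simp
  finally show ?thesis .
qed

lemma deriv_sq_continuous: "harm_sum L G \<Longrightarrow> continuous_on UNIV (deriv_sq k G)"
proof (induction k arbitrary: G)
  case 0
  then have "continuous_on UNIV (\<lambda>x. (norm (G x))\<^sup>2)" by (intro continuous_intros harm_sum_continuous)
  then show ?case by (simp cong: continuous_on_cong)
next
  case (Suc k)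
  then have "continuous_on UNIV (\<lambda>x. \<Sum>i\<in>UNIV. deriv_sq k (pd i G) x)" by (intro continuous_intros Suc.IH harm_sum_pd)
  then show ?case by (simp cong: continuous_on_cong)
qed

lemma bernstein_iterated:
  fixes G :: "real^'n \<Rightarrow> complex"
  assumes n: "CARD('n) \<ge> 2"
  shows "harm_sum L G \<Longrightarrow> (\<integral>u. deriv_sq k G u \<partial>sphm) \<le> (real L * (2 * real L + real CARD('n))) ^ k * normsq_sph G"
proof (induction k arbitrary: G)
  case 0
  then show ?case by (simp add: normsq_sph_def)
next
  case (Suc k)
  let ?\<Lambda> = "real L * (2 * real L + real CARD('n))"
  have "(\<integral>u. deriv_sq (Suc k) G u \<partial>sphm) = (\<Sum>i\<in>UNIV. \<integral>u. deriv_sq k (pd i G) u \<partial>sphm)"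
    unfolding deriv_sq.simps
    by (rule Bochner_Integration.integral_sum) (intro integrable_sphm deriv_sq_continuous[OF harm_sum_pd[OF Suc.prems]])
  also have "\<dots> \<le> (\<Sum>i\<in>UNIV. ?\<Lambda> ^ k * normsq_sph (pd i G))"
    by (intro sum_mono Suc.IH harm_sum_pd Suc.prems)
  also have "\<dots> = ?\<Lambda> ^ k * (\<Sum>i\<in>UNIV. normsq_sph (pd i G))" by (simp add: sum_distrib_left)
  also have "\<dots> \<le> ?\<Lambda> ^ k * (?\<Lambda> * normsq_sph G)"
    by (intro mult_left_mono bernstein_harm_sum[OF n Suc.prems]) simp
  finally show ?case by (simp add: mult_ac)
qed

section \<open>Orthogonal expansions in spherical harmonics\<close>

abbreviation sq_int :: "(real^'n \<Rightarrow> complex) \<Rightarrow> bool" where "sq_int \<equiv> square_integrable_sphere"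
abbreviation ip :: "(real^'n \<Rightarrow> complex) \<Rightarrow> (real^'n \<Rightarrow> complex) \<Rightarrow> complex" where "ip \<equiv> L2_inner_sphere"

lemma sq_int_measurable: "sq_int f \<Longrightarrow> f \<in> borel_measurable sphm"
  and sq_int_integrable: "sq_int f \<Longrightarrow> integrable sphm (\<lambda>u. (norm (f u))\<^sup>2)"
  by (simp_all add: square_integrable_sphere_def)

lemma sqiI_bound:
  assumes "f \<in> borel_measurable sphm" "integrable sphm w" "\<And>u. u \<in> unit_sphere \<Longrightarrow> (norm (f u))\<^sup>2 \<le> w u"
  shows "sq_int f"
  unfolding square_integrable_sphere_def
proof (intro conjI assms(1))
  show "integrable sphm (\<lambda>u. (norm (f u))\<^sup>2)"
    by (rule Bochner_Integration.integrable_bound[OF assms(2)])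
       (use assms in \<open>auto intro!: AE_I2 simp: space_sphere_measure intro: order_trans[OF _ abs_ge_self]\<close>)
qed

lemma sq_int_continuous: "continuous_on UNIV f \<Longrightarrow> sq_int f"
  unfolding square_integrable_sphere_def
  by (intro conjI measurable_sphmI borel_measurable_continuous_onI integrable_sphm continuous_intros)

lemma norm_add_sq_le: "(norm (a + b :: complex))\<^sup>2 \<le> 2 * (norm a)\<^sup>2 + 2 * (norm b)\<^sup>2"
proof -
  have "(norm (a + b))\<^sup>2 \<le> (norm a + norm b)\<^sup>2" by (intro power_mono norm_triangle_ineq) auto
  also have "\<dots> \<le> 2 * (norm a)\<^sup>2 + 2 * (norm b)\<^sup>2"
    using sum_squares_bound[of "norm a" "norm b"] by (simp add: power2_sum)
  finally show ?thesis .
qed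

lemma sq_int_add: assumes "sq_int f" "sq_int g" shows "sq_int (\<lambda>u. f u + g u)"
proof (rule sqiI_bound)
  show "integrable sphm (\<lambda>u. 2 * (norm (f u))\<^sup>2 + 2 * (norm (g u))\<^sup>2)"
    using assms by (intro Bochner_Integration.integrable_add integrable_mult_right sq_int_integrable)
qed (use assms[THEN sq_int_measurable] in \<open>auto intro!: borel_measurable_add norm_add_sq_le\<close>)

lemma sq_int_cmult: assumes "sq_int f" shows "sq_int (\<lambda>u. c * f u)"
proof (rule sqiI_bound)
  show "integrable sphm (\<lambda>u. (norm c)\<^sup>2 * (norm (f u))\<^sup>2)"
    using assms by (intro integrable_mult_right sq_int_integrable)
qed (use sq_int_measurable[OF assms] in \<open>auto simp: norm_mult power_mult_distrib\<close>)

lemma sq_int_diff: "sq_int f \<Longrightarrow> sq_int g \<Longrightarrow> sq_int (\<lambda>u. f u - g u)"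
  using sq_int_add[OF _ sq_int_cmult[of g "- 1"], of f] by simp

lemma sq_int_zero: "sq_int (\<lambda>u. 0)"
  by (rule sq_int_continuous) auto

lemma sq_int_sum: "(\<And>a. a \<in> A \<Longrightarrow> sq_int (f a)) \<Longrightarrow> sq_int (\<lambda>u. \<Sum>a\<in>A. f a u)"
proof (induction A rule: infinite_finite_induct)
  case (insert a A)
  then show ?case using sq_int_add[of "f a"] by simp
qed (simp_all add: sq_int_zero)

lemma cnj_measurable[measurable (raw)]: "f \<in> borel_measurable M \<Longrightarrow> (\<lambda>x. cnj (f x)) \<in> borel_measurable M"
  by (rule measurable_compose[OF _ borel_measurable_continuous_onI]) (auto intro: continuous_intros)

lemma ip_integrable:
  assumes "sq_int f" "sq_int g" shows "integrable sphm (\<lambda>u. f u * cnj (g u))"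
proof (rule Bochner_Integration.integrable_bound)
  show "integrable sphm (\<lambda>u. (norm (f u))\<^sup>2 + (norm (g u))\<^sup>2)"
    using assms by (intro Bochner_Integration.integrable_add sq_int_integrable)
  have [measurable]: "f \<in> borel_measurable sphm" "g \<in> borel_measurable sphm" using assms by (auto intro: sq_int_measurable)
  show "(\<lambda>u. f u * cnj (g u)) \<in> borel_measurable sphm" by measurable
  show "AE u in sphm. norm (f u * cnj (g u)) \<le> norm ((norm (f u))\<^sup>2 + (norm (g u))\<^sup>2)"
  proof (rule AE_I2)
    fix u
    have "norm (f u) * norm (g u) \<le> (norm (f u))\<^sup>2 + (norm (g u))\<^sup>2"
      using sum_squares_bound[of "norm (f u)" "norm (g u)"] mult_nonneg_nonneg[OF norm_ge_zero norm_ge_zero, of "f u" "g u"] by linarith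
    then show "norm (f u * cnj (g u)) \<le> norm ((norm (f u))\<^sup>2 + (norm (g u))\<^sup>2)" by (simp add: norm_mult)
  qed
qed

lemma ip_add_left: "sq_int f \<Longrightarrow> sq_int g \<Longrightarrow> sq_int h \<Longrightarrow> ip (\<lambda>u. f u + g u) h = ip f h + ip g h"
  unfolding L2_inner_sphere_def distrib_right by (intro Bochner_Integration.integral_add ip_integrable)

lemma ip_diff_left: "sq_int f \<Longrightarrow> sq_int g \<Longrightarrow> sq_int h \<Longrightarrow> ip (\<lambda>u. f u - g u) h = ip f h - ip g h"
  unfolding L2_inner_sphere_def left_diff_distrib by (intro Bochner_Integration.integral_diff ip_integrable)

lemma ip_cmult_left: "ip (\<lambda>u. c * f u) h = c * ip f h"
  unfolding L2_inner_sphere_def by (simp add: mult.assoc)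

lemma ip_add_right: "sq_int f \<Longrightarrow> sq_int g \<Longrightarrow> sq_int h \<Longrightarrow> ip f (\<lambda>u. g u + h u) = ip f g + ip f h"
  unfolding L2_inner_sphere_def complex_cnj_add distrib_left by (intro Bochner_Integration.integral_add ip_integrable)

lemma ip_cmult_right: "ip f (\<lambda>u. c * h u) = cnj c * ip f h"
proof -
  have "ip f (\<lambda>u. c * h u) = (\<integral>u. cnj c * (f u * cnj (h u)) \<partial>sphm)"
    unfolding L2_inner_sphere_def by (simp add: mult_ac)
  then show ?thesis by (simp add: L2_inner_sphere_def)
qed

lemma ip_zero_right: "ip f (\<lambda>u. 0) = 0"
  by (simp add: L2_inner_sphere_def)

lemma ip_zero_left: "ip (\<lambda>u. 0) f = 0"
  by (simp add: L2_inner_sphere_def)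

lemma ip_sum_right: "sq_int f \<Longrightarrow> (\<And>a. a \<in> A \<Longrightarrow> sq_int (g a)) \<Longrightarrow> ip f (\<lambda>u. \<Sum>a\<in>A. g a u) = (\<Sum>a\<in>A. ip f (g a))"
proof (induction A rule: infinite_finite_induct)
  case (insert a A)
  then show ?case by (simp add: ip_add_right sq_int_sum)
qed (simp_all add: ip_zero_right)

lemma ip_sum_left: "sq_int f \<Longrightarrow> (\<And>a. a \<in> A \<Longrightarrow> sq_int (g a)) \<Longrightarrow> ip (\<lambda>u. \<Sum>a\<in>A. g a u) f = (\<Sum>a\<in>A. ip (g a) f)"
proof (induction A rule: infinite_finite_induct)
  case (insert a A)
  then show ?case by (simp add: ip_add_left sq_int_sum)
qed (simp_all add: ip_zero_left)

lemma ip_cong: "(\<And>u. norm u = 1 \<Longrightarrow> f u = f' u) \<Longrightarrow> (\<And>u. norm u = 1 \<Longrightarrow> g u = g' u) \<Longrightarrow> ip f g = ip f' g'"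
  unfolding L2_inner_sphere_def by (intro Bochner_Integration.integral_cong) (auto simp: space_sphere_measure)

lemma normsq_sph_cong: "(\<And>u. norm u = 1 \<Longrightarrow> f u = g u) \<Longrightarrow> normsq_sph f = normsq_sph g"
  unfolding normsq_sph_def by (intro Bochner_Integration.integral_cong) (auto simp: space_sphere_measure)

lemma ip_sph_int: "ip f g = sph_int (\<lambda>u. f u * cnj (g u))"
  by (simp add: L2_inner_sphere_def sph_int_def)

lemma ip_self: "ip f f = of_real (normsq_sph f)"
  by (simp add: normsq_sph_sph_int ip_sph_int)

lemma normsq_sph_pythagoras:
  assumes "sq_int f" "sq_int g" "ip f g = 0" shows "normsq_sph (\<lambda>u. f u + g u) = normsq_sph f + normsq_sph g"
proof -
  have "ip g f = (\<integral>u. cnj (f u * cnj (g u)) \<partial>sphm)"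
    by (simp add: L2_inner_sphere_def mult.commute)
  also have "\<dots> = cnj (ip f g)" unfolding L2_inner_sphere_def by (rule Bochner_Integration.integral_cnj)
  finally have "ip g f = cnj (ip f g)" .
  then have "complex_of_real (normsq_sph (\<lambda>u. f u + g u)) = of_real (normsq_sph f + normsq_sph g)"
    using assms by (simp add: ip_self[symmetric] ip_add_left ip_add_right sq_int_add)
  then show ?thesis by (simp only: of_real_eq_iff)
qed

lemma normsq_sph_add_le:
  assumes "sq_int f" "sq_int g" shows "normsq_sph (\<lambda>u. f u + g u) \<le> 2 * normsq_sph f + 2 * normsq_sph g"
proof -
  have "normsq_sph (\<lambda>u. f u + g u) \<le> (\<integral>u. 2 * (norm (f u))\<^sup>2 + 2 * (norm (g u))\<^sup>2 \<partial>sphm)"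
    unfolding normsq_sph_def using assms
    by (intro integral_mono Bochner_Integration.integrable_add integrable_mult_right sq_int_integrable sq_int_add norm_add_sq_le)
  also have "\<dots> = 2 * normsq_sph f + 2 * normsq_sph g"
    unfolding normsq_sph_def using assms
    by (subst Bochner_Integration.integral_add) (auto intro!: integrable_mult_right sq_int_integrable)
  finally show ?thesis .
qed

section \<open>Orthogonal projection onto spherical harmonics\<close>

lemma ip_null:
  assumes "sq_int g" "normsq_sph g = 0" shows "ip f g = 0"
proof -
  have "AE u in sphm. (norm (g u))\<^sup>2 = 0"
    using integral_nonneg_eq_0_iff_AE[OF sq_int_integrable[OF assms(1)]] assms(2) by (simp add: normsq_sph_def)
  then have "AE u in sphm. f u * cnj (g u) = 0" by eventually_elim simp
  then show ?thesis unfolding L2_inner_sphere_def by (rule integral_eq_zero_AE)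
qed

text \<open>Gram-Schmidt, one vector at a time. Functions equal almost everywhere are not identified
  and the vectors may be dependent, so the residual r of the new vector can have norm 0;
  \<open>ip_null\<close> covers that case.\<close>

lemma orthogonal_projection_span:
  assumes "finite A" "\<And>a. a \<in> A \<Longrightarrow> sq_int (b a)"
  shows "sq_int f \<Longrightarrow> \<exists>c. \<forall>j\<in>A. ip (\<lambda>u. f u - (\<Sum>i\<in>A. c i * b i u)) (b j) = 0"
  using assms
proof (induction A arbitrary: f rule: finite_induct)
  case empty
  then show ?case by simp
next
  case (insert a A)
  have sb: "sq_int (b i)" if "i \<in> insert a A" for i using insert.prems that by auto
  have ss: "sq_int (\<lambda>u. \<Sum>i\<in>A. c i * b i u)" for c by (intro sq_int_sum sq_int_cmult sb) auto
  from insert.IH[of "b a"] obtain d where d: "\<And>j. j \<in> A \<Longrightarrow> ip (\<lambda>u. b a u - (\<Sum>i\<in>A. d i * b i u)) (b j) = 0"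
    using sb by auto
  from insert.IH[of f] obtain c where c: "\<And>j. j \<in> A \<Longrightarrow> ip (\<lambda>u. f u - (\<Sum>i\<in>A. c i * b i u)) (b j) = 0"
    using sb insert.prems by auto
  define r where "r = (\<lambda>u. b a u - (\<Sum>i\<in>A. d i * b i u))"
  define s where "s = (\<lambda>u. f u - (\<Sum>i\<in>A. c i * b i u))"
  \<comment> \<open>If r has norm 0, division by zero makes t = 0 and the previous projection is
    kept.\<close>
  define t where "t = ip s r / of_real (normsq_sph r)"
  have sr: "sq_int r" unfolding r_def by (intro sq_int_diff ss sb) auto
  have s_s: "sq_int s" unfolding s_def by (intro sq_int_diff ss insert.prems)
  define s' where "s' = (\<lambda>u. s u - t * r u)"
  have ss': "sq_int s'" unfolding s'_def by (intro sq_int_diff sq_int_cmult sr s_s)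
  have 1: "ip s' (b j) = 0" if "j \<in> A" for j
    unfolding s'_def using c[OF that] d[OF that] sb[of j] that
    by (simp add: ip_diff_left s_s sq_int_cmult sr ip_cmult_left s_def[symmetric] r_def[symmetric])
  have 2: "ip s' r = 0"
  proof (cases "normsq_sph r = 0")
    case True
    then show ?thesis by (rule ip_null[OF sr])
  next
    case False
    have "ip s' r = ip s r - t * of_real (normsq_sph r)" unfolding s'_def
      by (simp add: ip_diff_left s_s sq_int_cmult sr ip_cmult_left ip_self)
    then show ?thesis using False by (simp add: t_def)
  qed
  have "ip s' (b a) = ip s' (\<lambda>u. r u + (\<Sum>i\<in>A. d i * b i u))" by (simp add: r_def)
  also have "\<dots> = 0"
    using 1 by (simp add: ip_add_right ss' sr ss 2 ip_sum_right sq_int_cmult sb ip_cmult_right)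
  finally have 3: "ip s' (b j) = 0" if "j \<in> insert a A" for j using 1 that by auto
  define c' where "c' = (\<lambda>i. if i = a then t else c i - t * d i)"
  have "(\<Sum>i\<in>insert a A. c' i * b i u) = t * b a u + (\<Sum>i\<in>A. (c i - t * d i) * b i u)" for u
  proof -
    have "(\<Sum>i\<in>A. c' i * b i u) = (\<Sum>i\<in>A. (c i - t * d i) * b i u)"
      using insert.hyps by (intro sum.cong) (auto simp: c'_def)
    then show ?thesis using insert.hyps by (simp add: c'_def)
  qed
  then have "(\<lambda>u. f u - (\<Sum>i\<in>insert a A. c' i * b i u)) = s'"
    by (simp add: fun_eq_iff s'_def s_def r_def left_diff_distrib sum_subtractf sum_distrib_left right_diff_distrib mult.assoc)
  then show ?case using 3 by (intro exI[of _ c']) simp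
qed

lemma sq_int_solid_harm: "solid_harm l h \<Longrightarrow> sq_int h"
  by (intro sq_int_continuous solid_harm_continuous)

lemma sq_int_homog: "homog l h \<Longrightarrow> sq_int h"
  by (intro sq_int_continuous homog_continuous)

lemma homog_on_sphere:
  assumes "homog k (P :: real^'n \<Rightarrow> complex)"
  shows "\<exists>H. (\<forall>j. 2 * j \<le> k \<longrightarrow> solid_harm (k - 2 * j) (H j)) \<and> (\<forall>x. norm x = 1 \<longrightarrow> P x = (\<Sum>j\<le>k div 2. H j x))"
  using harmonic_decomposition[OF assms] by (auto simp: norm_sq_def)

text \<open>Project onto all homogeneous polynomials of degree \<open>l\<close>, then keep the component of degree \<open>l\<close> of the
  harmonic decomposition.\<close>
lemma projection_exists:
  fixes f :: "real^'n \<Rightarrow> complex"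
  assumes n: "CARD('n) \<ge> 2" and f: "sq_int f"
  shows "\<exists>p. solid_harm l p \<and> (\<forall>h. solid_harm l h \<longrightarrow> ip (\<lambda>u. f u - p u) h = 0)"
proof -
  let ?A = "{\<alpha> :: 'n \<Rightarrow> nat. (\<Sum>i\<in>UNIV. \<alpha> i) = l}"
  define b where "b = (\<lambda>(\<alpha> :: 'n \<Rightarrow> nat) x. complex_of_real (\<Prod>i\<in>UNIV. (x $ i) ^ \<alpha> i))"
  have rb: "homog l (b \<alpha>)" if "\<alpha> \<in> ?A" for \<alpha> using homog_monomial[of \<alpha>] that by (auto simp: b_def)
  obtain c where c: "\<And>j. j \<in> ?A \<Longrightarrow> ip (\<lambda>u. f u - (\<Sum>i\<in>?A. c i * b i u)) (b j) = 0"
    using orthogonal_projection_span[where b=b, OF finite_multiindices[where l=l] sq_int_homog[OF rb] f] by blast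
  define q where "q = (\<lambda>u. \<Sum>i\<in>?A. c i * b i u)"
  have rq: "homog l q" unfolding q_def by (intro homog_sum homog_cmult rb)
  have sfq: "sq_int (\<lambda>u. f u - q u)" by (intro sq_int_diff f sq_int_homog[OF rq])
  have orth: "ip (\<lambda>u. f u - q u) P = 0" if P: "homog l P" for P
  proof -
    obtain d where "P = (\<lambda>x. \<Sum>\<alpha>\<in>?A. d \<alpha> * b \<alpha> x)"
      using P[folded homogeneous_polynomial_iff] unfolding homogeneous_polynomial_def b_def by blast
    then have "ip (\<lambda>u. f u - q u) P = (\<Sum>\<alpha>\<in>?A. cnj (d \<alpha>) * ip (\<lambda>u. f u - q u) (b \<alpha>))"
      by (simp only: ip_sum_right[OF sfq sq_int_cmult[OF sq_int_homog[OF rb]]] ip_cmult_right)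
    also have "\<dots> = 0"
    proof (rule sum.neutral, rule ballI)
      fix \<alpha> assume "\<alpha> \<in> ?A"
      from c[OF this] show "cnj (d \<alpha>) * ip (\<lambda>u. f u - q u) (b \<alpha>) = 0" unfolding q_def by simp
    qed
    finally show ?thesis .
  qed
  obtain H where H: "\<And>j. 2 * j \<le> l \<Longrightarrow> solid_harm (l - 2 * j) (H j)" "\<And>x. norm x = 1 \<Longrightarrow> q x = (\<Sum>j\<le>l div 2. H j x)"
    using homog_on_sphere[OF rq] by blast
  have H0: "solid_harm l (H 0)" using H(1)[of 0] by simp
  \<comment> \<open>The components of q of lower degree are orthogonal to h, so on the sphere they
    may be moved from q into the error.\<close>
  have "ip (\<lambda>u. f u - H 0 u) h = 0" if h: "solid_harm l h" for h
  proof -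
    have sH: "sq_int (H (Suc j))" if "j < l div 2" for j
      by (rule sq_int_solid_harm[OF H(1)]) (use that in auto)
    have z: "ip (H (Suc j)) h = 0" if "j < l div 2" for j
      using harmonic_orthogonal[OF n H(1)[of "Suc j"] solid_harm_cnj[OF h]] that by (auto simp: ip_sph_int)
    have "ip (\<lambda>u. f u - H 0 u) h = ip (\<lambda>u. (f u - q u) + (\<Sum>j<l div 2. H (Suc j) u)) h"
      by (rule ip_cong) (auto simp: H(2) sum.atMost_shift)
    also have "\<dots> = ip (\<lambda>u. f u - q u) h + ip (\<lambda>u. \<Sum>j<l div 2. H (Suc j) u) h"
      by (intro ip_add_left sfq sq_int_sum sH sq_int_solid_harm[OF h]) auto
    also have "ip (\<lambda>u. \<Sum>j<l div 2. H (Suc j) u) h = (\<Sum>j<l div 2. ip (H (Suc j)) h)"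
      by (intro ip_sum_left sH sq_int_solid_harm[OF h]) auto
    also have "\<dots> = 0" by (intro sum.neutral) (auto simp: z)
    also have "ip (\<lambda>u. f u - q u) h = 0" by (intro orth solid_harm_homog h)
    finally show ?thesis by simp
  qed
  with H0 show ?thesis by blast
qed

lemma normsq_sph_zero_continuous:
  fixes p :: "real^'n \<Rightarrow> complex"
  assumes c: "continuous_on UNIV p" and z: "normsq_sph p = 0" and u: "norm u = 1"
  shows "p u = 0"
proof (rule sphm_charges_open[OF c _ u])
  have "(\<integral>\<^sup>+u. ennreal ((norm (p u))\<^sup>2) \<partial>sphm) = ennreal (normsq_sph p)"
    unfolding normsq_sph_def by (intro nn_integral_eq_integral sq_int_integrable sq_int_continuous c) auto
  then show "(\<integral>\<^sup>+u. ennreal ((norm (p u))\<^sup>2) \<partial>sphm) = 0" using z by simp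
qed

lemma solid_harm_diff: "solid_harm k p \<Longrightarrow> solid_harm k q \<Longrightarrow> solid_harm k (\<lambda>x. p x - q x)"
  using solid_harm_add[OF _ solid_harm_cmult[of k q "- 1"], of p] by simp

text \<open>Evaluates the definite description. Two candidates differ by a solid harmonic orthogonal
  to itself, which vanishes at every point of the sphere by continuity; \<open>restrict\<close>
  fixes the values off the sphere, so the candidates agree as functions.\<close>

lemma harmonic_projection_eq:
  fixes f :: "real^'n \<Rightarrow> complex"
  assumes f: "sq_int f" and p: "solid_harm l p" and orth: "\<And>h. solid_harm l h \<Longrightarrow> ip (\<lambda>u. f u - p u) h = 0"
  shows "harmonic_projection l f = restrict p unit_sphere"
  unfolding harmonic_projection_def
proof (rule the_equality)
  have r: "ip (\<lambda>u. f u - restrict p unit_sphere u) (restrict h unit_sphere) = ip (\<lambda>u. f u - p u) h" for p h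
    by (rule ip_cong) auto
  show "restrict p unit_sphere \<in> spherical_harmonics l \<and> (\<forall>h\<in>spherical_harmonics l. ip (\<lambda>u. f u - restrict p unit_sphere u) h = 0)"
    using p orth by (auto simp: spherical_harmonics_eq r simp del: restrict_apply)
  fix g assume g: "g \<in> spherical_harmonics l \<and> (\<forall>h\<in>spherical_harmonics l. ip (\<lambda>u. f u - g u) h = 0)"
  then obtain p' where p': "solid_harm l p'" "g = restrict p' unit_sphere" by (auto simp: spherical_harmonics_eq)
  have orth': "ip (\<lambda>u. f u - p' u) h = 0" if "solid_harm l h" for h
  proof -
    have "restrict h unit_sphere \<in> spherical_harmonics l" using that by (auto simp: spherical_harmonics_eq)
    then have "ip (\<lambda>u. f u - g u) (restrict h unit_sphere) = 0" using g by blast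
    then show ?thesis by (simp only: p'(2) r)
  qed
  define h where "h = (\<lambda>u. p u - p' u)"
  have h: "solid_harm l h" unfolding h_def by (rule solid_harm_diff[OF p p'(1)])
  have s: "sq_int (\<lambda>u. f u - p u)" "sq_int (\<lambda>u. f u - p' u)" by (intro sq_int_diff f sq_int_solid_harm[OF p] sq_int_solid_harm[OF p'(1)])+
  have "ip h h = ip (\<lambda>u. (f u - p' u) - (f u - p u)) h" by (simp add: h_def)
  also have "\<dots> = 0" unfolding ip_diff_left[OF s(2,1) sq_int_solid_harm[OF h]] orth[OF h] orth'[OF h] by simp
  finally have "normsq_sph h = 0" by (simp add: ip_self)
  then have "p u = p' u" if "norm u = 1" for u
    using normsq_sph_zero_continuous[OF solid_harm_continuous[OF h] _ that] by (simp add: h_def)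
  then show "g = restrict p unit_sphere" unfolding p'(2) by (auto simp: restrict_def fun_eq_iff)
qed

lemma harmonic_projectionE:
  fixes f :: "real^'n \<Rightarrow> complex"
  assumes n: "CARD('n) \<ge> 2" and f: "sq_int f"
  obtains p where "\<And>l. solid_harm l (p l)" "\<And>l h. solid_harm l h \<Longrightarrow> ip (\<lambda>u. f u - p l u) h = 0"
    "\<And>l. (L2_norm_sphere (harmonic_projection l f))\<^sup>2 = normsq_sph (p l)"
proof -
  from projection_exists[OF n f] obtain p where p: "\<And>l. solid_harm l (p l)" "\<And>l h. solid_harm l h \<Longrightarrow> ip (\<lambda>u. f u - p l u) h = 0" by metis
  moreover have "(L2_norm_sphere (harmonic_projection l f))\<^sup>2 = normsq_sph (p l)" for l
  proof -
    have e: "harmonic_projection l f = restrict (p l) unit_sphere"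
      by (rule harmonic_projection_eq[OF f p(1)]) (rule p(2))
    have "(L2_norm_sphere (harmonic_projection l f))\<^sup>2 = normsq_sph (restrict (p l) unit_sphere)"
      unfolding e L2_norm_sphere_def normsq_sph_def by (intro real_sqrt_pow2 integral_nonneg) auto
    also have "\<dots> = normsq_sph (p l)" by (rule normsq_sph_cong) simp
    finally show ?thesis .
  qed
  ultimately show ?thesis using that by blast
qed


section \<open>Density of finite harmonic sums in L2\<close>

lemma harm_sum_mono:
  assumes "harm_sum L G" "L \<le> M" shows "harm_sum M G"
proof -
  obtain H where H: "\<And>l. solid_harm l (H l)" "G = (\<lambda>x. \<Sum>l\<le>L. H l x)" using assms unfolding harm_sum_def by blast
  define H' where "H' = (\<lambda>l. if l \<le> L then H l else (\<lambda>_. 0))"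
  have "solid_harm l (H' l)" for l using H(1) by (simp add: H'_def solid_harm_zero)
  moreover have "(\<Sum>l\<le>L. H l x) = (\<Sum>l\<le>M. H' l x)" for x
    by (rule sum.mono_neutral_cong_left) (use assms(2) in \<open>auto simp: H'_def\<close>)
  ultimately show ?thesis unfolding harm_sum_def H(2) by (intro exI[of _ H']) auto
qed

lemma harm_sum_add:
  assumes "harm_sum L G" "harm_sum L G'" shows "harm_sum L (\<lambda>x. G x + G' x)"
proof -
  obtain H H' where H: "\<And>l. solid_harm l (H l)" "G = (\<lambda>x. \<Sum>l\<le>L. H l x)"
    and H': "\<And>l. solid_harm l (H' l)" "G' = (\<lambda>x. \<Sum>l\<le>L. H' l x)" using assms unfolding harm_sum_def by blast
  have "solid_harm l (\<lambda>x. H l x + H' l x)" for l by (intro solid_harm_add H H')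
  then show ?thesis unfolding harm_sum_def H(2) H'(2) sum.distrib[symmetric] by (intro exI[of _ "\<lambda>l x. H l x + H' l x"]) auto
qed

lemma harm_sum_cmult:
  assumes "harm_sum L G" shows "harm_sum L (\<lambda>x. c * G x)"
proof -
  obtain H where H: "\<And>l. solid_harm l (H l)" "G = (\<lambda>x. \<Sum>l\<le>L. H l x)" using assms unfolding harm_sum_def by blast
  have "solid_harm l (\<lambda>x. c * H l x)" for l by (intro solid_harm_cmult H)
  then show ?thesis unfolding harm_sum_def H(2) sum_distrib_left by (intro exI[of _ "\<lambda>l x. c * H l x"]) auto
qed

lemma solid_harm_harm_sum:
  assumes "solid_harm l p" shows "harm_sum l p"
proof -
  define H where "H = (\<lambda>m. if m = l then p else (\<lambda>_. 0))"
  have "solid_harm m (H m)" for m using assms by (simp add: H_def solid_harm_zero)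
  moreover have "p x = (\<Sum>m\<le>l. H m x)" for x
  proof -
    have "(\<Sum>m\<le>l. H m x) = (\<Sum>m\<le>l. if m = l then p x else 0)" by (intro sum.cong) (auto simp: H_def)
    then show ?thesis by simp
  qed
  ultimately show ?thesis unfolding harm_sum_def by (intro exI[of _ H]) auto
qed

text \<open>Equality is asked on the sphere only: there |x|^2 = 1, so every polynomial qualifies,
  although in general it is not a sum of harmonic ones on the whole space.\<close>

definition sph_poly :: "(real^'n \<Rightarrow> complex) \<Rightarrow> bool" where
  "sph_poly q \<longleftrightarrow> (\<exists>N G. harm_sum N G \<and> (\<forall>x. norm x = 1 \<longrightarrow> q x = G x))"

lemma sph_poly_add:
  assumes "sph_poly p" "sph_poly q" shows "sph_poly (\<lambda>x. p x + q x)"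
proof -
  obtain N G where G: "harm_sum N G" "\<And>x. norm x = 1 \<Longrightarrow> p x = G x"
    using assms(1) unfolding sph_poly_def by blast
  obtain M G' where G': "harm_sum M G'" "\<And>x. norm x = 1 \<Longrightarrow> q x = G' x"
    using assms(2) unfolding sph_poly_def by blast
  have "harm_sum (max N M) (\<lambda>x. G x + G' x)"
    by (intro harm_sum_add harm_sum_mono[OF G(1)] harm_sum_mono[OF G'(1)]) auto
  then show ?thesis unfolding sph_poly_def using G(2) G'(2) by (intro exI[of _ "max N M"] exI[of _ "\<lambda>x. G x + G' x"]) auto
qed

lemma sph_poly_zero: "sph_poly (\<lambda>_. 0)"
  unfolding sph_poly_def using solid_harm_harm_sum[OF solid_harm_zero[of 0]] by blast

lemma sph_poly_homog:
  assumes "homog k P" shows "sph_poly P"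
proof -
  obtain H where H: "\<And>j. 2 * j \<le> k \<Longrightarrow> solid_harm (k - 2 * j) (H j)" "\<And>x. norm x = 1 \<Longrightarrow> P x = (\<Sum>j\<le>k div 2. H j x)"
    using homog_on_sphere[OF assms] by blast
  have "sph_poly (\<lambda>x. \<Sum>j\<in>J. H j x)" if "finite J" "J \<subseteq> {..k div 2}" for J
    using that
  proof (induction J rule: finite_induct)
    case empty
    then show ?case by (simp add: sph_poly_zero)
  next
    case (insert j J)
    have "solid_harm (k - 2 * j) (H j)" using insert.prems by (intro H(1)) auto
    then have "sph_poly (H j)" using solid_harm_harm_sum unfolding sph_poly_def by blast
    then show ?case using insert by (simp add: sph_poly_add)
  qed
  from this[of "{..k div 2}"] show ?thesis unfolding sph_poly_def using H(2) by auto
qed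

text \<open>Polynomials of mixed degree, closed under products: the bridge from
  \<open>real_polynomial_function\<close>, the form in which Stone-Weierstrass delivers its
  approximants, to \<open>homog\<close>.\<close>

inductive poly_fun :: "(real^'n \<Rightarrow> complex) \<Rightarrow> bool" where
  poly_fun_homog: "homog k p \<Longrightarrow> poly_fun p"
| poly_fun_add: "poly_fun p \<Longrightarrow> poly_fun q \<Longrightarrow> poly_fun (\<lambda>x. p x + q x)"

lemma poly_fun_mult_homog: "poly_fun p \<Longrightarrow> homog m q \<Longrightarrow> poly_fun (\<lambda>x. p x * q x)"
proof (induction rule: poly_fun.induct)
  case (poly_fun_homog k p)
  then show ?case using homog_mult poly_fun.poly_fun_homog by blast
next
  case (poly_fun_add p r)
  then show ?case using poly_fun.poly_fun_add by (simp add: distrib_right)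
qed

lemma poly_fun_mult: "poly_fun q \<Longrightarrow> poly_fun p \<Longrightarrow> poly_fun (\<lambda>x. p x * q x)"
proof (induction rule: poly_fun.induct)
  case (poly_fun_homog k q)
  then show ?case using poly_fun_mult_homog by blast
next
  case (poly_fun_add q r)
  then show ?case using poly_fun.poly_fun_add by (simp add: distrib_left)
qed

lemma poly_fun_sph_poly: "poly_fun p \<Longrightarrow> sph_poly p"
  by (induction rule: poly_fun.induct) (auto intro: sph_poly_homog sph_poly_add)

lemma real_polynomial_poly_fun: "real_polynomial_function g \<Longrightarrow> poly_fun (\<lambda>x::real^'n. of_real (g x))"
proof (induction rule: real_polynomial_function.induct)
  case (linear f)
  have fx: "f x = (\<Sum>i\<in>UNIV. x $ i * f (axis i 1))" for x
  proof -
    have "f x = f (\<Sum>i\<in>UNIV. (x $ i) *\<^sub>R axis i 1)"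
      by (simp add: basis_expansion flip: scalar_mult_eq_scaleR)
    also have "\<dots> = (\<Sum>i\<in>UNIV. x $ i * f (axis i 1))"
      using bounded_linear.linear[OF linear] by (simp add: linear_sum linear_scale)
    finally show ?thesis .
  qed
  have "(\<lambda>x. complex_of_real (f x)) = (\<lambda>x. \<Sum>i\<in>UNIV. of_real (f (axis i 1)) * of_real (x $ i))"
  proof
    fix x
    have "complex_of_real (f x) = of_real (\<Sum>i\<in>UNIV. x $ i * f (axis i 1))" by (rule arg_cong[OF fx])
    then show "complex_of_real (f x) = (\<Sum>i\<in>UNIV. of_real (f (axis i 1)) * of_real (x $ i))"
      by (simp only: of_real_sum of_real_mult mult.commute)
  qed
  moreover have "homog 1 (\<lambda>x. \<Sum>i\<in>UNIV. of_real (f (axis i 1)) * complex_of_real (x $ i))"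
    by (intro homog_sum homog_cmult homog_coord)
  ultimately show ?case using poly_fun_homog by metis
next
  case (const c)
  show ?case by (rule poly_fun_homog[OF homog_const])
next
  case (add f g)
  then show ?case using poly_fun_add by fastforce
next
  case (mult f g)
  then show ?case using poly_fun_mult[OF mult.IH(2) mult.IH(1)] by simp
qed

text \<open>Membership in the L2 closure of the finite harmonic sums, of any degree.\<close>

definition poly_approx :: "(real^'n \<Rightarrow> complex) \<Rightarrow> bool" where
  "poly_approx f \<longleftrightarrow> sq_int f \<and> (\<forall>e>0. \<exists>N G. harm_sum N G \<and> normsq_sph (\<lambda>u. f u - G u) < e)"

lemma poly_approx_continuous:
  fixes \<phi> :: "real^'n \<Rightarrow> real"
  assumes c: "continuous_on UNIV \<phi>" shows "poly_approx (\<lambda>u. of_real (\<phi> u))"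
  unfolding poly_approx_def
proof (intro conjI allI impI)
  have c': "continuous_on UNIV (\<lambda>u. complex_of_real (\<phi> u))" by (intro continuous_intros c)
  show s: "sq_int (\<lambda>u. complex_of_real (\<phi> u))" by (rule sq_int_continuous[OF c'])
  fix e :: real assume e: "e > 0"
  let ?m = "measure (sphm :: (real^'n) measure) unit_sphere"
  \<comment> \<open>The bound 1 gives r^2 \<le> r, which turns the uniform error into a squared one.
    The summand 1 keeps the denominator positive and makes the final estimate strict.\<close>
  define r where "r = min 1 (e / (?m + 1))"
  have m0: "?m \<ge> 0" by simp
  have mp: "?m + 1 > 0" using m0 by linarith
  have r: "0 < r" "r \<le> 1" unfolding r_def using divide_pos_pos[OF e mp] by simp_all
  have cs: "continuous_on unit_sphere \<phi>" by (rule continuous_on_subset[OF c]) simp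
  obtain g where g: "real_polynomial_function g" "\<And>x. x \<in> unit_sphere \<Longrightarrow> \<bar>\<phi> x - g x\<bar> < r"
    by (rule Stone_Weierstrass_real_polynomial_function[OF compact_sphere cs r(1)]) blast
  obtain N G where G: "harm_sum N G" "\<And>x. norm x = 1 \<Longrightarrow> complex_of_real (g x) = G x"
    using poly_fun_sph_poly[OF real_polynomial_poly_fun[OF g(1)]] unfolding sph_poly_def by blast
  have "normsq_sph (\<lambda>u. of_real (\<phi> u) - G u) \<le> (\<integral>u. r \<partial>(sphm :: (real^'n) measure))"
    unfolding normsq_sph_def
  proof (rule integral_mono)
    show "integrable sphm (\<lambda>u. (norm (of_real (\<phi> u) - G u))\<^sup>2)"
      by (intro sq_int_integrable sq_int_diff s sq_int_continuous harm_sum_continuous[OF G(1)])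
    fix u :: "real^'n" assume "u \<in> space sphm"
    then have u: "norm u = 1" by (simp add: space_sphere_measure)
    have "norm (of_real (\<phi> u) - G u) = \<bar>\<phi> u - g u\<bar>"
      using G(2)[OF u] by (metis norm_of_real of_real_diff)
    then have "norm (of_real (\<phi> u) - G u) \<le> r" using g(2)[of u] u by simp
    then have "(norm (of_real (\<phi> u) - G u))\<^sup>2 \<le> r\<^sup>2" by (intro power_mono) auto
    also have "\<dots> \<le> r" using r by (simp add: power2_eq_square mult_left_le)
    finally show "(norm (of_real (\<phi> u) - G u))\<^sup>2 \<le> r" .
  qed simp
  also have "\<dots> = r * ?m" by (simp add: space_sphere_measure)
  also have "\<dots> \<le> (e / (?m + 1)) * ?m" by (intro mult_right_mono) (auto simp: r_def)
  also have "\<dots> = e * (?m / (?m + 1))" by simp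
  also have "\<dots> < e * 1"
  proof (rule mult_strict_left_mono[OF _ e])
    show "?m / (?m + 1) < 1" using mp by (subst divide_less_eq_1_pos) auto
  qed
  also have "\<dots> = e" by simp
  finally show "\<exists>N G. harm_sum N G \<and> normsq_sph (\<lambda>u. of_real (\<phi> u) - G u) < e" using G(1) by blast
qed

lemma poly_approx_sq_int: "poly_approx f \<Longrightarrow> sq_int f" by (simp add: poly_approx_def)

lemma poly_approx_lim:
  assumes f: "sq_int f" and g: "\<And>k. poly_approx (g k)" and lim: "(\<lambda>k. normsq_sph (\<lambda>u. f u - g k u)) \<longlonglongrightarrow> 0"
  shows "poly_approx f"
  unfolding poly_approx_def
proof (intro conjI allI impI f)
  fix e :: real assume e: "e > 0"
  obtain k where k: "normsq_sph (\<lambda>u. f u - g k u) < e / 4"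
    using order_tendstoD(2)[OF lim, of "e / 4"] e by (auto simp: eventually_sequentially)
  obtain N G where G: "harm_sum N G" "normsq_sph (\<lambda>u. g k u - G u) < e / 4"
    using g[of k] e unfolding poly_approx_def by (metis zero_less_divide_iff zero_less_numeral)
  have "normsq_sph (\<lambda>u. f u - G u) = normsq_sph (\<lambda>u. (f u - g k u) + (g k u - G u))" by simp
  also have "\<dots> \<le> 2 * normsq_sph (\<lambda>u. f u - g k u) + 2 * normsq_sph (\<lambda>u. g k u - G u)"
    by (intro normsq_sph_add_le sq_int_diff f poly_approx_sq_int g sq_int_continuous harm_sum_continuous[OF G(1)])
  also have "\<dots> < e" using k G(2) by simp
  finally show "\<exists>N G. harm_sum N G \<and> normsq_sph (\<lambda>u. f u - G u) < e" using G(1) by blast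
qed

lemma poly_approx_add:
  assumes "poly_approx f" "poly_approx g" shows "poly_approx (\<lambda>u. f u + g u)"
  unfolding poly_approx_def
proof (intro conjI allI impI sq_int_add poly_approx_sq_int assms)
  fix e :: real assume e: "e > 0"
  then have "e / 4 > 0" by simp
  then obtain N G M G' where G: "harm_sum N G" "normsq_sph (\<lambda>u. f u - G u) < e / 4" "harm_sum M G'" "normsq_sph (\<lambda>u. g u - G' u) < e / 4"
    using assms unfolding poly_approx_def by meson
  have "normsq_sph (\<lambda>u. f u + g u - (G u + G' u)) = normsq_sph (\<lambda>u. (f u - G u) + (g u - G' u))" by (simp add: algebra_simps)
  also have "\<dots> \<le> 2 * normsq_sph (\<lambda>u. f u - G u) + 2 * normsq_sph (\<lambda>u. g u - G' u)"
    by (intro normsq_sph_add_le sq_int_diff poly_approx_sq_int assms sq_int_continuous harm_sum_continuous[OF G(1)] harm_sum_continuous[OF G(3)])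
  also have "\<dots> < e" using G by simp
  finally have "normsq_sph (\<lambda>u. f u + g u - (G u + G' u)) < e" .
  moreover have "harm_sum (max N M) (\<lambda>x. G x + G' x)"
    by (intro harm_sum_add harm_sum_mono[OF G(1)] harm_sum_mono[OF G(3)]) auto
  ultimately show "\<exists>N Ga. harm_sum N Ga \<and> normsq_sph (\<lambda>u. f u + g u - Ga u) < e" by blast
qed

lemma normsq_sph_cmult: "normsq_sph (\<lambda>u. c * f u) = (norm c)\<^sup>2 * normsq_sph f"
  by (simp add: normsq_sph_def norm_mult power_mult_distrib)

lemma poly_approx_cmult:
  assumes "poly_approx f" shows "poly_approx (\<lambda>u. c * f u)"
  unfolding poly_approx_def
proof (intro conjI allI impI sq_int_cmult poly_approx_sq_int assms)
  fix e :: real assume e: "e > 0"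
  let ?d = "(norm c)\<^sup>2 + 1"
  have d: "?d > 0" by (simp add: add_nonneg_pos)
  then have "e / ?d > 0" using e by simp
  then obtain N G where G: "harm_sum N G" "normsq_sph (\<lambda>u. f u - G u) < e / ?d" using assms unfolding poly_approx_def by meson
  have "normsq_sph (\<lambda>u. c * f u - c * G u) = (norm c)\<^sup>2 * normsq_sph (\<lambda>u. f u - G u)"
    unfolding right_diff_distrib[symmetric] by (rule normsq_sph_cmult)
  also have "\<dots> \<le> ?d * normsq_sph (\<lambda>u. f u - G u)" by (intro mult_right_mono normsq_sph_nonneg) simp
  also have "\<dots> < e" using G(2) d by (simp add: field_simps)
  finally show "\<exists>N Ga. harm_sum N Ga \<and> normsq_sph (\<lambda>u. c * f u - Ga u) < e" using harm_sum_cmult[OF G(1)] by blast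
qed

lemma poly_approx_zero: "poly_approx (\<lambda>u. 0)"
  using poly_approx_continuous[of "\<lambda>_. 0"] by simp

lemma poly_approx_sum: "(\<And>a. a \<in> A \<Longrightarrow> poly_approx (f a)) \<Longrightarrow> poly_approx (\<lambda>u. \<Sum>a\<in>A. f a u)"
proof (induction A rule: infinite_finite_induct)
  case (insert a A)
  then show ?case using poly_approx_add[of "f a"] by simp
qed (simp_all add: poly_approx_zero)

lemma poly_approx_dominated:
  fixes f :: "real^'n \<Rightarrow> complex"
  assumes f: "sq_int f" and g: "\<And>k. poly_approx (g k)" and lim: "\<And>u. norm u = 1 \<Longrightarrow> (\<lambda>k. g k u) \<longlonglongrightarrow> f u"
    and w: "integrable sphm (\<lambda>u. (w u)\<^sup>2)" and b: "\<And>k u. norm (g k u) \<le> w u"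
  shows "poly_approx f"
proof (rule poly_approx_lim[OF f g])
  have "(\<lambda>k. normsq_sph (\<lambda>u. f u - g k u)) \<longlonglongrightarrow> (\<integral>u. 0 \<partial>(sphm :: (real^'n) measure))"
    unfolding normsq_sph_def
  proof (rule integral_dominated_convergence[where w="\<lambda>u. 2 * (norm (f u))\<^sup>2 + 2 * (w u)\<^sup>2"])
    show "integrable sphm (\<lambda>u. 2 * (norm (f u))\<^sup>2 + 2 * (w u)\<^sup>2)"
      by (intro Bochner_Integration.integrable_add integrable_mult_right w sq_int_integrable f)
    show "(\<lambda>u. (norm (f u - g k u))\<^sup>2) \<in> borel_measurable sphm" for k
      using sq_int_measurable[OF f] sq_int_measurable[OF poly_approx_sq_int[OF g]] by measurable
    show "AE u in sphm. (\<lambda>k. (norm (f u - g k u))\<^sup>2) \<longlonglongrightarrow> 0"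
    proof (rule AE_I2)
      fix u :: "real^'n" assume "u \<in> space sphm"
      then have "(\<lambda>k. g k u) \<longlonglongrightarrow> f u" by (intro lim) (simp add: space_sphere_measure)
      then have "(\<lambda>k. (norm (f u - g k u))\<^sup>2) \<longlonglongrightarrow> (norm (f u - f u))\<^sup>2" by (intro tendsto_intros)
      then show "(\<lambda>k. (norm (f u - g k u))\<^sup>2) \<longlonglongrightarrow> 0" by simp
    qed
    show "AE u in sphm. norm ((norm (f u - g k u))\<^sup>2) \<le> 2 * (norm (f u))\<^sup>2 + 2 * (w u)\<^sup>2" for k
    proof (rule AE_I2)
      fix u
      have "(norm (f u - g k u))\<^sup>2 \<le> 2 * (norm (f u))\<^sup>2 + 2 * (norm (g k u))\<^sup>2"
        using norm_add_sq_le[of "f u" "- g k u"] by simp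
      moreover have "(norm (g k u))\<^sup>2 \<le> (w u)\<^sup>2" using b by (intro power_mono) auto
      ultimately show "norm ((norm (f u - g k u))\<^sup>2) \<le> 2 * (norm (f u))\<^sup>2 + 2 * (w u)\<^sup>2" by simp
    qed
  qed simp
  then show "(\<lambda>k. normsq_sph (\<lambda>u. f u - g k u)) \<longlonglongrightarrow> 0" by simp
qed

lemma sq_int_indicator: "A \<in> sets borel \<Longrightarrow> sq_int (indicator A :: real^'n \<Rightarrow> complex)"
  by (rule sqiI_bound[where w="\<lambda>_. 1"], rule measurable_sphmI, erule borel_measurable_indicator)
     (auto simp: indicator_def)

text \<open>Closed sets form a generator of the Borel sets stable under intersection, and their
  indicators are limits of continuous functions. Complements and countable disjoint unions preserve
  approximability.\<close>

lemma poly_approx_indicator: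
  assumes "A \<in> sets borel" shows "poly_approx (indicator A :: real^'n \<Rightarrow> complex)"
proof -
  have 1: "Int_stable (Collect closed :: (real^'n) set set)" by (auto simp: Int_stable_def)
  have "A \<in> sigma_sets UNIV (Collect closed)"
    using assms by (simp add: borel_eq_closed)
  then show ?thesis
  proof (rule sigma_sets_induct_disjoint[OF 1 Pow_UNIV[THEN equalityD2, THEN order_trans[OF subset_UNIV]]])
    fix C :: "(real^'n) set" assume "C \<in> Collect closed"
    then have C: "closed C" by simp
    show "poly_approx (indicator C :: real^'n \<Rightarrow> complex)"
    proof (cases "C = {}")
      case True
      then show ?thesis using poly_approx_zero by (simp add: indicator_def[abs_def])
    next
      case False
      \<comment> \<open>Continuous cutoffs that decrease to the indicator of C. The empty set was
        split off because \<open>infdist\<close> to it is 0 by convention.\<close>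
      define \<phi> where "\<phi> = (\<lambda>k u. max 0 (1 - real k * infdist u C))"
      show ?thesis
      proof (rule poly_approx_dominated[where w="\<lambda>_. 1" and g="\<lambda>k u. of_real (\<phi> k u)"])
        show "sq_int (indicator C :: real^'n \<Rightarrow> complex)" by (rule sq_int_indicator) (use C in auto)
        show "poly_approx (\<lambda>u. complex_of_real (\<phi> k u))" for k
          unfolding \<phi>_def by (intro poly_approx_continuous continuous_intros)
        show "norm (complex_of_real (\<phi> k u)) \<le> 1" for k u
          unfolding \<phi>_def by (simp add: infdist_nonneg)
        show "(\<lambda>k. complex_of_real (\<phi> k u)) \<longlonglongrightarrow> indicator C u" for u
        proof (cases "u \<in> C")
          case True
          then show ?thesis by (simp add: \<phi>_def)
        next
          case out: False
          then have d: "infdist u C > 0"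
            using C False in_closed_iff_infdist_zero[OF C False, of u] infdist_nonneg[of u C] by linarith
          obtain K where K: "real K * infdist u C > 1" using ex_less_of_nat_mult[OF d] by blast
          have "\<phi> k u = 0" if "k \<ge> K" for k
          proof -
            have "real K * infdist u C \<le> real k * infdist u C" using that d by (intro mult_right_mono) auto
            then show ?thesis using K by (simp add: \<phi>_def)
          qed
          then have "\<forall>\<^sub>F k in sequentially. complex_of_real (\<phi> k u) = indicator C u"
            using out by (auto simp: eventually_sequentially intro!: exI[of _ K])
          then show ?thesis by (rule tendsto_eventually)
        qed
      qed simp
    qed
  next
    show "poly_approx (indicator {} :: real^'n \<Rightarrow> complex)" using poly_approx_zero by (simp add: indicator_def[abs_def])
  next
    fix A :: "(real^'n) set" assume "poly_approx (indicator A :: real^'n \<Rightarrow> complex)"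
    from poly_approx_add[OF poly_approx_continuous[of "\<lambda>_. 1"] poly_approx_cmult[OF this, of "- 1"]]
    have "poly_approx (\<lambda>u. 1 - indicator A u :: complex)" by simp
    moreover have "(\<lambda>u. 1 - indicator A u :: complex) = indicator (UNIV - A)" by (auto simp: indicator_def fun_eq_iff)
    ultimately show "poly_approx (indicator (UNIV - A) :: real^'n \<Rightarrow> complex)" by simp
  next
    fix A :: "nat \<Rightarrow> (real^'n) set"
    assume A: "disjoint_family A" "range A \<subseteq> sigma_sets UNIV (Collect closed)" "\<And>i. poly_approx (indicator (A i) :: real^'n \<Rightarrow> complex)"
    have m: "A i \<in> sets borel" for i using A(2) by (auto simp: borel_eq_closed)
    show "poly_approx (indicator (\<Union>i. A i) :: real^'n \<Rightarrow> complex)"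
    proof (rule poly_approx_dominated[where w="\<lambda>_. 1" and g="\<lambda>k. indicator (\<Union>i<k. A i)"])
      show "sq_int (indicator (\<Union>i. A i) :: real^'n \<Rightarrow> complex)" by (rule sq_int_indicator) (use m in auto)
      show "poly_approx (indicator (\<Union>i<k. A i) :: real^'n \<Rightarrow> complex)" for k
      proof -
        have "(indicator (\<Union>i<k. A i) :: real^'n \<Rightarrow> complex) = (\<lambda>u. \<Sum>i<k. indicator (A i) u)"
          by (intro ext indicator_UN_disjoint) (use A(1) in \<open>auto simp: disjoint_family_on_def\<close>)
        then show ?thesis using poly_approx_sum[of "{..<k}" "\<lambda>i. indicator (A i)"] A(3) by simp
      qed
      show "(\<lambda>k. indicator (\<Union>i<k. A i) u :: complex) \<longlonglongrightarrow> indicator (\<Union>i. A i) u" for u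
        by (rule LIMSEQ_indicator_UN)
    qed (auto simp: indicator_def)
  qed
qed

text \<open>Simple functions bounded by \<open>2 * norm (f u)\<close> converge to f pointwise, so
  dominated convergence reduces the claim to indicators.\<close>

lemma poly_approx_borel:
  fixes f :: "real^'n \<Rightarrow> complex"
  assumes f: "f \<in> borel_measurable borel" and s: "sq_int f" shows "poly_approx f"
proof -
  obtain F where F: "\<And>i. simple_function borel (F i)" "\<And>x. (\<lambda>i. F i x) \<longlonglongrightarrow> f x" "\<And>i x. dist (F i x) 0 \<le> 2 * dist (f x) 0"
    using borel_measurable_implies_sequence_metric[OF f, of 0] by auto
  show ?thesis
  proof (rule poly_approx_dominated[OF s, where g=F and w="\<lambda>u. 2 * norm (f u)"])
    show "poly_approx (F i)" for i
    proof -
      have fin: "finite (F i ` UNIV)" using F(1)[of i] by (simp add: simple_function_def)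
      have "F i = (\<lambda>x. \<Sum>y\<in>F i ` UNIV. y * indicator (F i -` {y}) x)"
      proof
        fix x
        have "(\<Sum>y\<in>F i ` UNIV. y * indicator (F i -` {y}) x) = (\<Sum>y\<in>F i ` UNIV. if F i x = y then y else 0)"
          by (intro sum.cong) (auto simp: indicator_def)
        then show "F i x = (\<Sum>y\<in>F i ` UNIV. y * indicator (F i -` {y}) x)" using fin by (simp add: sum.delta)
      qed
      moreover have "poly_approx (\<lambda>x. \<Sum>y\<in>F i ` UNIV. y * indicator (F i -` {y}) x)"
        using simple_functionD(2)[OF F(1)[of i]] by (intro poly_approx_sum poly_approx_cmult poly_approx_indicator) auto
      ultimately show ?thesis by simp
    qed
    show "(\<lambda>k. F k u) \<longlonglongrightarrow> f u" for u by (rule F)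
    show "norm (F k u) \<le> 2 * norm (f u)" for k u using F(3)[of k u] by simp
    show "integrable sphm (\<lambda>u. (2 * norm (f u))\<^sup>2)"
      using integrable_mult_right[OF sq_int_integrable[OF s], of 4] by (simp add: power_mult_distrib)
  qed
qed

text \<open>A function measurable for the completion agrees almost everywhere with one measurable
  for the Borel sets of the sphere; extended by 0 it becomes Borel on the whole space.\<close>

lemma sq_int_borel_version:
  fixes f :: "real^'n \<Rightarrow> complex"
  assumes "f \<in> borel_measurable sphm"
  shows "\<exists>g. g \<in> borel_measurable borel \<and> (AE u in sphm. f u = g u)"
proof -
  have "(\<lambda>u. Re (f u)) \<in> borel_measurable (completion sphere_measure_borel)" "(\<lambda>u. Im (f u)) \<in> borel_measurable (completion sphere_measure_borel)"
    using assms unfolding sphm_completion by (auto intro: borel_measurable_Re borel_measurable_Im)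
  then obtain a b where a: "a \<in> borel_measurable sphere_measure_borel" "AE u in sphere_measure_borel. Re (f u) = a u"
    and b: "b \<in> borel_measurable sphere_measure_borel" "AE u in sphere_measure_borel. Im (f u) = b u"
    using completion_ex_borel_measurable_real[of "\<lambda>u. Re (f u)" sphere_measure_borel] completion_ex_borel_measurable_real[of "\<lambda>u. Im (f u)" sphere_measure_borel]
    by blast
  define g0 where "g0 = (\<lambda>u. complex_of_real (a u) + \<i> * of_real (b u))"
  have "g0 \<in> borel_measurable (restrict_space borel unit_sphere)"
    unfolding g0_def using a(1) b(1) by (simp add: measurable_cong_sets[OF sets_sphere_measure_borel refl])
  then have g0: "(\<lambda>u. indicator unit_sphere u *\<^sub>R g0 u) \<in> borel_measurable borel"
    by (subst (asm) borel_measurable_restrict_space_iff) auto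
  have "AE u in sphere_measure_borel. f u = indicator unit_sphere u *\<^sub>R g0 u"
    using a(2) b(2) AE_space
  proof eventually_elim
    case (elim u)
    then show ?case by (simp add: space_sphere_measure_borel g0_def complex_eq_iff)
  qed
  then have "AE u in sphm. f u = indicator unit_sphere u *\<^sub>R g0 u"
    unfolding sphm_completion by (rule AE_completion)
  with g0 show ?thesis by blast
qed

lemma poly_approx_all:
  fixes f :: "real^'n \<Rightarrow> complex"
  assumes f: "sq_int f" shows "poly_approx f"
proof -
  obtain g where g: "g \<in> borel_measurable borel" "AE u in sphm. f u = g u"
    using sq_int_borel_version[OF sq_int_measurable[OF f]] by blast
  have gm: "g \<in> borel_measurable sphm" by (rule measurable_sphmI[OF g(1)])
  have "integrable sphm (\<lambda>u. (norm (g u))\<^sup>2)"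
  proof (rule integrable_cong_AE_imp[OF sq_int_integrable[OF f]])
    show "(\<lambda>u. (norm (g u))\<^sup>2) \<in> borel_measurable sphm" using gm by measurable
    show "AE u in sphm. (norm (f u))\<^sup>2 = (norm (g u))\<^sup>2" using g(2) by eventually_elim simp
  qed
  then have "sq_int g" using gm by (simp add: square_integrable_sphere_def)
  from poly_approx_borel[OF g(1) this] have ag: "poly_approx g" .
  have "normsq_sph (\<lambda>u. f u - G u) = normsq_sph (\<lambda>u. g u - G u)" if "harm_sum N G" for N G
    unfolding normsq_sph_def
  proof (rule integral_cong_AE)
    have "G \<in> borel_measurable sphm" by (intro measurable_sphmI borel_measurable_continuous_onI harm_sum_continuous[OF that])
    then show "(\<lambda>u. (norm (f u - G u))\<^sup>2) \<in> borel_measurable sphm" "(\<lambda>u. (norm (g u - G u))\<^sup>2) \<in> borel_measurable sphm"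
      using gm sq_int_measurable[OF f] by measurable
    show "AE u in sphm. (norm (f u - G u))\<^sup>2 = (norm (g u - G u))\<^sup>2" using g(2) by eventually_elim simp
  qed
  then show ?thesis using ag f unfolding poly_approx_def by metis
qed

text \<open>G is the partial sum S L. Since S N is the best approximation of f among harmonic sums
  of degree at most N, density makes the error of S N small for large N; the error of S L exceeds it
  by the squared norms of the components of degrees between L and N.\<close>

theorem parseval_tail:
  fixes f :: "real^'n \<Rightarrow> complex"
  assumes n: "CARD('n) \<ge> 2" and f: "sq_int f"
  obtains G where "harm_sum L G" "normsq_sph f = normsq_sph G + normsq_sph (\<lambda>u. f u - G u)"
    "normsq_sph (\<lambda>u. f u - G u) \<le> (\<Sum>\<^sub>\<infinity>l\<in>{L<..}. (L2_norm_sphere (harmonic_projection l f))\<^sup>2)"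
proof -
  obtain p where p: "\<And>l. solid_harm l (p l)" "\<And>l h. solid_harm l h \<Longrightarrow> ip (\<lambda>u. f u - p l u) h = 0"
    "\<And>l. (L2_norm_sphere (harmonic_projection l f))\<^sup>2 = normsq_sph (p l)"
    using harmonic_projectionE[OF n f] by blast
  define S where "S = (\<lambda>N u. \<Sum>l\<le>N. p l u)"
  have hS: "harm_sum N (S N)" for N unfolding harm_sum_def S_def using p(1) by blast
  have sp: "sq_int (p l)" for l by (rule sq_int_solid_harm[OF p(1)])
  have sS: "sq_int (S N)" for N by (rule sq_int_continuous[OF harm_sum_continuous[OF hS]])
  have sfS: "sq_int (\<lambda>u. f u - S N u)" for N by (intro sq_int_diff f sS)
  have orth: "ip (\<lambda>u. f u - S N u) h = 0" if h: "solid_harm l h" and l: "l \<le> N" for l h N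
  proof -
    have "ip (S N) h = (\<Sum>m\<le>N. ip (p m) h)" unfolding S_def by (intro ip_sum_left sq_int_solid_harm[OF h] sp)
    also have "\<dots> = (\<Sum>m\<le>N. if m = l then ip (p l) h else 0)"
      using harmonic_orthogonal[OF n p(1) solid_harm_cnj[OF h]] by (intro sum.cong) (auto simp: ip_sph_int)
    also have "\<dots> = ip (p l) h" using l by simp
    also have "\<dots> = ip f h" using p(2)[OF h] by (simp add: ip_diff_left f sp sq_int_solid_harm[OF h])
    finally show ?thesis by (simp add: ip_diff_left f sS sq_int_solid_harm[OF h])
  qed
  have orthG: "ip (\<lambda>u. f u - S N u) G = 0" if G: "harm_sum N G" for G N
  proof -
    obtain H where H: "\<And>l. solid_harm l (H l)" "G = (\<lambda>x. \<Sum>l\<le>N. H l x)" using G unfolding harm_sum_def by blast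
    have "ip (\<lambda>u. f u - S N u) G = (\<Sum>l\<le>N. ip (\<lambda>u. f u - S N u) (H l))"
      unfolding H(2) by (intro ip_sum_right sfS sq_int_solid_harm[OF H(1)])
    also have "\<dots> = 0" by (intro sum.neutral ballI orth[OF H(1)]) simp
    finally show ?thesis .
  qed
  have split: "normsq_sph (\<lambda>u. f u - G u) = normsq_sph (\<lambda>u. f u - S N u) + normsq_sph (\<lambda>u. S N u - G u)" if G: "harm_sum N G" for G N
  proof -
    have sG: "sq_int G" by (rule sq_int_continuous[OF harm_sum_continuous[OF G]])
    have h: "harm_sum N (\<lambda>u. S N u - G u)" using harm_sum_add[OF hS harm_sum_cmult[OF G, of "- 1"]] by simp
    have "normsq_sph (\<lambda>u. f u - G u) = normsq_sph (\<lambda>u. (f u - S N u) + (S N u - G u))" by simp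
    also have "\<dots> = normsq_sph (\<lambda>u. f u - S N u) + normsq_sph (\<lambda>u. S N u - G u)"
      by (rule normsq_sph_pythagoras[OF sfS sq_int_diff[OF sS sG] orthG[OF h]])
    finally show ?thesis .
  qed
  have z0: "harm_sum N (\<lambda>_. 0)" for N using harm_sum_mono[OF solid_harm_harm_sum[OF solid_harm_zero[of 0]]] by simp
  have f0: "normsq_sph f = normsq_sph (\<lambda>u. f u - S N u) + normsq_sph (S N)" for N using split[OF z0, of N] by simp
  have nS: "normsq_sph (S N) = (\<Sum>l\<le>N. normsq_sph (p l))" for N
    unfolding S_def by (rule normsq_sph_sum[OF n, where d=id]) (auto simp: p(1))
  have bnd: "(\<Sum>l\<in>F. normsq_sph (p l)) \<le> normsq_sph f" if "finite F" for F
  proof -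
    have "(\<Sum>l\<in>F. normsq_sph (p l)) \<le> (\<Sum>l\<le>Max (insert 0 F). normsq_sph (p l))"
      using that by (intro sum_mono2) (auto simp: normsq_sph_nonneg)
    also have "\<dots> \<le> normsq_sph f" unfolding nS[symmetric] using f0[of "Max (insert 0 F)"] normsq_sph_nonneg[of "\<lambda>u. f u - S (Max (insert 0 F)) u"] by linarith
    finally show ?thesis .
  qed
  \<comment> \<open>Bessel's inequality. Summability must be established, since
    \<open>infsum\<close> of a family that is not summable is 0 and would bound nothing.\<close>
  have summ: "(\<lambda>l. normsq_sph (p l)) summable_on {L<..}"
    by (rule nonneg_bdd_above_summable_on) (auto simp: normsq_sph_nonneg intro!: bdd_aboveI2[where M="normsq_sph f"] bnd)
  have "normsq_sph (\<lambda>u. f u - S L u) \<le> (\<Sum>\<^sub>\<infinity>l\<in>{L<..}. normsq_sph (p l)) + e" if e: "e > 0" for e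
  proof -
    obtain N0 G where G: "harm_sum N0 G" "normsq_sph (\<lambda>u. f u - G u) < e" using poly_approx_all[OF f] e unfolding poly_approx_def by blast
    define N where "N = max N0 L"
    have GN: "harm_sum N G" by (rule harm_sum_mono[OF G(1)]) (simp add: N_def)
    have "normsq_sph (\<lambda>u. f u - S N u) \<le> e" using split[OF GN] G(2) normsq_sph_nonneg[of "\<lambda>u. S N u - G u"] by linarith
    moreover have "normsq_sph (\<lambda>u. f u - S L u) = normsq_sph (\<lambda>u. f u - S N u) + normsq_sph (\<lambda>u. S N u - S L u)"
      by (rule split[OF harm_sum_mono[OF hS]]) (simp add: N_def)
    moreover have "normsq_sph (\<lambda>u. S N u - S L u) = (\<Sum>l\<in>{L<..N}. normsq_sph (p l))"
    proof -
      have "{..N} = {..L} \<union> {L<..N}" by (auto simp: N_def)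
      then have "S N u - S L u = (\<Sum>l\<in>{L<..N}. p l u)" for u
        unfolding S_def by (subst \<open>{..N} = _\<close>, subst sum.union_disjoint) auto
      then show ?thesis by (simp add: normsq_sph_sum[OF n, where d=id] p(1))
    qed
    moreover have "(\<Sum>l\<in>{L<..N}. normsq_sph (p l)) \<le> (\<Sum>\<^sub>\<infinity>l\<in>{L<..}. normsq_sph (p l))"
      by (rule finite_sum_le_infsum[OF summ]) (auto simp: normsq_sph_nonneg)
    ultimately show ?thesis by linarith
  qed
  then have "normsq_sph (\<lambda>u. f u - S L u) \<le> (\<Sum>\<^sub>\<infinity>l\<in>{L<..}. normsq_sph (p l))"
    by (rule field_le_epsilon)
  then show ?thesis using that[OF hS] f0[of L] by (simp add: p(3))
qed

section \<open>A Remez inequality for entire functions\<close>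

text \<open>Compactness (Montel): along a sequence of counterexamples a limit function exists, is not identically 0,
  and has finitely many zeros in the disc.\<close>
lemma small_values_covered:
  fixes b :: "complex \<Rightarrow> real" and \<Theta> \<rho> :: real
  assumes b: "continuous_on UNIV b" and \<rho>: "\<rho> > 0"
  shows "\<exists>\<eta>>0. \<forall>T. T holomorphic_on UNIV \<longrightarrow> T 0 = 1 \<longrightarrow> (\<forall>s. norm (T s) \<le> b s) \<longrightarrow>
    (\<exists>P r. finite P \<and> r > 0 \<and> real (card P) * r \<le> \<rho> \<and> (\<forall>s. norm s \<le> \<Theta> \<longrightarrow> norm (T s) < \<eta> \<longrightarrow> (\<exists>p\<in>P. dist p s < r)))"
proof (rule ccontr)
  assume neg: "\<not> ?thesis"
  \<comment> \<open>Small values are covered by discs whose radii add up to at most \<rho>. A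
    covering, unlike a bound on measure in the plane, says something about the real points, and it
    pulls back under an expanding map.\<close>
  define good where "good = (\<lambda>(T :: complex \<Rightarrow> complex) \<eta>. \<exists>P r. finite P \<and> r > 0 \<and> real (card P) * r \<le> \<rho> \<and> (\<forall>s. norm s \<le> \<Theta> \<longrightarrow> norm (T s) < \<eta> \<longrightarrow> (\<exists>p\<in>P. dist p s < r)))"
  define \<H> where "\<H> = {T. T holomorphic_on UNIV \<and> T 0 = 1 \<and> (\<forall>s. norm (T s) \<le> b s)}"
  have neg': "\<not> (\<exists>\<eta>>0. \<forall>T. T holomorphic_on UNIV \<longrightarrow> T 0 = 1 \<longrightarrow> (\<forall>s. norm (T s) \<le> b s) \<longrightarrow> good T \<eta>)"
    unfolding good_def by (rule neg)
  have "\<exists>T. T \<in> \<H> \<and> \<not> good T (inverse (real (Suc k)))" for k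
  proof (rule ccontr)
    assume "\<not> ?thesis"
    then have "\<forall>T. T holomorphic_on UNIV \<longrightarrow> T 0 = 1 \<longrightarrow> (\<forall>s. norm (T s) \<le> b s) \<longrightarrow> good T (inverse (real (Suc k)))"
      unfolding \<H>_def by blast
    moreover have "inverse (real (Suc k)) > 0" by simp
    ultimately show False using neg' by blast
  qed
  then obtain F where F: "\<And>k. F k \<in> \<H>" "\<And>k. \<not> good (F k) (inverse (real (Suc k)))" by metis
  obtain g r where g: "g holomorphic_on UNIV" and r: "strict_mono r"
    and pw: "\<And>x. x \<in> UNIV \<Longrightarrow> (\<lambda>n. F (r n) x) \<longlonglongrightarrow> g x"
    and ul: "\<And>K. compact K \<Longrightarrow> K \<subseteq> UNIV \<Longrightarrow> uniform_limit K (F \<circ> r) g sequentially"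
  proof (rule Montel[of UNIV \<H> F])
    show "h holomorphic_on UNIV" if "h \<in> \<H>" for h using that by (simp add: \<H>_def)
    show "\<exists>B. \<forall>h\<in>\<H>. \<forall>z\<in>K. norm (h z) \<le> B" if K: "compact K" for K
    proof -
      have "compact (b ` K)" by (intro compact_continuous_image continuous_on_subset[OF b] K) simp
      then obtain B where B: "\<And>z. z \<in> K \<Longrightarrow> norm (b z) \<le> B" using compact_imp_bounded bounded_iff by (metis imageI)
      have "norm (h z) \<le> B" if "h \<in> \<H>" "z \<in> K" for h z
      proof -
        have "norm (h z) \<le> b z" using that by (simp add: \<H>_def)
        also have "\<dots> \<le> B" using B[OF that(2)] abs_ge_self[of "b z"] by simp
        finally show ?thesis .
      qed
      then show ?thesis by blast
    qed
  qed (use F in auto)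
  \<comment> \<open>The normalization passes to the limit and keeps g from being identically
    0.\<close>
  have g0: "g 0 = 1"
    using LIMSEQ_unique[OF pw[of 0], of 1] F(1) by (simp add: \<H>_def)
  define Z where "Z = {z \<in> cball 0 \<Theta>. g z = 0}"
  have finZ: "finite Z"
  proof (cases "g constant_on UNIV")
    case True
    then have "g z = 1" for z using g0 unfolding constant_on_def by (metis UNIV_I)
    then show ?thesis by (simp add: Z_def)
  next
    case False
    then show ?thesis unfolding Z_def by (intro holomorphic_compact_finite_zeros[OF g]) auto
  qed
  \<comment> \<open>The summand 1 keeps r0 positive also when g has no zeros in the disc.\<close>
  define r0 where "r0 = \<rho> / real (card Z + 1)"
  have r0: "r0 > 0" unfolding r0_def using \<rho> by simp
  have cZ: "real (card Z) * r0 \<le> \<rho>" unfolding r0_def using \<rho> by (simp add: field_simps)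
  define K where "K = cball 0 \<Theta> - (\<Union>p\<in>Z. ball p r0)"
  have cK: "compact K" unfolding K_def by (intro compact_diff) auto
  obtain \<mu> where \<mu>: "\<mu> > 0" "\<And>s. s \<in> K \<Longrightarrow> norm (g s) \<ge> \<mu>"
  proof (cases "K = {}")
    case True
    show ?thesis
    proof (rule that[of 1])
      show "norm (g s) \<ge> 1" if "s \<in> K" for s using that unfolding True by (rule emptyE)
    qed (rule zero_less_one)
  next
    case False
    have "continuous_on K (\<lambda>s. norm (g s))"
      by (rule continuous_on_norm[OF continuous_on_subset[OF holomorphic_on_imp_continuous_on[OF g]]]) simp
    then obtain s0 where s0: "s0 \<in> K" "\<And>s. s \<in> K \<Longrightarrow> norm (g s0) \<le> norm (g s)"
      using continuous_attains_inf[OF cK False] by blast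
    have "g s0 \<noteq> 0" using s0(1) r0 by (auto simp: K_def Z_def)
    then show ?thesis by (intro that[of "norm (g s0)"] s0(2)) auto
  qed
  have "\<forall>\<^sub>F n in sequentially. \<forall>s\<in>K. dist ((F \<circ> r) n s) (g s) < \<mu> / 2"
    by (rule uniform_limitD[OF ul[OF cK subset_UNIV] half_gt_zero[OF \<mu>(1)]])
  moreover have "\<forall>\<^sub>F n in sequentially. inverse (real (Suc n)) < \<mu> / 2"
    by (rule order_tendstoD(2)[OF LIMSEQ_inverse_real_of_nat half_gt_zero[OF \<mu>(1)]])
  ultimately have "\<forall>\<^sub>F n in sequentially. (\<forall>s\<in>K. dist ((F \<circ> r) n s) (g s) < \<mu> / 2) \<and> inverse (real (Suc n)) < \<mu> / 2"
    by (rule eventually_conj)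
  then obtain n where n: "\<And>s. s \<in> K \<Longrightarrow> dist (F (r n) s) (g s) < \<mu> / 2" "inverse (real (Suc n)) < \<mu> / 2"
    using eventually_happens'[OF sequentially_bot] by (force simp: o_def)
  \<comment> \<open>The tolerance 1 / (r n + 1) is at most 1 / (n + 1), hence below the bound \<mu>
    / 2 that uniform convergence gives for |F (r n)| on K.\<close>
  have "n \<le> r n" using r by (rule seq_suble)
  then have le: "inverse (real (Suc (r n))) < \<mu> / 2"
    by (intro le_less_trans[OF _ n(2)] le_imp_inverse_le) auto
  have "good (F (r n)) (inverse (real (Suc (r n))))"
    unfolding good_def
  proof (intro exI[of _ Z] exI[of _ r0] conjI finZ r0 cZ allI impI)
    fix s assume s: "norm s \<le> \<Theta>" "norm (F (r n) s) < inverse (real (Suc (r n)))"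
    have "s \<notin> K"
    proof
      assume "s \<in> K"
      from n(1)[OF this] \<mu>(2)[OF this] have "norm (F (r n) s) > \<mu> / 2"
        using norm_triangle_ineq2[of "g s" "F (r n) s"] by (simp add: dist_norm norm_minus_commute)
      then show False using s(2) le by linarith
    qed
    then show "\<exists>p\<in>Z. dist p s < r0" using s(1) by (auto simp: K_def)
  qed
  with F(2) show False by blast
qed

text \<open>Since \<theta> does not bring points closer than by the factor m, the part of S mapped
  into a disc of radius r lies in an interval of length 4 r / m. Removing these few intervals from S
  leaves the set S'.\<close>

lemma remez_entire:
  fixes b :: "complex \<Rightarrow> real" and \<Theta> m c :: real
  assumes b: "continuous_on UNIV b" and m: "m > 0" and c: "c > 0"
  shows "\<exists>\<eta>>0. \<forall>T (\<theta> :: real \<Rightarrow> real) S. T holomorphic_on UNIV \<longrightarrow> T 0 = 1 \<longrightarrow> (\<forall>s. norm (T s) \<le> b s) \<longrightarrow>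
     S \<in> sets borel \<longrightarrow> emeasure lborel S \<ge> ennreal c \<longrightarrow> (\<forall>t\<in>S. \<bar>\<theta> t\<bar> \<le> \<Theta>) \<longrightarrow>
     (\<forall>t\<in>S. \<forall>t'\<in>S. \<bar>\<theta> t - \<theta> t'\<bar> \<ge> m * \<bar>t - t'\<bar>) \<longrightarrow>
     (\<exists>S'\<subseteq>S. S' \<in> sets borel \<and> emeasure lborel S' \<ge> ennreal (c / 2) \<and> (\<forall>t\<in>S'. norm (T (of_real (\<theta> t))) \<ge> \<eta>))"
proof -
  \<comment> \<open>Radii of total at most \<rho> pull back to intervals of total length at most 4
    \<rho> / m = c / 2, half of the guaranteed measure.\<close>
  define \<rho> where "\<rho> = m * c / 8"
  have \<rho>: "\<rho> > 0" using m c by (simp add: \<rho>_def)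
  obtain \<eta> where \<eta>: "\<eta> > 0" and cov: "\<And>T. T holomorphic_on UNIV \<Longrightarrow> T 0 = 1 \<Longrightarrow> (\<And>s. norm (T s) \<le> b s) \<Longrightarrow>
    (\<exists>P r. finite P \<and> r > 0 \<and> real (card P) * r \<le> \<rho> \<and> (\<forall>s. norm s \<le> \<Theta> \<longrightarrow> norm (T s) < \<eta> \<longrightarrow> (\<exists>p\<in>P. dist p s < r)))"
    using small_values_covered[OF b \<rho>, of \<Theta>] by blast
  show ?thesis
  proof (intro exI[of _ \<eta>] conjI allI impI \<eta>)
    fix T and \<theta> :: "real \<Rightarrow> real" and S
    assume T: "T holomorphic_on UNIV" "T 0 = 1" "\<forall>s. norm (T s) \<le> b s"
      and S: "S \<in> sets borel" "emeasure lborel S \<ge> ennreal c" and th: "\<forall>t\<in>S. \<bar>\<theta> t\<bar> \<le> \<Theta>"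
      and ex: "\<forall>t\<in>S. \<forall>t'\<in>S. \<bar>\<theta> t - \<theta> t'\<bar> \<ge> m * \<bar>t - t'\<bar>"
    obtain P r where P: "finite P" "r > 0" "real (card P) * r \<le> \<rho>"
      "\<And>s. norm s \<le> \<Theta> \<Longrightarrow> norm (T s) < \<eta> \<Longrightarrow> (\<exists>p\<in>P. dist p s < r)" using cov[of T] T by blast
    define near where "near = (\<lambda>p. {t \<in> S. dist p (complex_of_real (\<theta> t)) < r})"
    \<comment> \<open>Any point of the preimage serves as centre. For an empty preimage the chosen
      value is arbitrary and the inclusion below is trivial.\<close>
    define ctr where "ctr = (\<lambda>p. SOME t. t \<in> near p)"
    define I where "I = (\<Union>p\<in>P. {ctr p - 2 * r / m .. ctr p + 2 * r / m})"
    have sub: "near p \<subseteq> {ctr p - 2 * r / m .. ctr p + 2 * r / m}" for p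
    proof
      fix t assume t: "t \<in> near p"
      then have c: "ctr p \<in> near p" unfolding ctr_def by (rule someI)
      have "dist (complex_of_real (\<theta> t)) (complex_of_real (\<theta> (ctr p))) < r + r"
        using t c dist_triangle2[of "complex_of_real (\<theta> t)" "complex_of_real (\<theta> (ctr p))" p]
        by (simp add: near_def dist_commute)
      then have "\<bar>\<theta> t - \<theta> (ctr p)\<bar> < 2 * r" by (simp add: dist_norm flip: of_real_diff)
      moreover have "m * \<bar>t - ctr p\<bar> \<le> \<bar>\<theta> t - \<theta> (ctr p)\<bar>" using ex t c by (auto simp: near_def)
      ultimately have "m * \<bar>t - ctr p\<bar> \<le> 2 * r" by linarith
      then have "\<bar>t - ctr p\<bar> \<le> 2 * r / m" using m by (simp add: field_simps)
      then show "t \<in> {ctr p - 2 * r / m .. ctr p + 2 * r / m}" by (auto simp: abs_le_iff)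
    qed
    have Im: "I \<in> sets borel" unfolding I_def using P(1) by auto
    have "emeasure lborel I \<le> (\<Sum>p\<in>P. emeasure lborel {ctr p - 2 * r / m .. ctr p + 2 * r / m})"
      unfolding I_def by (rule emeasure_subadditive_finite) (use P(1) in auto)
    also have "\<dots> = (\<Sum>p\<in>P. ennreal (4 * r / m))"
      using P(2) m by (intro sum.cong) (auto simp: field_simps)
    also have "\<dots> = ennreal (real (card P) * (4 * r / m))"
      unfolding sum_constant ennreal_of_nat_eq_real_of_nat by (rule ennreal_mult'[symmetric]) simp
    also have "\<dots> \<le> ennreal (c / 2)"
    proof (rule ennreal_leI)
      have "real (card P) * (4 * r / m) = 4 * (real (card P) * r) / m" by simp
      also have "\<dots> \<le> 4 * \<rho> / m" using P(3) m by (intro divide_right_mono) auto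
      also have "\<dots> = c / 2" using m by (simp add: \<rho>_def)
      finally show "real (card P) * (4 * r / m) \<le> c / 2" .
    qed
    finally have eI: "emeasure lborel I \<le> ennreal (c / 2)" .
    have "ennreal c \<le> emeasure lborel (S - I) + emeasure lborel I"
    proof -
      have "emeasure lborel S \<le> emeasure lborel ((S - I) \<union> I)" by (rule emeasure_mono) (use S Im in auto)
      also have "\<dots> \<le> emeasure lborel (S - I) + emeasure lborel I" by (rule emeasure_subadditive) (use S Im in auto)
      finally show ?thesis using S(2) by (rule order_trans[rotated])
    qed
    also have "\<dots> \<le> emeasure lborel (S - I) + ennreal (c / 2)" using eI by (rule add_left_mono)
    finally have "ennreal (c / 2) + ennreal (c / 2) \<le> emeasure lborel (S - I) + ennreal (c / 2)"
      using c by (subst ennreal_plus[symmetric]) auto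
    then have "ennreal (c / 2) \<le> emeasure lborel (S - I)"
      by (simp add: ennreal_add_left_cancel_le add.commute)
    moreover have "norm (T (of_real (\<theta> t))) \<ge> \<eta>" if t: "t \<in> S - I" for t
    proof (rule ccontr)
      assume "\<not> ?thesis"
      then obtain p where "p \<in> P" "dist p (complex_of_real (\<theta> t)) < r" using P(4)[of "of_real (\<theta> t)"] th t by auto
      then have "t \<in> near p" using t by (simp add: near_def)
      then have "t \<in> I" using sub[of p] \<open>p \<in> P\<close> unfolding I_def by blast
      then show False using t by simp
    qed
    ultimately show "\<exists>S'\<subseteq>S. S' \<in> sets borel \<and> emeasure lborel S' \<ge> ennreal (c / 2) \<and> (\<forall>t\<in>S'. norm (T (of_real (\<theta> t))) \<ge> \<eta>)"
      by (intro exI[of _ "S - I"] conjI) (use S(1) Im in auto)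
  qed
qed

text \<open>Mean value inequality on the disc of radius |z|. The factor |z| is the point: at z = s /
  L it supplies the 1 / L that cancels the Bernstein factor.\<close>

lemma norm_sin_bound: "norm (sin z) \<le> norm z * exp (norm (z::complex))"
proof -
  have "norm (sin z - sin 0) \<le> exp (norm z) * norm (z - 0)"
  proof (rule field_differentiable_bound[where S="cball 0 (norm z)" and f'=cos])
    fix x :: complex assume x: "x \<in> cball 0 (norm z)"
    show "(sin has_field_derivative cos x) (at x within cball 0 (norm z))" by (auto intro!: derivative_eq_intros)
    show "norm (cos x) \<le> exp (norm z)" using norm_cos_le[of x] x by (auto intro: order_trans)
  qed auto
  then show ?thesis by (simp add: mult.commute)
qed

lemma norm_cos_bound: "norm (cos z - 1) \<le> norm z * exp (2 * norm (z::complex))"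
proof -
  have "norm (cos z - cos 0) \<le> exp (2 * norm z) * norm (z - 0)"
  proof (rule field_differentiable_bound[where S="cball 0 (norm z)" and f'="\<lambda>z. - sin z"])
    fix x :: complex assume x: "x \<in> cball 0 (norm z)"
    show "(cos has_field_derivative - sin x) (at x within cball 0 (norm z))" by (auto intro!: derivative_eq_intros)
    have "norm (sin x) \<le> norm x * exp (norm x)" by (rule norm_sin_bound)
    also have "\<dots> \<le> exp (norm z) * exp (norm z)"
    proof (intro mult_mono)
      have "norm x \<le> exp (norm x)" using exp_ge_add_one_self[of "norm x"] by linarith
      also have "\<dots> \<le> exp (norm z)" using x by simp
      finally show "norm x \<le> exp (norm z)" .
    qed (use x in auto)
    finally show "norm (- sin x) \<le> exp (2 * norm z)" by (simp add: exp_double[symmetric] power2_eq_square exp_add[symmetric])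
  qed auto
  then show ?thesis by (simp add: mult.commute)
qed

section \<open>Density of sets with large harmonic measure\<close>

lemma emeasure_cball_vec:
  fixes c :: "real^'n" assumes "r \<ge> 0"
  shows "emeasure lborel (cball c r) = ennreal (unit_ball_vol (real CARD('n)) * r ^ CARD('n))"
  using emeasure_cball[OF assms, of c] by simp

lemma cone_measure:
  assumes A: "A \<in> sets borel" and r: "r > 0"
  shows "of_nat CARD('n) * emeasure lborel {y \<in> cball 0 r. sgn y \<in> (A :: (real^'n) set)} = ennreal (r ^ CARD('n)) * emeasure sphm (A \<inter> unit_sphere)"
proof -
  have m: "(\<lambda>u. indicator A u :: ennreal) \<in> borel_measurable borel" using A by simp
  have "emeasure sphm (A \<inter> unit_sphere) = (\<integral>\<^sup>+u. indicator (A \<inter> unit_sphere) u \<partial>sphm)"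
    using sets_sphmI[of "A \<inter> unit_sphere"] A by (subst nn_integral_indicator) auto
  also have "\<dots> = (\<integral>\<^sup>+u. indicator A u \<partial>sphm)"
    by (rule nn_integral_cong) (auto simp: space_sphere_measure indicator_def)
  finally have e: "emeasure sphm (A \<inter> unit_sphere) = (\<integral>\<^sup>+u. indicator A u \<partial>sphm)" .
  have "emeasure lborel {y \<in> cball 0 r. sgn y \<in> A} = (\<integral>\<^sup>+x. indicator {y \<in> cball 0 r. sgn y \<in> A} x \<partial>lborel)"
  proof (rule nn_integral_indicator[symmetric])
    have "{y \<in> cball 0 r. sgn y \<in> A} = cball 0 r \<inter> (sgn -` A \<inter> space borel)" by auto
    moreover have "sgn -` A \<inter> space borel \<in> sets (borel :: (real^'n) measure)" by (rule measurable_sets[OF sgn_measurable A]) simp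
    ultimately show "{y \<in> cball 0 r. sgn y \<in> A} \<in> sets lborel" by simp
  qed
  also have "\<dots> = (\<integral>\<^sup>+x. indicator A (sgn x) * indicator (cball 0 r) x \<partial>lborel)"
    by (rule nn_integral_cong) (auto simp: indicator_def)
  finally show ?thesis using nn_integral_cball_sgn[OF m r] e by simp
qed

lemma sets_sgn: "A \<in> sets borel \<Longrightarrow> {y \<in> B. sgn y \<in> A} \<in> sets borel" if "B \<in> sets borel" for A B :: "(real^'n) set"
proof -
  assume A: "A \<in> sets borel"
  have "{y \<in> B. sgn y \<in> A} = B \<inter> (sgn -` A \<inter> space borel)" by auto
  moreover have "sgn -` A \<inter> space borel \<in> sets (borel :: (real^'n) measure)" by (rule measurable_sets[OF sgn_measurable A]) simp
  ultimately show ?thesis using that by simp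
qed

abbreviation sph_mass :: "(real^'n) set \<Rightarrow> real" where "sph_mass A \<equiv> measure sphm A"

lemma emeasure_sph_mass: "emeasure sphm A = ennreal (sph_mass A)"
  by (rule sphm.emeasure_eq_measure)

lemma cone_measure_real:
  assumes A: "A \<in> sets borel" "A \<subseteq> unit_sphere" and r: "r \<ge> 0"
  shows "measure lborel {y \<in> cball 0 r. sgn y \<in> (A :: (real^'n) set)} = r ^ CARD('n) * sph_mass A / real CARD('n)"
    and "emeasure lborel {y \<in> cball 0 r. sgn y \<in> A} < top"
proof -
  let ?C = "{y \<in> cball 0 r. sgn y \<in> A}"
  have mC: "?C \<in> sets lborel" using sets_sgn[OF _ A(1), of "cball 0 r"] by simp
  have "emeasure lborel ?C \<le> emeasure lborel (cball (0::real^'n) r)" by (rule emeasure_mono) auto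
  then show fin: "emeasure lborel ?C < top" by (rule le_less_trans) simp
  show "measure lborel ?C = r ^ CARD('n) * sph_mass A / real CARD('n)"
  proof (cases "r = 0")
    \<comment> \<open>\<open>sgn 0 = 0\<close> is not in A, so the cone of radius 0 is empty; on the
      right, the power of 0 vanishes because n > 0.\<close>
    case True
    then have e: "?C = {}" using A(2) by (auto simp: subset_iff)
    have "0 < CARD('n)" by (rule zero_less_card_finite)
    then have "r ^ CARD('n) = 0" using True by (simp only: zero_power)
    then show ?thesis unfolding e by (simp only: measure_empty mult_zero_left div_0)
  next
    case False
    then have r: "r > 0" using r by simp
    have "A \<inter> unit_sphere = A" using A by auto
    then have "of_nat CARD('n) * emeasure lborel ?C = ennreal (r ^ CARD('n)) * ennreal (sph_mass A)"
      using cone_measure[OF A(1) r] by (simp add: emeasure_sph_mass)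
    moreover have "emeasure lborel ?C = ennreal (measure lborel ?C)"
      using fin by (simp add: emeasure_eq_ennreal_measure)
    ultimately have "ennreal (real CARD('n) * measure lborel ?C) = ennreal (r ^ CARD('n) * sph_mass A)"
      using r by (simp add: ennreal_mult' ennreal_of_nat_eq_real_of_nat)
    then have "real CARD('n) * measure lborel ?C = r ^ CARD('n) * sph_mass A"
      using r by (subst (asm) ennreal_inj) auto
    then show ?thesis by (simp add: field_simps)
  qed
qed

section \<open>Spherical caps and the Poisson kernel\<close>

lemma measure_cball_vec: "r \<ge> 0 \<Longrightarrow> measure lborel (cball (c :: real^'n) r) = unit_ball_vol (real CARD('n)) * r ^ CARD('n)"
  using content_cball[of r c] by simp

text \<open>x - y splits into a radial part and an angular part at radius |y|.\<close>

lemma dist_sgn: 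
  fixes x y :: "real^'n"
  assumes "norm y > 0"
  shows "norm (x - y) \<le> \<bar>norm x - norm y\<bar> + norm y * norm (sgn x - sgn y)"
proof -
  have "x = norm x *\<^sub>R sgn x" by (cases "x = 0") (simp_all add: sgn_div_norm)
  moreover have "y = norm y *\<^sub>R sgn y" by (cases "y = 0") (simp_all add: sgn_div_norm)
  ultimately have "x - y = (norm x - norm y) *\<^sub>R sgn x + norm y *\<^sub>R (sgn x - sgn y)"
    by (metis (no_types, lifting) diff_add_cancel diff_diff_eq2 scaleR_left_diff_distrib scaleR_right_diff_distrib add.commute add_diff_eq)
  then have "norm (x - y) \<le> norm ((norm x - norm y) *\<^sub>R sgn x) + norm (norm y *\<^sub>R (sgn x - sgn y))"
    by (metis norm_triangle_ineq)
  also have "norm ((norm x - norm y) *\<^sub>R sgn x) \<le> \<bar>norm x - norm y\<bar> * 1"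
    by (simp add: norm_sgn)
  finally show ?thesis by simp
qed

text \<open>The part of the cone over the cap between the radii 1 - r and 1 has at least the
  fraction r of the volume of the cone, and it lies in a ball of radius 2 r, of volume of order r^n.
  For r \<ge> 1 the whole sphere is a sufficient bound.\<close>

lemma cap_measure:
  shows "\<exists>C>0. \<forall>\<omega>::real^'n. \<forall>r>0. norm \<omega> = 1 \<longrightarrow> sph_mass (unit_sphere \<inter> cball \<omega> r) \<le> C * r ^ (CARD('n) - 1)"
proof -
  let ?n = "CARD('n)"
  let ?v = "unit_ball_vol (real ?n)"
  have n0: "0 < ?n" by (rule zero_less_card_finite)
  define C where "C = real ?n * ?v * 2 ^ ?n + sph_mass (unit_sphere :: (real^'n) set) + 1"
  have v0: "?v \<ge> 0" by simp
  have C0: "C > 0" unfolding C_def by (intro add_nonneg_pos add_nonneg_nonneg mult_nonneg_nonneg) (auto simp: v0)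
  have "sph_mass (unit_sphere \<inter> cball \<omega> r) \<le> C * r ^ (?n - 1)" if r: "r > 0" and \<omega>: "norm \<omega> = 1" for \<omega> :: "real^'n" and r
  proof (cases "r < 1")
    case True
    define A where "A = unit_sphere \<inter> cball \<omega> r"
    have A: "A \<in> sets borel" "A \<subseteq> unit_sphere" by (auto simp: A_def)
    have "{y \<in> cball 0 1. sgn y \<in> A} \<subseteq> {y \<in> cball 0 (1 - r). sgn y \<in> A} \<union> cball \<omega> (2 * r)"
    proof
      fix y assume y: "y \<in> {y \<in> cball 0 1. sgn y \<in> A}"
      show "y \<in> {y \<in> cball 0 (1 - r). sgn y \<in> A} \<union> cball \<omega> (2 * r)"
      proof (cases "norm y \<le> 1 - r")
        case False
        have s: "sgn \<omega> = \<omega>" using \<omega> by (simp add: sgn_div_norm)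
        have "norm (y - \<omega>) \<le> \<bar>norm y - norm \<omega>\<bar> + norm \<omega> * norm (sgn y - sgn \<omega>)" by (rule dist_sgn) (use \<omega> in simp)
        also have "\<dots> \<le> r + r" using y False \<omega> s by (auto simp: A_def dist_norm norm_minus_commute)
        finally show ?thesis by (simp add: dist_norm norm_minus_commute)
      qed (use y in auto)
    qed
    then have "measure lborel {y \<in> cball 0 1. sgn y \<in> A} \<le> measure lborel ({y \<in> cball 0 (1 - r). sgn y \<in> A} \<union> cball \<omega> (2 * r))"
    proof (rule measure_mono_fmeasurable)
      have "{y \<in> cball 0 (1 - r). sgn y \<in> A} \<in> fmeasurable lborel"
        using cone_measure_real(2)[OF A, of "1 - r"] sets_sgn[OF _ A(1), of "cball 0 (1 - r)"] True by (intro fmeasurableI) auto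
      moreover have "cball \<omega> (2 * r) \<in> fmeasurable lborel" by (intro fmeasurableI) auto
      ultimately show "{y \<in> cball 0 (1 - r). sgn y \<in> A} \<union> cball \<omega> (2 * r) \<in> fmeasurable lborel" by (rule fmeasurable.Un)
    qed (use sets_sgn[OF _ A(1), of "cball 0 1"] in auto)
    also have "\<dots> \<le> measure lborel {y \<in> cball 0 (1 - r). sgn y \<in> A} + measure lborel (cball \<omega> (2 * r))"
      by (rule measure_Un_le) (use sets_sgn[OF _ A(1), of "cball 0 (1 - r)"] in auto)
    finally have "sph_mass A / real ?n \<le> (1 - r) ^ ?n * sph_mass A / real ?n + ?v * (2 * r) ^ ?n"
    proof -
      have "measure lborel {y \<in> cball 0 1. sgn y \<in> A} = sph_mass A / real ?n" using cone_measure_real(1)[OF A, of 1] by simp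
      moreover have "measure lborel {y \<in> cball 0 (1 - r). sgn y \<in> A} = (1 - r) ^ ?n * sph_mass A / real ?n"
        using cone_measure_real(1)[OF A, of "1 - r"] True by simp
      moreover have "measure lborel (cball \<omega> (2 * r)) = ?v * (2 * r) ^ ?n" using r by (intro measure_cball_vec) simp
      moreover assume "measure lborel {y \<in> cball 0 1. sgn y \<in> A} \<le> measure lborel {y \<in> cball 0 (1 - r). sgn y \<in> A} + measure lborel (cball \<omega> (2 * r))"
      ultimately show ?thesis by (simp only:)
    qed
    then have 1: "sph_mass A \<le> (1 - r) ^ ?n * sph_mass A + real ?n * (?v * (2 * r) ^ ?n)"
      using n0 by (simp add: field_simps)
    have "(1 - r) ^ ?n \<le> (1 - r) ^ 1" using r True n0 by (intro power_decreasing) auto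
    then have "(1 - r) ^ ?n * sph_mass A \<le> (1 - r) * sph_mass A" by (intro mult_right_mono) auto
    with 1 have "r * sph_mass A \<le> real ?n * (?v * (2 * r) ^ ?n)" by (simp add: left_diff_distrib)
    also have "\<dots> = r * (real ?n * ?v * 2 ^ ?n * r ^ (?n - 1))"
      using n0 by (cases ?n) (auto simp: power_mult_distrib)
    finally have "sph_mass A \<le> real ?n * ?v * 2 ^ ?n * r ^ (?n - 1)" using r by (simp only: mult_le_cancel_left_pos)
    also have "\<dots> \<le> C * r ^ (?n - 1)" unfolding C_def using r by (intro mult_right_mono) auto
    finally show ?thesis by (simp add: A_def)
  next
    case False
    have "sph_mass (unit_sphere \<inter> cball \<omega> r) \<le> sph_mass (unit_sphere :: (real^'n) set)"
      by (rule sphm.finite_measure_mono) (auto intro: sets_sphmI)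
    also have "\<dots> \<le> C * 1" unfolding C_def using v0 by simp
    also have "\<dots> \<le> C * r ^ (?n - 1)" using False C0 by (intro mult_left_mono one_le_power) auto
    finally show ?thesis .
  qed
  with C0 show ?thesis by blast
qed

text \<open>Tail of the Poisson kernel: on the dyadic shell \<open>2\<^sup>j \<rho> \<le> \<bar>u - \<omega>\<bar> \<le> 2\<^sup>j\<^sup>+\<^sup>1 \<rho>\<close> compare with the measure of a cap.\<close>
lemma poisson_tail:
  shows "\<exists>C>0. \<forall>\<omega>::real^'n. \<forall>\<rho>>0. norm \<omega> = 1 \<longrightarrow>
    (\<integral>\<^sup>+u. ennreal (1 / norm (u - \<omega>) ^ CARD('n)) * indicator {u. norm (u - \<omega>) \<ge> \<rho>} u \<partial>sphm) \<le> ennreal (C / \<rho>)"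
proof -
  let ?n = "CARD('n)"
  have n0: "0 < ?n" by (rule zero_less_card_finite)
  obtain C where C: "C > 0" "\<And>\<omega> r. r > 0 \<Longrightarrow> norm \<omega> = 1 \<Longrightarrow> sph_mass (unit_sphere \<inter> cball (\<omega> :: real^'n) r) \<le> C * r ^ (?n - 1)"
    using cap_measure by blast
  define C' where "C' = 2 * C * 2 ^ (?n - 1)"
  have "(\<integral>\<^sup>+u. ennreal (1 / norm (u - \<omega>) ^ ?n) * indicator {u. norm (u - \<omega>) \<ge> \<rho>} u \<partial>sphm) \<le> ennreal (C' / \<rho>)"
    if \<rho>: "\<rho> > 0" and \<omega>: "norm \<omega> = 1" for \<omega> :: "real^'n" and \<rho>
  proof -
    define g where "g = (\<lambda>j u. ennreal (1 / (2 ^ j * \<rho>) ^ ?n) * indicator (unit_sphere \<inter> cball \<omega> (2 ^ Suc j * \<rho>)) u)"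
    have capm: "unit_sphere \<inter> cball \<omega> r \<in> sets sphm" for r by (rule sets_sphmI) auto
    have "(\<integral>\<^sup>+u. ennreal (1 / norm (u - \<omega>) ^ ?n) * indicator {u. norm (u - \<omega>) \<ge> \<rho>} u \<partial>sphm) \<le> (\<integral>\<^sup>+u. (\<Sum>j. g j u) \<partial>sphm)"
    proof (rule nn_integral_mono)
      fix u :: "real^'n" assume "u \<in> space sphm"
      then have u: "norm u = 1" by (simp add: space_sphere_measure)
      show "ennreal (1 / norm (u - \<omega>) ^ ?n) * indicator {u. norm (u - \<omega>) \<ge> \<rho>} u \<le> (\<Sum>j. g j u)"
      proof (cases "norm (u - \<omega>) \<ge> \<rho>")
        case True
        \<comment> \<open>The dyadic shell containing u. The ratio is at least 1, so its logarithm
          is nonnegative and \<open>nat\<close> loses nothing.\<close>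
        define j where "j = nat \<lfloor>log 2 (norm (u - \<omega>) / \<rho>)\<rfloor>"
        let ?q = "norm (u - \<omega>) / \<rho>"
        have q: "?q \<ge> 1" using True \<rho> by simp
        then have l0: "log 2 ?q \<ge> 0" by simp
        have "real j \<le> log 2 ?q" "log 2 ?q < real j + 1" using l0 unfolding j_def by (auto simp: of_nat_nat)
        then have "2 powr real j \<le> ?q" "?q < 2 powr (real j + 1)"
          using q by (auto simp: le_log_iff log_less_iff)
        then have "2 ^ j \<le> ?q" "?q < 2 ^ Suc j" by (simp_all add: powr_add powr_realpow)
        then have j: "2 ^ j * \<rho> \<le> norm (u - \<omega>)" "norm (u - \<omega>) \<le> 2 ^ Suc j * \<rho>" using \<rho> by (simp_all add: field_simps)
        have p: "(2 ^ j * \<rho>) ^ ?n \<le> norm (u - \<omega>) ^ ?n" using j(1) \<rho> by (intro power_mono) auto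
        have p0: "0 < (2 ^ j * \<rho>) ^ ?n" using \<rho> by simp
        have "1 / norm (u - \<omega>) ^ ?n \<le> 1 / (2 ^ j * \<rho>) ^ ?n"
          by (rule divide_left_mono[OF p]) (use p0 less_le_trans[OF p0 p] in \<open>auto intro: mult_pos_pos\<close>)
        then have "ennreal (1 / norm (u - \<omega>) ^ ?n) \<le> g j u"
          using j(2) u by (auto simp: g_def dist_norm norm_minus_commute intro!: ennreal_leI)
        also have "\<dots> \<le> (\<Sum>j. g j u)" using sum_le_suminf[of "\<lambda>j. g j u" "{j}"] by simp
        finally show ?thesis using True by simp
      qed simp
    qed
    also have "\<dots> = (\<Sum>j. \<integral>\<^sup>+u. g j u \<partial>sphm)"
      by (rule nn_integral_suminf) (use capm in \<open>simp add: g_def\<close>)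
    also have "\<dots> \<le> (\<Sum>j. ennreal (C * 2 ^ (?n - 1) / \<rho> * (1/2) ^ j))"
    proof (rule suminf_le)
      fix j
      have "(\<integral>\<^sup>+u. g j u \<partial>sphm) = ennreal (1 / (2 ^ j * \<rho>) ^ ?n) * ennreal (sph_mass (unit_sphere \<inter> cball \<omega> (2 ^ Suc j * \<rho>)))"
        unfolding g_def using capm by (simp add: nn_integral_cmult emeasure_sph_mass)
      also have "\<dots> = ennreal (1 / (2 ^ j * \<rho>) ^ ?n * sph_mass (unit_sphere \<inter> cball \<omega> (2 ^ Suc j * \<rho>)))"
        by (rule ennreal_mult''[symmetric]) simp
      also have "\<dots> \<le> ennreal (1 / (2 ^ j * \<rho>) ^ ?n * (C * (2 ^ Suc j * \<rho>) ^ (?n - 1)))"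
        using \<rho> by (intro ennreal_leI mult_left_mono C(2) \<omega>) auto
      \<comment> \<open>The cap contributes the radius to the power n - 1, the kernel to the power
        -n. One factor 1 / (2^j \<rho>) remains, hence a geometric series.\<close>
      also have "1 / (2 ^ j * \<rho>) ^ ?n * (C * (2 ^ Suc j * \<rho>) ^ (?n - 1)) = C * 2 ^ (?n - 1) / \<rho> * (1/2) ^ j"
      proof -
        obtain d where d: "?n = Suc d" using n0 by (cases ?n) auto
        have "(2 ^ Suc j * \<rho>) ^ d = 2 ^ d * (2 ^ j * \<rho>) ^ d" by (simp add: power_mult_distrib)
        moreover have "(2 ^ j * \<rho>) ^ d \<noteq> 0" using \<rho> by simp
        ultimately show ?thesis unfolding d using \<rho> by (simp add: field_simps power_one_over)
      qed
      finally show "(\<integral>\<^sup>+u. g j u \<partial>sphm) \<le> ennreal (C * 2 ^ (?n - 1) / \<rho> * (1/2) ^ j)" .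
    qed auto
    also have "\<dots> = ennreal (\<Sum>j. C * 2 ^ (?n - 1) / \<rho> * (1/2) ^ j)"
      by (rule suminf_ennreal2) (use C \<rho> in \<open>auto intro!: summable_mult summable_geometric\<close>)
    also have "(\<Sum>j. C * 2 ^ (?n - 1) / \<rho> * (1/2) ^ j) = C' / \<rho>"
      by (subst suminf_mult) (auto simp: suminf_geometric C'_def)
    finally show ?thesis .
  qed
  moreover have "C' > 0" using C(1) by (simp add: C'_def)
  ultimately show ?thesis by blast
qed


lemma sph_mass_unit_sphere_pos: "sph_mass (unit_sphere :: (real^'n) set) > 0"
proof (rule ccontr)
  assume "\<not> ?thesis"
  then have z: "sph_mass (unit_sphere :: (real^'n) set) = 0" using measure_nonneg[of sphm "unit_sphere :: (real^'n) set"] by linarith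
  have "normsq_sph (\<lambda>_ :: real^'n. 1) = sph_mass (unit_sphere :: (real^'n) set)" by (simp add: normsq_sph_def space_sphere_measure)
  from normsq_sph_zero_continuous[OF _ this[unfolded z], of "axis undefined 1"] show False
    by (simp add: norm_axis_1)
qed

text \<open>The hypothesis is tested at \<open>z = (1 - 1 / real L) *\<^sub>R \<omega>\<close>.
  Outside the cap of radius K / L the Poisson kernel contributes at most half of \<delta> once K is
  large, and it is nowhere larger than 2 L^(n-1); so E must fill a fixed proportion of the
  cap.\<close>

lemma harmonic_density:
  fixes \<delta> :: real
  assumes \<delta>: "\<delta> > 0"
  shows "\<exists>K c. K \<ge> 2 \<and> c > 0 \<and> (\<forall>L E \<omega>. L \<ge> (1::nat) \<longrightarrow> E \<in> sets borel \<longrightarrow> (E :: (real^'n) set) \<subseteq> unit_sphere \<longrightarrow>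
    (\<forall>z. norm z = 1 - 1 / real L \<longrightarrow> harmonic_measure z E \<ge> \<delta>) \<longrightarrow> norm \<omega> = 1 \<longrightarrow>
    sph_mass (E \<inter> cball \<omega> (K / real L)) \<ge> c / real L ^ (CARD('n) - 1))"
proof -
  let ?n = "CARD('n)"
  define \<sigma> where "\<sigma> = sph_mass (unit_sphere :: (real^'n) set)"
  have \<sigma>: "\<sigma> > 0" unfolding \<sigma>_def by (rule sph_mass_unit_sphere_pos)
  have n0: "0 < ?n" by (rule zero_less_card_finite)
  obtain C where C: "C > 0" "\<And>\<omega> \<rho>. \<rho> > 0 \<Longrightarrow> norm \<omega> = 1 \<Longrightarrow>
    (\<integral>\<^sup>+u. ennreal (1 / norm (u - (\<omega> :: real^'n)) ^ ?n) * indicator {u. norm (u - \<omega>) \<ge> \<rho>} u \<partial>sphm) \<le> ennreal (C / \<rho>)"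
    using poisson_tail[where 'n='n] by blast
  \<comment> \<open>Far from \<omega> the kernel is at most 2^(n+1) / L times |u - \<omega>|^(-n),
    and \<open>poisson_tail\<close> at radius K / L gives C L / K. The product has to be at most
    \<delta> \<sigma> / 2.\<close>
  define K where "K = max 2 (2 ^ (?n + 2) * C / (\<delta> * \<sigma>))"
  have K2: "K \<ge> 2" by (simp add: K_def)
  have far: "2 ^ (?n + 1) * C / K \<le> \<delta> * \<sigma> / 2"
  proof -
    have "2 ^ (?n + 2) * C / (\<delta> * \<sigma>) \<le> K" by (simp add: K_def)
    then have "2 ^ (?n + 2) * C \<le> K * (\<delta> * \<sigma>)" using \<delta> \<sigma> by (simp add: pos_divide_le_eq)
    then have "2 * (2 ^ (?n + 1) * C) \<le> K * (\<delta> * \<sigma>)" by simp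
    then show ?thesis using K2 by (simp add: pos_divide_le_eq mult_ac)
  qed
  define c where "c = \<delta> * \<sigma> / 4"
  have c: "c > 0" using \<delta> \<sigma> by (simp add: c_def)
  have main: "sph_mass (E \<inter> cball \<omega> (K / real L)) \<ge> c / real L ^ (?n - 1)"
    if L: "L \<ge> 1" and E: "E \<in> sets borel" "E \<subseteq> unit_sphere" and hm: "\<And>z. norm z = 1 - 1 / real L \<Longrightarrow> harmonic_measure z E \<ge> \<delta>"
      and \<omega>: "norm \<omega> = 1" for L E and \<omega> :: "real^'n"
  proof -
    define A where "A = E \<inter> cball \<omega> (K / real L)"
    define z where "z = (1 - 1 / real L) *\<^sub>R \<omega>"
    have Lr: "real L \<ge> 1" using L by simp
    have L1: "1 / real L \<le> 1" "1 / real L > 0" using Lr by auto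
    have nz: "norm z = 1 - 1 / real L" using \<omega> L1 by (simp add: z_def)
    have nzw: "norm (z - \<omega>) = 1 / real L"
    proof -
      have "z - \<omega> = (- (1 / real L)) *\<^sub>R \<omega>" by (simp add: z_def scaleR_left_diff_distrib)
      then show ?thesis using \<omega> L1 by simp
    qed
    have num: "0 \<le> 1 - (norm z)\<^sup>2" "1 - (norm z)\<^sup>2 \<le> 2 / real L"
    proof -
      have "1 - (norm z)\<^sup>2 = (1 / real L) * (1 + norm z)" unfolding nz by (simp add: power2_eq_square algebra_simps)
      moreover have "0 \<le> norm z" "norm z \<le> 1" using nz L1 by auto
      ultimately show "0 \<le> 1 - (norm z)\<^sup>2" "1 - (norm z)\<^sup>2 \<le> 2 / real L"
        using L1 mult_left_mono[of "1 + norm z" 2 "1 / real L"] by auto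
    qed
    define P where "P = (\<lambda>u. (1 - (norm z)\<^sup>2) / norm (z - u) ^ ?n)"
    have P0: "P u \<ge> 0" for u using num(1) by (simp add: P_def)
    have Pm: "(\<lambda>u. indicator E u *\<^sub>R P u) \<in> borel_measurable borel" using E(1) unfolding P_def by measurable
    have "\<delta> \<le> 1 / \<sigma> * (\<integral>u. indicator E u *\<^sub>R P u \<partial>sphm)"
      using hm[OF nz] unfolding harmonic_measure_def set_lebesgue_integral_def P_def \<sigma>_def .
    then have "\<delta> * \<sigma> \<le> (\<integral>u. indicator E u *\<^sub>R P u \<partial>sphm)" using \<sigma> by (simp add: field_simps)
    also have "\<dots> = enn2real (\<integral>\<^sup>+u. ennreal (indicator E u *\<^sub>R P u) \<partial>sphm)"
      by (rule integral_eq_nn_integral) (use P0 measurable_sphmI[OF Pm] in \<open>auto simp: indicator_def\<close>)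
    finally have "ennreal (\<delta> * \<sigma>) \<le> ennreal (enn2real (\<integral>\<^sup>+u. ennreal (indicator E u *\<^sub>R P u) \<partial>sphm))" by (rule ennreal_leI)
    also have "\<dots> \<le> (\<integral>\<^sup>+u. ennreal (indicator E u *\<^sub>R P u) \<partial>sphm)"
      by (cases "\<integral>\<^sup>+u. ennreal (indicator E u *\<^sub>R P u) \<partial>sphm") auto
    also have "\<dots> \<le> (\<integral>\<^sup>+u. ennreal (2 * real L ^ (?n - 1)) * indicator A u
       + ennreal (2 ^ (?n + 1) / real L) * (ennreal (1 / norm (u - \<omega>) ^ ?n) * indicator {u. norm (u - \<omega>) \<ge> K / real L} u) \<partial>sphm)"
    proof (rule nn_integral_mono)
      fix u :: "real^'n" assume "u \<in> space sphm"
      then have u: "norm u = 1" by (simp add: space_sphere_measure)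
      show "ennreal (indicator E u *\<^sub>R P u) \<le> ennreal (2 * real L ^ (?n - 1)) * indicator A u
       + ennreal (2 ^ (?n + 1) / real L) * (ennreal (1 / norm (u - \<omega>) ^ ?n) * indicator {u. norm (u - \<omega>) \<ge> K / real L} u)"
      proof (cases "u \<in> E")
        case False then show ?thesis by simp
      next
        case uE: True
        show ?thesis
        proof (cases "norm (u - \<omega>) \<le> K / real L")
          case True
          then have uA: "u \<in> A" using uE by (simp add: A_def dist_norm norm_minus_commute)
          have "norm (z - u) \<ge> 1 / real L" using norm_triangle_ineq2[of u z] u nz by (simp add: norm_minus_commute)
          then have pw: "(1 / real L) ^ ?n \<le> norm (z - u) ^ ?n" using L1 by (intro power_mono) auto
          have "P u \<le> (2 / real L) / (1 / real L) ^ ?n"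
            unfolding P_def using num pw Lr by (intro frac_le) auto
          also have "\<dots> = 2 * real L ^ (?n - 1)" using n0 Lr by (cases ?n) (auto simp: power_one_over)
          finally have "ennreal (P u) \<le> ennreal (2 * real L ^ (?n - 1))" by (rule ennreal_leI)
          then show ?thesis using uE uA by (simp add: add_increasing2)
        next
          case False
          then have d: "norm (u - \<omega>) \<ge> K / real L" by simp
          \<comment> \<open>K \<ge> 2 makes |z - \<omega>| = 1 / L at most half of |u - \<omega>|,
            so z may be replaced by \<omega> in the kernel at the cost of 2^n.\<close>
          have "norm (u - \<omega>) \<ge> 2 / real L" using d K2 Lr divide_right_mono[of 2 K "real L"] by linarith
          then have h: "1 / real L \<le> norm (u - \<omega>) / 2" by simp
          have "norm (u - \<omega>) \<le> norm (z - u) + norm (z - \<omega>)" using norm_triangle_ineq[of "u - z" "z - \<omega>"] by (simp add: norm_minus_commute)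
          then have z2: "norm (u - \<omega>) / 2 \<le> norm (z - u)" using h nzw by linarith
          have p0: "norm (u - \<omega>) > 0" using h L1 by linarith
          have pw: "(norm (u - \<omega>) / 2) ^ ?n \<le> norm (z - u) ^ ?n" using z2 by (intro power_mono) auto
          have "P u \<le> (2 / real L) / (norm (u - \<omega>) / 2) ^ ?n"
            unfolding P_def using num pw p0 by (intro frac_le) auto
          also have "\<dots> = 2 ^ (?n + 1) / real L * (1 / norm (u - \<omega>) ^ ?n)" by (simp add: power_divide)
          finally have "ennreal (P u) \<le> ennreal (2 ^ (?n + 1) / real L * (1 / norm (u - \<omega>) ^ ?n))" by (rule ennreal_leI)
          also have "\<dots> = ennreal (2 ^ (?n + 1) / real L) * ennreal (1 / norm (u - \<omega>) ^ ?n)" by (rule ennreal_mult'') simp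
          finally show ?thesis using uE d by (simp add: add_increasing)
        qed
      qed
    qed
    also have "\<dots> = ennreal (2 * real L ^ (?n - 1)) * emeasure sphm A
       + ennreal (2 ^ (?n + 1) / real L) * (\<integral>\<^sup>+u. ennreal (1 / norm (u - \<omega>) ^ ?n) * indicator {u. norm (u - \<omega>) \<ge> K / real L} u \<partial>sphm)"
    proof -
      have Am: "A \<in> sets sphm" unfolding A_def using E by (intro sets_sphmI) auto
      have "(\<lambda>u::real^'n. ennreal (1 / norm (u - \<omega>) ^ ?n) * indicator {u. norm (u - \<omega>) \<ge> K / real L} u) \<in> borel_measurable borel"
        by measurable
      then have m: "(\<lambda>u::real^'n. ennreal (1 / norm (u - \<omega>) ^ ?n) * indicator {u. norm (u - \<omega>) \<ge> K / real L} u) \<in> borel_measurable sphm"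
        by (rule measurable_sphmI)
      show ?thesis using Am m by (subst nn_integral_add) (auto simp: nn_integral_cmult)
    qed
    also have "\<dots> \<le> ennreal (2 * real L ^ (?n - 1)) * ennreal (sph_mass A) + ennreal (2 ^ (?n + 1) / real L) * ennreal (C / (K / real L))"
      using C(2)[OF _ \<omega>, of "K / real L"] K2 Lr by (intro add_mono mult_left_mono) (auto simp: emeasure_sph_mass)
    also have "\<dots> = ennreal (2 * real L ^ (?n - 1) * sph_mass A + 2 ^ (?n + 1) / real L * (C / (K / real L)))"
    proof -
      have 1: "ennreal (2 * real L ^ (?n - 1)) * ennreal (sph_mass A) = ennreal (2 * real L ^ (?n - 1) * sph_mass A)"
        by (rule ennreal_mult''[symmetric]) simp
      have 2: "ennreal (2 ^ (?n + 1) / real L) * ennreal (C / (K / real L)) = ennreal (2 ^ (?n + 1) / real L * (C / (K / real L)))"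
        using C(1) K2 by (intro ennreal_mult''[symmetric]) simp
      show ?thesis unfolding 1 2 using C(1) K2 by (intro ennreal_plus[symmetric]) auto
    qed
    finally have "\<delta> * \<sigma> \<le> 2 * real L ^ (?n - 1) * sph_mass A + 2 ^ (?n + 1) / real L * (C / (K / real L))"
      using C(1) K2 Lr by (subst (asm) ennreal_le_iff) (auto intro!: add_nonneg_nonneg)
    moreover have "2 ^ (?n + 1) / real L * (C / (K / real L)) = 2 ^ (?n + 1) * C / K" using Lr by simp
    ultimately have "2 * real L ^ (?n - 1) * sph_mass A \<ge> \<delta> * \<sigma> / 2" using far by linarith
    then have "c \<le> sph_mass A * real L ^ (?n - 1)" by (simp add: c_def mult_ac)
    then show ?thesis using Lr unfolding A_def by (simp add: pos_divide_le_eq)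
  qed
  show ?thesis using K2 c main by blast
qed

text \<open>About 1 / \<epsilon> balls of radius 2 \<epsilon> R, with centres spaced by \<epsilon> R
  on the axis, cover the tube. This gives the order \<epsilon>^(n-1) R^n, and n \<ge> 2 leaves a
  factor \<epsilon>.\<close>

lemma tube_measure:
  fixes x e :: "real^'n"
  assumes n: "CARD('n) \<ge> 2" and e: "norm e = 1" and R: "R > 0" and \<epsilon>: "0 < \<epsilon>" "\<epsilon> \<le> 1"
  shows "emeasure lborel {y. norm (y - x) \<le> R \<and> norm ((y - x) - ((y - x) \<bullet> e) *\<^sub>R e) \<le> \<epsilon> * R}
    \<le> ennreal (5 * 2 ^ CARD('n) * unit_ball_vol (real CARD('n)) * \<epsilon> * R ^ CARD('n))"
proof -
  let ?n = "CARD('n)"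
  let ?v = "unit_ball_vol (real ?n)"
  define N where "N = \<lceil>1 / \<epsilon>\<rceil>"
  let ?B = "\<lambda>k::int. cball (x + (of_int k * (\<epsilon> * R)) *\<^sub>R e) (2 * \<epsilon> * R)"
  have "{y. norm (y - x) \<le> R \<and> norm ((y - x) - ((y - x) \<bullet> e) *\<^sub>R e) \<le> \<epsilon> * R} \<subseteq> (\<Union>k\<in>{-N..N}. ?B k)"
  proof
    fix y assume "y \<in> {y. norm (y - x) \<le> R \<and> norm ((y - x) - ((y - x) \<bullet> e) *\<^sub>R e) \<le> \<epsilon> * R}"
    then have y: "norm (y - x) \<le> R" "norm ((y - x) - ((y - x) \<bullet> e) *\<^sub>R e) \<le> \<epsilon> * R" by auto
    define a where "a = (y - x) \<bullet> e"
    have aR: "\<bar>a\<bar> \<le> R" using Cauchy_Schwarz_ineq2[of "y - x" e] y(1) e by (simp add: a_def)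
    define k where "k = \<lfloor>a / (\<epsilon> * R)\<rfloor>"
    have q: "\<bar>a / (\<epsilon> * R)\<bar> \<le> 1 / \<epsilon>"
      using aR R \<epsilon> by (simp add: abs_mult field_simps)
    have k: "of_int k \<le> a / (\<epsilon> * R)" "a / (\<epsilon> * R) < of_int k + 1" by (simp_all add: k_def)
    have "1 / \<epsilon> \<le> of_int N" by (simp add: N_def)
    moreover have "- (1 / \<epsilon>) \<le> a / (\<epsilon> * R)" "a / (\<epsilon> * R) \<le> 1 / \<epsilon>" using q by (simp_all only: abs_le_iff) linarith+
    ultimately have "real_of_int k \<le> of_int N" "real_of_int (- N) < of_int (k + 1)"
      using k unfolding of_int_minus of_int_add of_int_1 by linarith+
    then have "k \<le> N" "- N < k + 1" by (simp_all only: of_int_le_iff of_int_less_iff)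
    then have "- N \<le> k" by simp
    have "\<bar>a - of_int k * (\<epsilon> * R)\<bar> \<le> \<epsilon> * R"
    proof -
      have "of_int k * (\<epsilon> * R) \<le> a" "a \<le> (of_int k + 1) * (\<epsilon> * R)" using k R \<epsilon> by (simp_all add: field_simps)
      then show ?thesis by (simp add: abs_le_iff algebra_simps)
    qed
    moreover have "y - (x + (of_int k * (\<epsilon> * R)) *\<^sub>R e) = ((y - x) - a *\<^sub>R e) + (a - of_int k * (\<epsilon> * R)) *\<^sub>R e"
      by (simp add: algebra_simps)
    then have "norm (y - (x + (of_int k * (\<epsilon> * R)) *\<^sub>R e)) \<le> norm ((y - x) - a *\<^sub>R e) + norm ((a - of_int k * (\<epsilon> * R)) *\<^sub>R e)"
      by (metis norm_triangle_ineq)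
    ultimately have "norm (y - (x + (of_int k * (\<epsilon> * R)) *\<^sub>R e)) \<le> 2 * \<epsilon> * R" using y(2) e by (simp add: a_def)
    then have "y \<in> ?B k" by (simp add: dist_norm norm_minus_commute)
    then show "y \<in> (\<Union>k\<in>{-N..N}. ?B k)" using \<open>k \<le> N\<close> \<open>- N \<le> k\<close> by auto
  qed
  then have "emeasure lborel {y. norm (y - x) \<le> R \<and> norm ((y - x) - ((y - x) \<bullet> e) *\<^sub>R e) \<le> \<epsilon> * R} \<le> emeasure lborel (\<Union>k\<in>{-N..N}. ?B k)"
    by (intro emeasure_mono) auto
  also have "\<dots> \<le> (\<Sum>k\<in>{-N..N}. emeasure lborel (?B k))"
    by (rule emeasure_subadditive_finite) auto
  also have "\<dots> = (\<Sum>k\<in>{-N..N}. ennreal (?v * (2 * \<epsilon> * R) ^ ?n))"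
    using R \<epsilon> by (intro sum.cong refl emeasure_cball_vec) auto
  also have "\<dots> = ennreal (real (card {-N..N}) * (?v * (2 * \<epsilon> * R) ^ ?n))"
    using R \<epsilon> by (simp add: ennreal_of_nat_eq_real_of_nat ennreal_mult')
  also have "\<dots> \<le> ennreal (5 * 2 ^ ?n * ?v * \<epsilon> * R ^ ?n)"
  proof (rule ennreal_leI)
    have "1 / \<epsilon> > 0" using \<epsilon> by simp
    then have N0: "N \<ge> 0" unfolding N_def by linarith
    have "real_of_int N \<le> 1 / \<epsilon> + 1" unfolding N_def by linarith
    \<comment> \<open>As \<epsilon> \<le> 1, the number 2 N + 1 of balls is at most 5 / \<epsilon>;
      this is the 5 of the statement.\<close>
    then have "real (card {-N..N}) \<le> 2 * (1 / \<epsilon> + 1) + 1" using N0 by simp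
    also have "\<dots> \<le> 5 / \<epsilon>" using \<epsilon> by (simp add: field_simps)
    finally have "real (card {-N..N}) * (?v * (2 * \<epsilon> * R) ^ ?n) \<le> 5 / \<epsilon> * (?v * (2 * \<epsilon> * R) ^ ?n)"
      using R \<epsilon> by (intro mult_right_mono) auto
    also have "\<dots> = 5 * 2 ^ ?n * ?v * \<epsilon> ^ (?n - 1) * R ^ ?n"
      using n \<epsilon> by (cases ?n) (auto simp: power_mult_distrib)
    also have "\<dots> \<le> 5 * 2 ^ ?n * ?v * \<epsilon> ^ 1 * R ^ ?n"
      using n \<epsilon> R by (intro mult_right_mono mult_left_mono power_decreasing) auto
    finally show "real (card {-N..N}) * (?v * (2 * \<epsilon> * R) ^ ?n) \<le> 5 * 2 ^ ?n * ?v * \<epsilon> * R ^ ?n" by simp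
  qed
  finally show ?thesis .
qed

text \<open>Points near the axis of \<open>x\<close> are left out: along a line through \<open>x\<close> and such a point the direction
  hardly moves, or it moves towards the antipode of \<open>x\<close>.\<close>
definition near_cone :: "(real^'n) set \<Rightarrow> real \<Rightarrow> real \<Rightarrow> real^'n \<Rightarrow> (real^'n) set" where
  "near_cone E R \<epsilon> x = {y. norm y \<le> 2 \<and> norm (y - x) \<le> R \<and> sgn y \<in> E \<and> norm (y - (y \<bullet> sgn x) *\<^sub>R sgn x) \<ge> \<epsilon> * R}"

lemma near_cone_borel: "E \<in> sets borel \<Longrightarrow> near_cone E R \<epsilon> x \<in> sets borel"
proof -
  assume E: "E \<in> sets borel"
  have "near_cone E R \<epsilon> x = {y \<in> {y. norm y \<le> 2 \<and> norm (y - x) \<le> R \<and> norm (y - (y \<bullet> sgn x) *\<^sub>R sgn x) \<ge> \<epsilon> * R}. sgn y \<in> E}"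
    by (auto simp: near_cone_def)
  moreover have "{y. norm y \<le> 2 \<and> norm (y - x) \<le> R \<and> norm (y - (y \<bullet> sgn x) *\<^sub>R sgn x) \<ge> \<epsilon> * R} \<in> sets borel"
    by measurable
  ultimately show ?thesis using sets_sgn[OF _ E] by simp
qed

text \<open>Over the part of E in the cap, the layer of thickness 1 / L just inside radius |x| has
  volume at least of order L^(-n) and stays within 3 K / L of x. The tube around the axis, which
  \<open>near_cone\<close> excludes, takes at most half of that bound by the choice of
  \<epsilon>.\<close>

lemma harmonic_density_ball:
  fixes \<delta> :: real
  assumes n: "CARD('n) \<ge> 2" and \<delta>: "\<delta> > 0"
  shows "\<exists>K c \<epsilon>. K \<ge> 2 \<and> c > 0 \<and> 0 < \<epsilon> \<and> \<epsilon> \<le> 1 \<and> (\<forall>L E x. L \<ge> (1::nat) \<longrightarrow> E \<in> sets borel \<longrightarrow> (E :: (real^'n) set) \<subseteq> unit_sphere \<longrightarrow>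
    (\<forall>z. norm z = 1 - 1 / real L \<longrightarrow> harmonic_measure z E \<ge> \<delta>) \<longrightarrow> 1 \<le> norm x \<longrightarrow> norm x \<le> 2 \<longrightarrow>
    emeasure lborel (near_cone E (3 * K / real L) \<epsilon> x) \<ge> ennreal (c / real L ^ CARD('n)))"
proof -
  let ?n = "CARD('n)"
  let ?v = "unit_ball_vol (real ?n)"
  have n0: "0 < ?n" by (rule zero_less_card_finite)
  have v0: "?v > 0" by (rule unit_ball_vol_pos) simp
  obtain K c0 where K: "K \<ge> 2" and c0: "c0 > 0" and dens: "\<And>L E \<omega>. L \<ge> (1::nat) \<Longrightarrow> E \<in> sets borel \<Longrightarrow> (E :: (real^'n) set) \<subseteq> unit_sphere \<Longrightarrow>
    (\<forall>z. norm z = 1 - 1 / real L \<longrightarrow> harmonic_measure z E \<ge> \<delta>) \<Longrightarrow> norm \<omega> = 1 \<Longrightarrow>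
    sph_mass (E \<inter> cball \<omega> (K / real L)) \<ge> c0 / real L ^ (?n - 1)"
    using harmonic_density[OF \<delta>, where 'n='n] by blast
  \<comment> \<open>Half of the lower bound c0 / (n L^n) for the layer; the other half is left to
    the tube.\<close>
  define c where "c = c0 / (2 * real ?n)"
  have c: "c > 0" unfolding c_def using c0 n0 by simp
  define T where "T = 5 * 2 ^ ?n * ?v * (3 * K) ^ ?n"
  have T: "T > 0" unfolding T_def using v0 K by simp
  define \<epsilon> where "\<epsilon> = min 1 (c / T)"
  have \<epsilon>: "0 < \<epsilon>" "\<epsilon> \<le> 1" "\<epsilon> * T \<le> c" using c T by (auto simp: \<epsilon>_def min_def field_simps)
  have main: "emeasure lborel (near_cone E (3 * K / real L) \<epsilon> x) \<ge> ennreal (c / real L ^ ?n)"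
    if L: "L \<ge> 1" and E: "E \<in> sets borel" "E \<subseteq> unit_sphere" and hm: "\<forall>z. norm z = 1 - 1 / real L \<longrightarrow> harmonic_measure z E \<ge> \<delta>"
      and x: "1 \<le> norm x" "norm x \<le> 2" for L E and x :: "real^'n"
  proof -
    define e where "e = sgn x"
    have xn: "norm x > 0" using x by linarith
    have e: "norm e = 1" using xn by (simp add: e_def norm_sgn)
    have xe: "x = norm x *\<^sub>R e" using xn by (simp add: e_def sgn_div_norm)
    define R where "R = 3 * K / real L"
    have Lr: "real L \<ge> 1" using L by simp
    have R: "R > 0" using K Lr by (simp add: R_def)
    define A where "A = E \<inter> cball e (K / real L)"
    have A: "A \<in> sets borel" "A \<subseteq> unit_sphere" using E by (auto simp: A_def)
    have sA: "sph_mass A \<ge> c0 / real L ^ (?n - 1)" unfolding A_def by (rule dens[OF L E hm e])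
    define h where "h = 1 / real L"
    have h: "0 < h" "h \<le> 1" using Lr by (auto simp: h_def)
    define Y0 where "Y0 = {y \<in> cball 0 (norm x). sgn y \<in> A} - cball 0 (norm x - h)"
    define Tb where "Tb = {y. norm (y - x) \<le> R \<and> norm ((y - x) - ((y - x) \<bullet> e) *\<^sub>R e) \<le> \<epsilon> * R}"
    let ?Y = "near_cone E R \<epsilon> x"
    have Y0m: "Y0 \<in> sets borel" unfolding Y0_def using sets_sgn[OF _ A(1), of "cball 0 (norm x)"] by auto
    have Tbm: "Tb \<in> sets borel" unfolding Tb_def by measurable
    have Ym: "?Y \<in> sets borel" by (rule near_cone_borel[OF E(1)])
    have sub: "Y0 \<subseteq> ?Y \<union> Tb"
    proof
      fix y assume y: "y \<in> Y0"
      then have y1: "norm y \<le> norm x" "norm y > norm x - h" "sgn y \<in> E" "norm (sgn y - e) \<le> K / real L"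
        by (auto simp: Y0_def A_def dist_norm norm_minus_commute)
      have "norm (y - x) \<le> \<bar>norm y - norm x\<bar> + norm x * norm (sgn y - sgn x)" by (rule dist_sgn) (use x in linarith)
      also have "\<dots> \<le> h + 2 * (K / real L)"
        using y1 x by (intro add_mono mult_mono) (auto simp: e_def)
      \<comment> \<open>1 / L for the thickness and 2 K / L for the angle, because |x| \<le> 2: the
        origin of the factor 3.\<close>
      also have "\<dots> \<le> R" using K Lr by (simp add: h_def R_def divide_simps)
      finally have yR: "norm (y - x) \<le> R" .
      \<comment> \<open>x lies on the axis, so y and y - x have the same component orthogonal to e.
        This matches \<open>near_cone\<close> with the tube around x.\<close>
      have pe: "(y - x) - ((y - x) \<bullet> e) *\<^sub>R e = y - (y \<bullet> e) *\<^sub>R e"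
      proof -
        have "(x \<bullet> e) *\<^sub>R e = x"
        proof -
          have "x \<bullet> e = norm x" by (subst xe) (use e in \<open>simp add: norm_eq_1\<close>)
          then show ?thesis using xe by simp
        qed
        then show ?thesis by (simp add: inner_diff_left scaleR_left_diff_distrib)
      qed
      show "y \<in> ?Y \<union> Tb"
        unfolding near_cone_def Tb_def Un_iff mem_Collect_eq e_def[symmetric] pe using yR y1 x by auto
    qed
    have vol: "c0 / (real ?n * real L ^ ?n) \<le> measure lborel Y0"
    proof -
      let ?C = "\<lambda>r. {y \<in> cball 0 r. sgn y \<in> A}"
      have hx: "norm x - h \<ge> 0" using x h by linarith
      have Cm: "?C r \<in> sets lborel" for r using sets_sgn[OF _ A(1), of "cball 0 r"] by simp
      have fC: "?C r \<in> fmeasurable lborel" if "r \<ge> 0" for r using cone_measure_real(2)[OF A that] Cm by (intro fmeasurableI) auto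
      have fY: "Y0 \<in> fmeasurable lborel" by (rule fmeasurableI2[OF fC[of "norm x"]]) (use Y0m in \<open>auto simp: Y0_def\<close>)
      have "measure lborel (?C (norm x)) \<le> measure lborel (?C (norm x - h) \<union> Y0)"
        by (rule measure_mono_fmeasurable) (use fC[OF hx] fY Cm in \<open>auto simp: Y0_def intro: fmeasurable.Un\<close>)
      also have "\<dots> \<le> measure lborel (?C (norm x - h)) + measure lborel Y0"
        by (rule measure_Un_le) (use Cm Y0m in auto)
      finally have "norm x ^ ?n * sph_mass A / real ?n \<le> (norm x - h) ^ ?n * sph_mass A / real ?n + measure lborel Y0"
        unfolding cone_measure_real(1)[OF A norm_ge_zero] cone_measure_real(1)[OF A hx] .
      \<comment> \<open>Since |x| \<ge> 1, shrinking the radius by h lowers its n-th power by at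
        least h.\<close>
      moreover have "(norm x - h) ^ ?n \<le> norm x ^ ?n - h"
      proof -
        obtain d where d: "?n = Suc d" using n0 by (cases ?n) auto
        have "(norm x - h) ^ ?n \<le> (norm x - h) * norm x ^ d" unfolding d power_Suc using hx h by (intro mult_left_mono power_mono) auto
        also have "\<dots> = norm x ^ ?n - h * norm x ^ d" by (simp add: d algebra_simps)
        also have "\<dots> \<le> norm x ^ ?n - h * 1" using h x one_le_power[of "norm x" d] by (intro diff_mono mult_left_mono) auto
        finally show ?thesis by simp
      qed
      then have "(norm x - h) ^ ?n * sph_mass A / real ?n \<le> (norm x ^ ?n - h) * sph_mass A / real ?n"
        by (intro divide_right_mono mult_right_mono) auto
      ultimately have "h * sph_mass A / real ?n \<le> measure lborel Y0" by (simp add: left_diff_distrib diff_divide_distrib)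
      moreover have "c0 / (real ?n * real L ^ ?n) \<le> h * sph_mass A / real ?n"
      proof -
        have "c0 / (real ?n * real L ^ ?n) = h * (c0 / real L ^ (?n - 1)) / real ?n"
          using n0 Lr by (cases ?n) (auto simp: h_def)
        also have "\<dots> \<le> h * sph_mass A / real ?n" using sA h by (intro divide_right_mono mult_left_mono) auto
        finally show ?thesis .
      qed
      ultimately show ?thesis by linarith
    qed
    have "ennreal (c / real L ^ ?n) + ennreal (c / real L ^ ?n) = ennreal (c0 / (real ?n * real L ^ ?n))"
    proof -
      have q: "c / real L ^ ?n \<ge> 0" using c by simp
      have "c / real L ^ ?n + c / real L ^ ?n = c0 / (real ?n * real L ^ ?n)" using Lr n0 by (simp add: c_def field_simps)
      then show ?thesis using ennreal_plus[OF q q] by simp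
    qed
    also have "\<dots> \<le> ennreal (measure lborel Y0)" by (rule ennreal_leI[OF vol])
    also have "\<dots> \<le> emeasure lborel Y0" by (simp add: measure_def) (cases "emeasure lborel Y0", auto)
    also have "\<dots> \<le> emeasure lborel (?Y \<union> Tb)" using sub Ym Tbm by (intro emeasure_mono) auto
    also have "\<dots> \<le> emeasure lborel ?Y + emeasure lborel Tb" using Ym Tbm by (intro emeasure_subadditive) auto
    also have "emeasure lborel Tb \<le> ennreal (5 * 2 ^ ?n * ?v * \<epsilon> * R ^ ?n)"
      unfolding Tb_def by (rule tube_measure[OF n e R \<epsilon>(1,2)])
    also have "\<dots> \<le> ennreal (c / real L ^ ?n)"
    proof (rule ennreal_leI)
      have "5 * 2 ^ ?n * ?v * \<epsilon> * R ^ ?n = (\<epsilon> * T) / real L ^ ?n" by (simp add: T_def R_def power_divide)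
      also have "\<dots> \<le> c / real L ^ ?n" using \<epsilon>(3) by (intro divide_right_mono) auto
      finally show "5 * 2 ^ ?n * ?v * \<epsilon> * R ^ ?n \<le> c / real L ^ ?n" .
    qed
    finally have "ennreal (c / real L ^ ?n) + ennreal (c / real L ^ ?n) \<le> emeasure lborel ?Y + ennreal (c / real L ^ ?n)"
      by (simp add: add_left_mono)
    then show ?thesis unfolding R_def by (simp add: ennreal_add_left_cancel_le add.commute)
  qed
  show ?thesis using K c \<epsilon>(1,2) main by blast
qed

section \<open>Estimates at good points\<close>

lemma exp_partial_sum: "(\<Sum>k\<le>N. x ^ k / fact k) \<le> exp (x::real)" if "x \<ge> 0"
proof -
  have "(\<Sum>k\<in>{..N}. inverse (fact k) * x ^ k) \<le> (\<Sum>k. inverse (fact k) * x ^ k)"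
    by (rule sum_le_suminf[OF summable_exp]) (use that in auto)
  then show ?thesis by (simp add: exp_def divide_inverse mult.commute)
qed

text \<open>The Taylor polynomial of G at e is evaluated at the increment (cos - 1) e + sin v with
  complex angle s / L. For bounded s the increment has order |s| / L, while the k-th derivative is
  at most (\<beta> L)^k |G e|; so L cancels and an exponential series bounds the sum.\<close>

lemma great_circle_entire:
  fixes G :: "real^'n \<Rightarrow> complex" and e v :: "real^'n"
  assumes G: "harm_sum L G" and L: "L \<ge> 1" and e: "norm e = 1" and v: "norm v = 1" and nz: "G e \<noteq> 0"
    and \<beta>: "\<beta> \<ge> 0" and bern: "\<And>k. k \<le> L \<Longrightarrow> sqrt (deriv_sq k G e) \<le> (\<beta> * real L) ^ k * norm (G e)"
  shows "\<exists>T. T holomorphic_on UNIV \<and> T 0 = 1 \<and> (\<forall>s. norm (T s) \<le> exp (\<beta> * (2 * norm s * exp (2 * norm s)))) \<and>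
    (\<forall>\<theta>. T (of_real (real L * \<theta>)) = G (cos \<theta> *\<^sub>R e + sin \<theta> *\<^sub>R v) / G e)"
proof -
  define u where "u = (\<lambda>s i. (cos (s / of_nat L) - 1) * of_real (e $ i) + sin (s / of_nat L) * complex_of_real (v $ i))"
  define T where "T = (\<lambda>s. (\<Sum>k\<le>L. taylor_term k G e (u s) / fact k) / G e)"
  have Lr: "real L \<ge> 1" using L by simp
  have hol: "T holomorphic_on UNIV"
  proof -
    have "(\<lambda>s. u s i) holomorphic_on UNIV" for i
      unfolding u_def using L by (intro holomorphic_intros) auto
    then have "(\<lambda>s. taylor_term k G e (u s)) holomorphic_on UNIV" for k by (rule taylor_term_holomorphic)
    then show ?thesis unfolding T_def using nz by (intro holomorphic_intros) auto
  qed
  \<comment> \<open>For a real angle the increment is real, and the Taylor expansion of a polynomial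
    is exact.\<close>
  have real_eq: "T (of_real (real L * \<theta>)) = G (cos \<theta> *\<^sub>R e + sin \<theta> *\<^sub>R v) / G e" for \<theta>
  proof -
    have a: "complex_of_real (real L * \<theta>) / of_nat L = of_real \<theta>" using L by simp
    define y where "y = (cos \<theta> - 1) *\<^sub>R e + sin \<theta> *\<^sub>R v"
    have "u (of_real (real L * \<theta>)) = (\<lambda>i. of_real (y $ i))"
      unfolding u_def a by (auto simp: fun_eq_iff y_def cos_of_real sin_of_real)
    moreover have "e + y = cos \<theta> *\<^sub>R e + sin \<theta> *\<^sub>R v" by (simp add: y_def algebra_simps)
    ultimately show ?thesis unfolding T_def using taylor_poly_sum[OF harm_sum_poly_sum[OF G], of e y] by simp
  qed
  have T0: "T 0 = 1" using real_eq[of 0] nz by simp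
  have bound: "norm (T s) \<le> exp (\<beta> * (2 * norm s * exp (2 * norm s)))" for s
  proof -
    let ?z = "s / of_nat L"
    define r where "r = L2_set (\<lambda>i. norm (u s i)) UNIV"
    have r0: "r \<ge> 0" by (simp add: r_def L2_set_nonneg)
    have nz1: "L2_set (\<lambda>i. norm a * \<bar>(w :: real^'n) $ i\<bar>) UNIV = norm a" if "norm w = 1" for a :: complex and w
    proof -
      have "L2_set (\<lambda>i. norm a * \<bar>w $ i\<bar>) UNIV = norm a * L2_set (\<lambda>i. \<bar>w $ i\<bar>) UNIV"
        by (rule L2_set_right_distrib[symmetric]) simp
      also have "L2_set (\<lambda>i. \<bar>w $ i\<bar>) UNIV = norm w" by (simp add: norm_vec_def)
      finally show ?thesis using that by simp
    qed
    have "r \<le> L2_set (\<lambda>i. norm (cos ?z - 1) * \<bar>e $ i\<bar> + norm (sin ?z) * \<bar>v $ i\<bar>) UNIV"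
      unfolding r_def
    proof (rule L2_set_mono)
      fix i
      have "norm (u s i) \<le> norm ((cos ?z - 1) * of_real (e $ i)) + norm (sin ?z * complex_of_real (v $ i))"
        unfolding u_def by (rule norm_triangle_ineq)
      then show "norm (u s i) \<le> norm (cos ?z - 1) * \<bar>e $ i\<bar> + norm (sin ?z) * \<bar>v $ i\<bar>" by (simp add: norm_mult)
    qed simp
    also have "\<dots> \<le> L2_set (\<lambda>i. norm (cos ?z - 1) * \<bar>e $ i\<bar>) UNIV + L2_set (\<lambda>i. norm (sin ?z) * \<bar>v $ i\<bar>) UNIV"
      by (rule L2_set_triangle_ineq)
    also have "\<dots> = norm (cos ?z - 1) + norm (sin ?z)" by (simp only: nz1[OF e] nz1[OF v])
    also have "\<dots> \<le> norm ?z * exp (2 * norm ?z) + norm ?z * exp (norm ?z)"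
      by (intro add_mono norm_cos_bound norm_sin_bound)
    also have "\<dots> \<le> norm ?z * exp (2 * norm ?z) + norm ?z * exp (2 * norm ?z)"
      by (intro add_mono mult_left_mono) auto
    also have "\<dots> = 2 * norm ?z * exp (2 * norm ?z)" by simp
    finally have r1: "r \<le> 2 * norm ?z * exp (2 * norm ?z)" .
    have nzs: "norm ?z = norm s / real L" by (simp add: norm_divide)
    \<comment> \<open>L \<ge> 1 removes L from the exponent only; the factor |s| / L in front is
      kept for the cancellation.\<close>
    have "norm ?z \<le> norm s" unfolding nzs using Lr divide_left_mono[of 1 "real L" "norm s"] by simp
    then have "2 * norm ?z * exp (2 * norm ?z) \<le> 2 * norm ?z * exp (2 * norm s)" by (intro mult_left_mono) auto
    with r1 have "r \<le> 2 * norm ?z * exp (2 * norm s)" by linarith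
    then have "r * (\<beta> * real L) \<le> 2 * norm ?z * exp (2 * norm s) * (\<beta> * real L)" using \<beta> by (intro mult_right_mono) auto
    also have "\<dots> = \<beta> * (2 * norm s * exp (2 * norm s))" unfolding nzs using Lr by simp
    finally have r2: "r * (\<beta> * real L) \<le> \<beta> * (2 * norm s * exp (2 * norm s))" .
    have "norm (\<Sum>k\<le>L. taylor_term k G e (u s) / fact k) \<le> (\<Sum>k\<le>L. norm (G e) * ((r * (\<beta> * real L)) ^ k / fact k))"
    proof (rule sum_norm_le)
      fix k assume k: "k \<in> {..L}"
      have "norm (taylor_term k G e (u s)) \<le> r ^ k * sqrt (deriv_sq k G e)" unfolding r_def by (rule norm_taylor_term)
      also have "\<dots> \<le> r ^ k * ((\<beta> * real L) ^ k * norm (G e))" using k r0 by (intro mult_left_mono bern) auto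
      also have "\<dots> = norm (G e) * (r * (\<beta> * real L)) ^ k" by (simp add: power_mult_distrib)
      finally have "norm (taylor_term k G e (u s)) / fact k \<le> norm (G e) * (r * (\<beta> * real L)) ^ k / fact k"
        by (intro divide_right_mono) auto
      then show "norm (taylor_term k G e (u s) / fact k) \<le> norm (G e) * ((r * (\<beta> * real L)) ^ k / fact k)"
        by (simp add: norm_divide)
    qed
    also have "\<dots> = norm (G e) * (\<Sum>k\<le>L. (r * (\<beta> * real L)) ^ k / fact k)" by (rule sum_distrib_left[symmetric])
    also have "\<dots> \<le> norm (G e) * exp (r * (\<beta> * real L))"
      using r0 \<beta> by (intro mult_left_mono exp_partial_sum) auto
    also have "\<dots> \<le> norm (G e) * exp (\<beta> * (2 * norm s * exp (2 * norm s)))" using r2 by (intro mult_left_mono) auto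
    finally show ?thesis unfolding T_def using nz by (simp add: norm_divide field_simps)
  qed
  show ?thesis using hol T0 bound real_eq by blast
qed

text \<open>The directions of \<open>x + t *\<^sub>R w\<close> run along a great circle through
  \<open>sgn x\<close>, and \<open>remez_entire\<close> applies to L times the angle as a function
  of t. The growth bound b, the expansion m and the range \<Theta> are free of L, hence so is
  \<eta>.\<close>

lemma line_lower_bound:
  fixes K \<epsilon> c' \<beta> :: real
  assumes K: "K \<ge> 2" and \<epsilon>: "0 < \<epsilon>" and c': "c' > 0" and \<beta>: "\<beta> \<ge> 0"
  shows "\<exists>\<eta>>0. \<forall>L G E (x :: real^'n) w. L \<ge> 1 \<longrightarrow> harm_sum L G \<longrightarrow> E \<in> sets borel \<longrightarrow> 1 \<le> norm x \<longrightarrow> G (sgn x) \<noteq> 0 \<longrightarrow>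
    (\<forall>k\<le>L. sqrt (deriv_sq k G (sgn x)) \<le> (\<beta> * real L) ^ k * norm (G (sgn x))) \<longrightarrow>
    emeasure lborel {t\<in>{1/2..1}. x + t *\<^sub>R w \<in> near_cone E (3 * K / real L) \<epsilon> x} \<ge> ennreal c' \<longrightarrow>
    (\<exists>S'\<subseteq>{t\<in>{1/2..1}. x + t *\<^sub>R w \<in> near_cone E (3 * K / real L) \<epsilon> x}. S' \<in> sets borel \<and>
       emeasure lborel S' \<ge> ennreal (c' / 2) \<and> (\<forall>t\<in>S'. norm (G (sgn (x + t *\<^sub>R w))) \<ge> \<eta> * norm (G (sgn x))))"
proof -
  define b where "b = (\<lambda>s :: complex. exp (\<beta> * (2 * norm s * exp (2 * norm s))))"
  have cb: "continuous_on UNIV b" unfolding b_def by (intro continuous_intros)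
  \<comment> \<open>Least speed of L times the angle: L R = 3 K, the distance from the axis supplies
    \<epsilon>, and two radii of at most 2 supply the 4.\<close>
  define m where "m = 3 * K * \<epsilon> / 4"
  have m: "m > 0" using K \<epsilon> by (simp add: m_def)
  \<comment> \<open>For R < 1/4 the angle is at most 4 R / 3, so L times it is at most 4 K.
    Otherwise L \<le> 12 K, and the angle is at most pi. This value covers both cases.\<close>
  define \<Theta> where "\<Theta> = 12 * K * pi"
  obtain \<eta> where \<eta>: "\<eta> > 0" and rem: "\<And>T (\<theta> :: real \<Rightarrow> real) S. T holomorphic_on UNIV \<Longrightarrow> T 0 = 1 \<Longrightarrow> (\<forall>s. norm (T s) \<le> b s) \<Longrightarrow>
     S \<in> sets borel \<Longrightarrow> emeasure lborel S \<ge> ennreal c' \<Longrightarrow> (\<forall>t\<in>S. \<bar>\<theta> t\<bar> \<le> \<Theta>) \<Longrightarrow>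
     (\<forall>t\<in>S. \<forall>t'\<in>S. \<bar>\<theta> t - \<theta> t'\<bar> \<ge> m * \<bar>t - t'\<bar>) \<Longrightarrow>
     (\<exists>S'\<subseteq>S. S' \<in> sets borel \<and> emeasure lborel S' \<ge> ennreal (c' / 2) \<and> (\<forall>t\<in>S'. norm (T (of_real (\<theta> t))) \<ge> \<eta>))"
    using remez_entire[OF cb m c', of \<Theta>] by blast
  have main: "\<exists>S'\<subseteq>S. S' \<in> sets borel \<and> emeasure lborel S' \<ge> ennreal (c' / 2) \<and> (\<forall>t\<in>S'. norm (G (sgn (x + t *\<^sub>R w))) \<ge> \<eta> * norm (G (sgn x)))"
    if L: "L \<ge> 1" and G: "harm_sum L G" and E: "E \<in> sets borel" and x: "1 \<le> norm x" and nz: "G (sgn x) \<noteq> 0"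
      and bern: "\<forall>k\<le>L. sqrt (deriv_sq k G (sgn x)) \<le> (\<beta> * real L) ^ k * norm (G (sgn x))"
      and S_def: "S = {t\<in>{1/2..1}. x + t *\<^sub>R w \<in> near_cone E (3 * K / real L) \<epsilon> x}"
      and S: "emeasure lborel S \<ge> ennreal c'" for L G E S and x w :: "real^'n"
  proof -
    define e where "e = sgn x"
    define R where "R = 3 * K / real L"
    have Lr: "real L \<ge> 1" using L by simp
    have R: "R > 0" using K Lr by (simp add: R_def)
    have LR: "real L * R = 3 * K" using Lr by (simp add: R_def)
    have xn: "norm x > 0" using x by linarith
    have e: "norm e = 1" using xn by (simp add: e_def norm_sgn)
    have ee: "e \<bullet> e = 1" using e by (simp add: norm_eq_1)
    have xe: "x = norm x *\<^sub>R e" using xn by (simp add: e_def sgn_div_norm)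
    have Sm: "S \<in> sets borel"
    proof -
      have "S = {1/2..1} \<inter> ((\<lambda>t. x + t *\<^sub>R w) -` near_cone E R \<epsilon> x \<inter> space borel)" by (auto simp: S_def R_def)
      moreover have "(\<lambda>t. x + t *\<^sub>R w) -` near_cone E R \<epsilon> x \<inter> space borel \<in> sets (borel :: real measure)"
        by (rule measurable_sets[OF _ near_cone_borel[OF E]]) measurable
      ultimately show ?thesis by simp
    qed
    define w1 where "w1 = w \<bullet> e"
    define p where "p = w - w1 *\<^sub>R e"
    define w2 where "w2 = norm p"
    have pe: "p \<bullet> e = 0" by (simp add: p_def inner_diff_left w1_def ee)
    have dec: "x + t *\<^sub>R w = (norm x + t * w1) *\<^sub>R e + t *\<^sub>R p" for t
    proof -
      have "x + t *\<^sub>R w = norm x *\<^sub>R e + t *\<^sub>R (w1 *\<^sub>R e + p)" using xe by (simp add: p_def)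
      then show ?thesis by (simp add: algebra_simps)
    qed
    have perp: "(x + t *\<^sub>R w) - ((x + t *\<^sub>R w) \<bullet> e) *\<^sub>R e = t *\<^sub>R p" for t
      unfolding dec by (simp add: inner_add_left ee pe)
    have St: "1/2 \<le> t" "t \<le> 1" "norm (x + t *\<^sub>R w) \<le> 2" "norm (t *\<^sub>R w) \<le> R" "\<epsilon> * R \<le> t * w2" if "t \<in> S" for t
      using that perp[of t] by (auto simp: S_def near_cone_def R_def[symmetric] e_def[symmetric] w2_def)
    have "S \<noteq> {}" using S c' by auto
    then obtain t0 where t0: "t0 \<in> S" by blast
    have w2: "w2 \<ge> \<epsilon> * R"
    proof -
      have "w2 \<ge> 0" by (simp add: w2_def)
      then have "t0 * w2 \<le> 1 * w2" using St(2)[OF t0] by (intro mult_right_mono)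
      then show ?thesis using St(5)[OF t0] by linarith
    qed
    have w20: "w2 > 0" using w2 \<epsilon> R by (meson less_le_trans mult_pos_pos)
    define v where "v = p /\<^sub>R w2"
    have v: "norm v = 1" using w20 by (simp add: v_def w2_def)
    have pv: "p = w2 *\<^sub>R v" using w20 by (simp add: v_def)
    have ve: "v \<bullet> e = 0" by (simp add: v_def pe)
    \<comment> \<open>Coordinates in the plane of e and v as one complex number, so that
      \<open>Arg\<close> is the angle from e.\<close>
    define q where "q = (\<lambda>t. Complex (norm x + t * w1) (t * w2))"
    have dec2: "x + t *\<^sub>R w = Re (q t) *\<^sub>R e + Im (q t) *\<^sub>R v" for t
      unfolding dec by (simp add: q_def pv)
    have nq: "norm (x + t *\<^sub>R w) = norm (q t)" for t
    proof -
      have vv: "v \<bullet> v = 1" using v by (simp add: norm_eq_1)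
      have "(norm (x + t *\<^sub>R w))\<^sup>2 = (Re (q t))\<^sup>2 + (Im (q t))\<^sup>2"
        unfolding dec2 power2_norm_eq_inner
        by (simp add: inner_add_left inner_add_right ee vv ve inner_commute[of e v] power2_eq_square)
      then have "(norm (x + t *\<^sub>R w))\<^sup>2 = (norm (q t))\<^sup>2" by (simp add: cmod_power2)
      then show ?thesis by (simp add: power2_eq_iff_nonneg)
    qed
    define \<theta> where "\<theta> = (\<lambda>t. Arg (q t))"
    have qne: "q t \<noteq> 0" if "t \<in> S" for t
    proof -
      have "t * w2 > 0" using St(1)[OF that] w20 by simp
      then show ?thesis by (auto simp: q_def complex_eq_iff)
    qed
    have polar: "Re (q t) = norm (q t) * cos (\<theta> t)" "Im (q t) = norm (q t) * sin (\<theta> t)" for t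
      using rcis_cmod_Arg[of "q t"] unfolding \<theta>_def by (metis Re_rcis, metis Im_rcis)
    have sgn_eq: "sgn (x + t *\<^sub>R w) = cos (\<theta> t) *\<^sub>R e + sin (\<theta> t) *\<^sub>R v" if "t \<in> S" for t
    proof -
      have a: "x + t *\<^sub>R w = norm (q t) *\<^sub>R (cos (\<theta> t) *\<^sub>R e + sin (\<theta> t) *\<^sub>R v)"
        unfolding dec2 polar[of t] by (simp add: scaleR_add_right)
      have "sgn (x + t *\<^sub>R w) = (x + t *\<^sub>R w) /\<^sub>R norm (q t)" by (simp only: sgn_div_norm nq)
      also have "\<dots> = cos (\<theta> t) *\<^sub>R e + sin (\<theta> t) *\<^sub>R v" unfolding a using qne[OF that] by simp
      finally show ?thesis .
    qed
    have expand: "\<bar>real L * \<theta> t - real L * \<theta> t'\<bar> \<ge> m * \<bar>t - t'\<bar>" if t: "t \<in> S" and t': "t' \<in> S" for t t'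
    proof -
      have nn: "norm (q t) > 0" "norm (q t') > 0" using qne t t' by auto
      have n2: "norm (q t) \<le> 2" "norm (q t') \<le> 2" using St(3)[OF t] St(3)[OF t'] by (simp_all add: nq)
      \<comment> \<open>The planar cross product of two points of the line: on one side the radii
        times the sine of the angle difference, on the other |x| times w2 times t - t'.\<close>
      have "norm (q t) * norm (q t') * sin (\<theta> t - \<theta> t') = Im (q t) * Re (q t') - Re (q t) * Im (q t')"
        unfolding polar[of t] polar[of t'] by (simp add: sin_diff algebra_simps)
      also have "\<dots> = norm x * w2 * (t - t')" by (simp add: q_def algebra_simps)
      finally have "norm (q t) * norm (q t') * \<bar>sin (\<theta> t - \<theta> t')\<bar> = norm x * w2 * \<bar>t - t'\<bar>"
        using nn w20 xn by (metis abs_mult abs_of_pos)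
      moreover have "norm (q t) * norm (q t') * \<bar>sin (\<theta> t - \<theta> t')\<bar> \<le> (2 * 2) * \<bar>\<theta> t - \<theta> t'\<bar>"
        by (intro mult_mono abs_sin_x_le_abs_x n2) auto
      moreover have "1 * (\<epsilon> * R) * \<bar>t - t'\<bar> \<le> norm x * w2 * \<bar>t - t'\<bar>"
        using x w2 \<epsilon> R by (intro mult_right_mono mult_mono) auto
      ultimately have "\<epsilon> * R * \<bar>t - t'\<bar> \<le> 4 * \<bar>\<theta> t - \<theta> t'\<bar>" by linarith
      then have "real L * (\<epsilon> * R * \<bar>t - t'\<bar>) \<le> real L * (4 * \<bar>\<theta> t - \<theta> t'\<bar>)" by (intro mult_left_mono) auto
      moreover have "real L * (\<epsilon> * R * \<bar>t - t'\<bar>) = 4 * (m * \<bar>t - t'\<bar>)"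
        using LR by (simp add: m_def algebra_simps)
      moreover have "\<bar>real L * \<theta> t - real L * \<theta> t'\<bar> = real L * \<bar>\<theta> t - \<theta> t'\<bar>"
        by (simp add: abs_mult flip: right_diff_distrib)
      ultimately show ?thesis by linarith
    qed
    have upper: "\<bar>real L * \<theta> t\<bar> \<le> \<Theta>" if t: "t \<in> S" for t
    proof (cases "R < 1/4")
      case True
      have tw: "\<bar>t * w1\<bar> \<le> R" "t * w2 \<le> R"
      proof -
        have "\<bar>t * w1\<bar> = \<bar>(t *\<^sub>R w) \<bullet> e\<bar>" by (simp add: w1_def)
        also have "\<dots> \<le> norm (t *\<^sub>R w)" using Cauchy_Schwarz_ineq2[of "t *\<^sub>R w" e] e by simp
        finally show "\<bar>t * w1\<bar> \<le> R" using St(4)[OF t] by linarith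
        have "w2\<^sup>2 \<le> (norm w)\<^sup>2"
        proof -
          have "w = w1 *\<^sub>R e + p" by (simp add: p_def)
          then have "(norm w)\<^sup>2 = w1\<^sup>2 + w2\<^sup>2"
            by (simp add: power2_norm_eq_inner w2_def inner_add_left inner_add_right ee pe inner_commute[of e p] power2_eq_square[of w1])
          then show ?thesis by simp
        qed
        then have "w2 \<le> norm w" by (rule power2_le_imp_le) simp
        then have "t * w2 \<le> norm (t *\<^sub>R w)" using St(1)[OF t] by (simp add: mult_left_mono)
        then show "t * w2 \<le> R" using St(4)[OF t] by linarith
      qed
      have Re: "Re (q t) \<ge> 3/4" using tw(1) True x by (simp add: q_def)
      have Im: "0 \<le> Im (q t)" "Im (q t) \<le> R" using tw(2) St(1)[OF t] w20 by (auto simp: q_def)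
      have th: "\<theta> t = arctan (Im (q t) / Re (q t))" unfolding \<theta>_def using Re by (intro arg_conv_arctan) auto
      have r0: "Im (q t) / Re (q t) \<ge> 0" using Im Re by simp
      have "\<theta> t \<le> Im (q t) / Re (q t)" unfolding th by (rule arctan_le_self[OF r0])
      also have "\<dots> \<le> R / (3/4)" using Im Re R by (intro frac_le) auto
      finally have "real L * \<theta> t \<le> real L * (R / (3/4))" by (intro mult_left_mono) auto
      also have "\<dots> = 4 * K" using LR by (simp add: mult.commute)
      also have "\<dots> \<le> 12 * K * pi"
      proof -
        have "4 * K * 1 \<le> 12 * K * pi" using K pi_gt3 by (intro mult_mono) auto
        then show ?thesis by simp
      qed
      finally have "real L * \<theta> t \<le> \<Theta>" by (simp add: \<Theta>_def)
      moreover have "\<theta> t \<ge> 0" unfolding th using r0 by simp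
      ultimately show ?thesis by simp
    next
      case False
      then have "real L * (1/4) \<le> real L * R" by (intro mult_left_mono) auto
      then have L12: "real L \<le> 12 * K" using LR by simp
      have "\<bar>\<theta> t\<bar> \<le> pi" unfolding \<theta>_def using Arg_bounded[of "q t"] by linarith
      then have "real L * \<bar>\<theta> t\<bar> \<le> 12 * K * pi" using L12 by (intro mult_mono) auto
      then show ?thesis by (simp add: \<Theta>_def abs_mult)
    qed
    obtain T where T: "T holomorphic_on UNIV" "T 0 = 1" "\<forall>s. norm (T s) \<le> b s"
      "\<And>\<theta>. T (of_real (real L * \<theta>)) = G (cos \<theta> *\<^sub>R e + sin \<theta> *\<^sub>R v) / G e"
      using great_circle_entire[OF G L e v nz[folded e_def] \<beta>] bern unfolding b_def e_def by blast
    obtain S' where S': "S' \<subseteq> S" "S' \<in> sets borel" "emeasure lborel S' \<ge> ennreal (c' / 2)"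
      "\<And>t. t \<in> S' \<Longrightarrow> norm (T (of_real (real L * \<theta> t))) \<ge> \<eta>"
      using rem[OF T(1-3) Sm S, of "\<lambda>t. real L * \<theta> t"] upper expand by blast
    have "norm (G (sgn (x + t *\<^sub>R w))) \<ge> \<eta> * norm (G (sgn x))" if t: "t \<in> S'" for t
    proof -
      have "\<eta> \<le> norm (G (sgn (x + t *\<^sub>R w)) / G e)" using S'(4)[OF t] unfolding T(4) using sgn_eq[of t] t S'(1) by auto
      then show ?thesis using nz by (simp add: e_def norm_divide field_simps)
    qed
    then show ?thesis using S' by blast
  qed
  show ?thesis
    by (rule exI[of _ \<eta>], intro conjI \<eta> allI impI, rule main[OF _ _ _ _ _ _ refl]) auto
qed

text \<open>The substitution y = x + t w for fixed t, integrated over t in [1/2, 1], replaces polar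
  coordinates around x. The Jacobian t^n lies between 2^(-n) and 1, which gives both
  comparisons.\<close>

lemma line_fubini:
  fixes h :: "real^'n \<Rightarrow> ennreal"
  assumes h[measurable]: "h \<in> borel_measurable borel"
  shows "(\<integral>\<^sup>+y. h y \<partial>lborel) \<le> 2 * (\<integral>\<^sup>+w. (\<integral>\<^sup>+t. indicator {1/2..1} t * h (x + t *\<^sub>R w) \<partial>lborel) \<partial>lborel)"
    and "(\<integral>\<^sup>+w. (\<integral>\<^sup>+t. indicator {1/2..1::real} t * h (x + t *\<^sub>R w) \<partial>lborel) \<partial>lborel) \<le> ennreal (2 ^ CARD('n)) * (\<integral>\<^sup>+y. h y \<partial>lborel)"
proof -
  let ?n = "CARD('n)"
  let ?I = "\<integral>\<^sup>+y. h y \<partial>lborel"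
  define J where "J = (\<lambda>t. \<integral>\<^sup>+w. h (x + t *\<^sub>R w) \<partial>lborel)"
  have J: "?I = ennreal (t ^ ?n) * J t" if "t > 0" for t
  proof -
    have "?I = (\<integral>\<^sup>+y. h y \<partial>distr lborel borel ((+) x))" by (simp add: lborel_distr_plus)
    also have "\<dots> = (\<integral>\<^sup>+y. h (x + y) \<partial>lborel)" by (rule nn_integral_distr) auto
    also have "\<dots> = ennreal (t ^ ?n) * J t" unfolding J_def by (rule nn_integral_scale_lborel[OF _ that]) measurable
    finally show ?thesis .
  qed
  have J1: "?I \<le> J t" if t: "1/2 \<le> t" "t \<le> 1" for t
  proof -
    have "ennreal (t ^ ?n) \<le> ennreal 1" using t by (intro ennreal_leI power_le_one) auto
    then have "ennreal (t ^ ?n) * J t \<le> 1 * J t" by (intro mult_right_mono) auto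
    then show ?thesis using J[of t] t by simp
  qed
  have J2: "J t \<le> ennreal (2 ^ ?n) * ?I" if t: "1/2 \<le> t" "t \<le> 1" for t
  proof -
    have "1 \<le> (2 * t) ^ ?n" using t by (intro one_le_power) auto
    then have "ennreal 1 \<le> ennreal (2 ^ ?n * t ^ ?n)" by (intro ennreal_leI) (simp add: power_mult_distrib)
    then have "1 * J t \<le> ennreal (2 ^ ?n * t ^ ?n) * J t" by (intro mult_right_mono) auto
    also have "\<dots> = ennreal (2 ^ ?n) * (ennreal (t ^ ?n) * J t)" using t by (simp add: ennreal_mult' mult.assoc)
    also have "\<dots> = ennreal (2 ^ ?n) * ?I" using J[of t] t by simp
    finally show ?thesis by simp
  qed
  have "(\<integral>\<^sup>+w. (\<integral>\<^sup>+t. indicator {1/2..1} t * h (x + t *\<^sub>R w) \<partial>lborel) \<partial>lborel)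
     = (\<integral>\<^sup>+t. (\<integral>\<^sup>+w. indicator {1/2..1} t * h (x + t *\<^sub>R w) \<partial>lborel) \<partial>lborel)"
    by (rule lborel_pair.Fubini'[symmetric]) measurable
  also have "\<dots> = (\<integral>\<^sup>+t. indicator {1/2..1} t * J t \<partial>lborel)"
    unfolding J_def by (intro nn_integral_cong nn_integral_cmult) measurable
  finally have F: "(\<integral>\<^sup>+w. (\<integral>\<^sup>+t. indicator {1/2..1} t * h (x + t *\<^sub>R w) \<partial>lborel) \<partial>lborel) = (\<integral>\<^sup>+t. indicator {1/2..1} t * J t \<partial>lborel)" .
  have c: "(\<integral>\<^sup>+t. indicator {1/2..1::real} t * C \<partial>lborel) = ennreal (1/2) * C" for C :: ennreal
    by (subst nn_integral_multc) auto
  have "?I = 2 * (ennreal (1/2) * ?I)"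
  proof -
    have "2 * ennreal (1/2) = 1" using ennreal_mult'[of 2 "1/2"] by simp
    then show ?thesis by (simp add: mult.assoc[symmetric])
  qed
  also have "\<dots> \<le> 2 * (\<integral>\<^sup>+t. indicator {1/2..1} t * J t \<partial>lborel)"
    unfolding c[symmetric] by (rule mult_left_mono, rule nn_integral_mono) (auto simp: indicator_def J1)
  finally show "?I \<le> 2 * (\<integral>\<^sup>+w. (\<integral>\<^sup>+t. indicator {1/2..1} t * h (x + t *\<^sub>R w) \<partial>lborel) \<partial>lborel)" unfolding F .
  have "(\<integral>\<^sup>+t. indicator {1/2..1} t * J t \<partial>lborel) \<le> (\<integral>\<^sup>+t. indicator {1/2..1::real} t * (ennreal (2 ^ ?n) * ?I) \<partial>lborel)"
    by (intro nn_integral_mono) (auto simp: indicator_def J2)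
  also have "\<dots> = ennreal (1/2) * (ennreal (2 ^ ?n) * ?I)" by (rule c)
  also have "\<dots> \<le> ennreal 1 * (ennreal (2 ^ ?n) * ?I)"
    by (rule mult_right_mono, rule ennreal_leI) simp_all
  finally show "(\<integral>\<^sup>+w. (\<integral>\<^sup>+t. indicator {1/2..1::real} t * h (x + t *\<^sub>R w) \<partial>lborel) \<partial>lborel) \<le> ennreal (2 ^ CARD('n)) * (\<integral>\<^sup>+y. h y \<partial>lborel)"
    unfolding F by simp
qed


text \<open>Lines that meet Y in measure below c' are too thin for \<open>line_lower_bound\<close>;
  c' is so small that their total can be absorbed on the left. On the other lines the lower bound is
  integrated, and \<open>line_fubini\<close> returns to volume.\<close>

lemma good_point_bound:
  fixes K \<epsilon> c \<beta> :: real
  assumes K: "K \<ge> 2" and \<epsilon>: "0 < \<epsilon>" and c: "c > 0" and \<beta>: "\<beta> \<ge> 0"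
  shows "\<exists>C>0. \<forall>L G E (x :: real^'n). L \<ge> 1 \<longrightarrow> harm_sum L G \<longrightarrow> E \<in> sets borel \<longrightarrow> 1 \<le> norm x \<longrightarrow>
    (\<forall>k\<le>L. sqrt (deriv_sq k G (sgn x)) \<le> (\<beta> * real L) ^ k * norm (G (sgn x))) \<longrightarrow>
    emeasure lborel (near_cone E (3 * K / real L) \<epsilon> x) \<ge> ennreal (c / real L ^ CARD('n)) \<longrightarrow>
    ennreal ((norm (G (sgn x)))\<^sup>2) \<le> ennreal (C * real L ^ CARD('n)) *
      (\<integral>\<^sup>+y. ennreal ((norm (G (sgn y)))\<^sup>2) * indicator (near_cone E (3 * K / real L) \<epsilon> x) y \<partial>lborel)"
proof -
  let ?n = "CARD('n)"
  let ?v = "unit_ball_vol (real ?n)"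
  have v0: "?v > 0" by (rule unit_ball_vol_pos) simp
  \<comment> \<open>A line meets Y for some t \<ge> 1/2 only if |w| \<le> 2 R = 6 K / L; c' times
    the volume of that ball is a quarter of c / L^n.\<close>
  define c' where "c' = c / (4 * ?v * (6 * K) ^ ?n)"
  have c': "c' > 0" using c v0 K by (simp add: c'_def)
  obtain \<eta> where \<eta>: "\<eta> > 0" and low: "\<And>L G E (x :: real^'n) w. L \<ge> 1 \<Longrightarrow> harm_sum L G \<Longrightarrow> E \<in> sets borel \<Longrightarrow> 1 \<le> norm x \<Longrightarrow> G (sgn x) \<noteq> 0 \<Longrightarrow>
    (\<forall>k\<le>L. sqrt (deriv_sq k G (sgn x)) \<le> (\<beta> * real L) ^ k * norm (G (sgn x))) \<Longrightarrow>
    emeasure lborel {t\<in>{1/2..1}. x + t *\<^sub>R w \<in> near_cone E (3 * K / real L) \<epsilon> x} \<ge> ennreal c' \<Longrightarrow>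
    (\<exists>S'\<subseteq>{t\<in>{1/2..1}. x + t *\<^sub>R w \<in> near_cone E (3 * K / real L) \<epsilon> x}. S' \<in> sets borel \<and>
       emeasure lborel S' \<ge> ennreal (c' / 2) \<and> (\<forall>t\<in>S'. norm (G (sgn (x + t *\<^sub>R w))) \<ge> \<eta> * norm (G (sgn x))))"
    using line_lower_bound[OF K \<epsilon> c' \<beta>, where 'n='n] by blast
  \<comment> \<open>The square of \<eta> for the values and c' / 2 for the measure of S', set
    against the trivial bound 1/2 for the measure of S.\<close>
  define \<kappa> where "\<kappa> = \<eta>\<^sup>2 * c'"
  have \<kappa>: "\<kappa> > 0" using \<eta> c' by (simp add: \<kappa>_def)
  define C where "C = 2 ^ ?n * 4 / (\<kappa> * c)"
  have C: "C > 0" using \<kappa> c by (simp add: C_def)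
  have main: "ennreal ((norm (G (sgn x)))\<^sup>2) \<le> ennreal (C * real L ^ ?n) *
      (\<integral>\<^sup>+y. ennreal ((norm (G (sgn y)))\<^sup>2) * indicator Y y \<partial>lborel)"
    if L: "L \<ge> 1" and G: "harm_sum L G" and E: "E \<in> sets borel" and x: "1 \<le> norm x"
      and bern: "\<forall>k\<le>L. sqrt (deriv_sq k G (sgn x)) \<le> (\<beta> * real L) ^ k * norm (G (sgn x))"
      and Y_def: "Y = near_cone E (3 * K / real L) \<epsilon> x"
      and vol: "emeasure lborel Y \<ge> ennreal (c / real L ^ ?n)" for L G E Y and x :: "real^'n"
  proof (cases "G (sgn x) = 0")
    case True
    then show ?thesis by simp
  next
    case nz: False
    define g where "g = norm (G (sgn x))"
    have g: "g > 0" using nz by (simp add: g_def)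
    define R where "R = 3 * K / real L"
    have Lr: "real L \<ge> 1" using L by simp
    have R: "R > 0" using K Lr by (simp add: R_def)
    have Ym: "Y \<in> sets borel" unfolding Y_def by (rule near_cone_borel[OF E])
    define \<Phi> where "\<Phi> = (\<lambda>y. ennreal ((norm (G (sgn y)))\<^sup>2) * indicator Y y)"
    have Gm[measurable]: "G \<in> borel_measurable borel" by (intro borel_measurable_continuous_onI harm_sum_continuous[OF G])
    have \<Phi>m[measurable]: "\<Phi> \<in> borel_measurable borel" unfolding \<Phi>_def using Ym by measurable
    have Im[measurable]: "(indicator Y :: real^'n \<Rightarrow> ennreal) \<in> borel_measurable borel" using Ym by measurable
    let ?k = "ennreal (\<kappa> * g\<^sup>2)"
    \<comment> \<open>For each w: if the line meets Y in measure at least c', the integral of \<Phi>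
      along it pays; otherwise c' pays for w in the ball, and outside the ball the line misses
      Y.\<close>
    have pw: "?k * (\<integral>\<^sup>+t. indicator {1/2..1} t * indicator Y (x + t *\<^sub>R w) \<partial>lborel)
        \<le> (\<integral>\<^sup>+t. indicator {1/2..1} t * \<Phi> (x + t *\<^sub>R w) \<partial>lborel) + ?k * ennreal c' * indicator (cball 0 (2 * R)) w" for w
    proof -
      define S where "S = {t\<in>{1/2..1::real}. x + t *\<^sub>R w \<in> Y}"
      have Sm: "S \<in> sets borel"
      proof -
        have "S = {1/2..1} \<inter> ((\<lambda>t. x + t *\<^sub>R w) -` Y \<inter> space borel)" by (auto simp: S_def)
        moreover have "(\<lambda>t. x + t *\<^sub>R w) -` Y \<inter> space borel \<in> sets (borel :: real measure)"
          by (rule measurable_sets[OF _ Ym]) measurable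
        ultimately show ?thesis by simp
      qed
      have mS: "(\<integral>\<^sup>+t. indicator {1/2..1} t * indicator Y (x + t *\<^sub>R w) \<partial>lborel) = emeasure lborel S"
      proof -
        have "(\<integral>\<^sup>+t. indicator {1/2..1} t * indicator Y (x + t *\<^sub>R w) \<partial>lborel) = (\<integral>\<^sup>+t. indicator S t \<partial>lborel)"
          by (intro nn_integral_cong) (auto simp: S_def indicator_def)
        then show ?thesis using Sm by simp
      qed
      have half: "emeasure lborel S \<le> ennreal (1/2)"
      proof -
        have "emeasure lborel S \<le> emeasure lborel {1/2..1::real}" by (rule emeasure_mono) (auto simp: S_def)
        then show ?thesis by simp
      qed
      show ?thesis
      proof (cases "emeasure lborel S \<ge> ennreal c'")
        case True
        obtain S' where S': "S' \<subseteq> S" "S' \<in> sets borel" "emeasure lborel S' \<ge> ennreal (c' / 2)"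
          "\<And>t. t \<in> S' \<Longrightarrow> norm (G (sgn (x + t *\<^sub>R w))) \<ge> \<eta> * g"
          using low[OF L G E x nz bern, of w] True unfolding S_def Y_def g_def by blast
        have "?k * emeasure lborel S \<le> ?k * ennreal (1/2)" by (intro mult_left_mono half) simp
        also have "\<dots> = ennreal (\<eta>\<^sup>2 * g\<^sup>2) * ennreal (c' / 2)"
          using \<eta> g c' by (simp add: \<kappa>_def ennreal_mult'[symmetric] del: ennreal_half)
        also have "\<dots> \<le> ennreal (\<eta>\<^sup>2 * g\<^sup>2) * emeasure lborel S'" by (intro mult_left_mono S'(3)) simp
        also have "\<dots> = (\<integral>\<^sup>+t. ennreal (\<eta>\<^sup>2 * g\<^sup>2) * indicator S' t \<partial>lborel)"
          using S'(2) by (simp add: nn_integral_cmult)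
        also have "\<dots> \<le> (\<integral>\<^sup>+t. indicator {1/2..1} t * \<Phi> (x + t *\<^sub>R w) \<partial>lborel)"
        proof (rule nn_integral_mono)
          fix t
          show "ennreal (\<eta>\<^sup>2 * g\<^sup>2) * indicator S' t \<le> indicator {1/2..1} t * \<Phi> (x + t *\<^sub>R w)"
          proof (cases "t \<in> S'")
            case tS: True
            then have "t \<in> S" using S'(1) by auto
            then have 1: "1/2 \<le> t" "t \<le> 1" "x + t *\<^sub>R w \<in> Y" by (auto simp: S_def)
            have "(\<eta> * g)\<^sup>2 \<le> (norm (G (sgn (x + t *\<^sub>R w))))\<^sup>2"
              using S'(4)[OF tS] \<eta> g by (intro power_mono) auto
            then have "ennreal (\<eta>\<^sup>2 * g\<^sup>2) \<le> ennreal ((norm (G (sgn (x + t *\<^sub>R w))))\<^sup>2)"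
              by (intro ennreal_leI) (simp add: power_mult_distrib)
            then show ?thesis using tS 1 by (simp add: \<Phi>_def)
          qed simp
        qed
        finally show ?thesis unfolding mS by (simp add: add_increasing2)
      next
        case False
        then have lt: "emeasure lborel S \<le> ennreal c'" by simp
        show ?thesis
        proof (cases "w \<in> cball 0 (2 * R)")
          case True
          have "?k * emeasure lborel S \<le> ?k * ennreal c'" by (intro mult_left_mono lt) simp
          then show ?thesis unfolding mS using True by (simp add: add_increasing)
        next
          case wout: False
          have "S = {}"
          proof (rule ccontr)
            assume "S \<noteq> {}"
            then obtain t where "1/2 \<le> t" "norm (t *\<^sub>R w) \<le> R" by (auto simp: S_def Y_def near_cone_def R_def)
            moreover from this have "(1/2) * norm w \<le> t * norm w" by (intro mult_right_mono) auto
            ultimately have "norm w \<le> 2 * R" by simp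
            then show False using wout by simp
          qed
          then show ?thesis unfolding mS by simp
        qed
      qed
    qed
    let ?I = "\<integral>\<^sup>+y. \<Phi> y \<partial>lborel"
    have "?k * ennreal (c / real L ^ ?n) \<le> ?k * emeasure lborel Y" by (intro mult_left_mono vol) simp
    also have "emeasure lborel Y = (\<integral>\<^sup>+y. indicator Y y \<partial>lborel)" using Ym by simp
    also have "?k * (\<integral>\<^sup>+y. indicator Y y \<partial>lborel) \<le> ?k * (2 * (\<integral>\<^sup>+w. (\<integral>\<^sup>+t. indicator {1/2..1} t * indicator Y (x + t *\<^sub>R w) \<partial>lborel) \<partial>lborel))"
      by (rule mult_left_mono[OF line_fubini(1)[OF Im]]) simp
    also have "\<dots> = 2 * (\<integral>\<^sup>+w. ?k * (\<integral>\<^sup>+t. indicator {1/2..1} t * indicator Y (x + t *\<^sub>R w) \<partial>lborel) \<partial>lborel)"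
      by (subst nn_integral_cmult) (measurable, simp add: mult_ac)
    also have "\<dots> \<le> 2 * (\<integral>\<^sup>+w. (\<integral>\<^sup>+t. indicator {1/2..1} t * \<Phi> (x + t *\<^sub>R w) \<partial>lborel) + ?k * ennreal c' * indicator (cball 0 (2 * R)) w \<partial>lborel)"
      by (rule mult_left_mono, rule nn_integral_mono, rule pw) simp
    also have "\<dots> = 2 * ((\<integral>\<^sup>+w. (\<integral>\<^sup>+t. indicator {1/2..1} t * \<Phi> (x + t *\<^sub>R w) \<partial>lborel) \<partial>lborel) + ?k * ennreal c' * emeasure lborel (cball (0::real^'n) (2 * R)))"
      by (subst nn_integral_add) (measurable, simp add: nn_integral_cmult)
    also have "\<dots> \<le> 2 * (ennreal (2 ^ ?n) * ?I + ?k * ennreal c' * emeasure lborel (cball (0::real^'n) (2 * R)))"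
      by (rule mult_left_mono, rule add_right_mono, rule line_fubini(2)[OF \<Phi>m]) simp
    also have "?k * ennreal c' * emeasure lborel (cball (0::real^'n) (2 * R)) = ennreal (\<kappa> * g\<^sup>2 * (c / real L ^ ?n) / 4)"
    proof -
      have e: "emeasure lborel (cball (0::real^'n) (2 * R)) = ennreal (?v * (2 * R) ^ ?n)" using R by (intro emeasure_cball_vec) simp
      have "\<kappa> * g\<^sup>2 * c' * (?v * (2 * R) ^ ?n) = \<kappa> * g\<^sup>2 * (c / real L ^ ?n) / 4"
      proof -
        have "(2 * R) ^ ?n = (6 * K) ^ ?n / real L ^ ?n" by (simp add: R_def power_divide)
        moreover have "?v \<noteq> 0" using v0 by linarith
        ultimately have "c' * (?v * (2 * R) ^ ?n) = (c / real L ^ ?n) / 4" using K Lr by (simp add: c'_def)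
        then have "\<kappa> * g\<^sup>2 * (c' * (?v * (2 * R) ^ ?n)) = \<kappa> * g\<^sup>2 * ((c / real L ^ ?n) / 4)" by (rule arg_cong)
        then show ?thesis by (simp only: mult.assoc times_divide_eq_right)
      qed
      moreover have "?k * ennreal c' * ennreal (?v * (2 * R) ^ ?n) = ennreal (\<kappa> * g\<^sup>2 * c' * (?v * (2 * R) ^ ?n))"
        using \<kappa> c' v0 R by (simp add: ennreal_mult')
      ultimately show ?thesis unfolding e by simp
    qed
    finally have ineq: "?k * ennreal (c / real L ^ ?n) \<le> 2 * (ennreal (2 ^ ?n) * ?I + ennreal (\<kappa> * g\<^sup>2 * (c / real L ^ ?n) / 4))" .
    show ?thesis
    \<comment> \<open>Absorbing a term needs subtraction, hence finite values; an infinite integral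
      makes the claim trivial.\<close>
    proof (cases "?I = top")
      case True
      have "ennreal (C * real L ^ ?n) \<noteq> 0" using C Lr by (auto simp: ennreal_eq_0_iff not_le intro!: mult_pos_pos)
      then have "ennreal (C * real L ^ ?n) * ?I = top" using True by (simp add: ennreal_mult_top)
      then show ?thesis unfolding \<Phi>_def by simp
    next
      case False
      then obtain i where i: "?I = ennreal i" "i \<ge> 0" by (cases ?I) auto
      define a where "a = c / real L ^ ?n"
      have a: "a > 0" using c Lr by (simp add: a_def)
      have "?k * ennreal a = ennreal (\<kappa> * g\<^sup>2 * a)" using a by (intro ennreal_mult''[symmetric]) simp
      moreover have "2 * (ennreal (2 ^ ?n) * ?I + ennreal (\<kappa> * g\<^sup>2 * a / 4)) = ennreal (2 * (2 ^ ?n * i + \<kappa> * g\<^sup>2 * a / 4))"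
      proof -
        define b where "b = \<kappa> * g\<^sup>2 * a / 4"
        have b: "b \<ge> 0" using \<kappa> a by (simp add: b_def)
        have s1: "ennreal (2 ^ ?n) * ennreal i = ennreal (2 ^ ?n * i)" by (rule ennreal_mult'[symmetric]) simp
        have s2: "ennreal (2 ^ ?n * i) + ennreal b = ennreal (2 ^ ?n * i + b)" using i(2) b by (intro ennreal_plus[symmetric]) auto
        have s3: "2 * ennreal (2 ^ ?n * i + b) = ennreal (2 * (2 ^ ?n * i + b))" using ennreal_mult'[of 2 "2 ^ ?n * i + b"] by simp
        show ?thesis unfolding i(1) b_def[symmetric] s1 s2 s3 ..
      qed
      ultimately have "ennreal (\<kappa> * g\<^sup>2 * a) \<le> ennreal (2 * (2 ^ ?n * i + \<kappa> * g\<^sup>2 * a / 4))" using ineq by (simp only: a_def)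
      then have "\<kappa> * g\<^sup>2 * a \<le> 2 * (2 ^ ?n * i + \<kappa> * g\<^sup>2 * a / 4)"
        using i(2) \<kappa> a by (subst (asm) ennreal_le_iff) (auto intro!: add_nonneg_nonneg)
      moreover have "X \<le> 4 * Y" if "X \<le> 2 * (Y + X / 4)" for X Y :: real using that by simp
      ultimately have "\<kappa> * g\<^sup>2 * a \<le> 4 * (2 ^ ?n * i)" by blast
      then have "g\<^sup>2 * (\<kappa> * a) \<le> 4 * 2 ^ ?n * i" by (simp only: mult_ac)
      then have "g\<^sup>2 \<le> 4 * 2 ^ ?n * i / (\<kappa> * a)" using \<kappa> a by (simp add: pos_le_divide_eq)
      also have "\<dots> = C * real L ^ ?n * i" using \<kappa> c Lr by (simp add: C_def a_def)
      finally have "ennreal (g\<^sup>2) \<le> ennreal (C * real L ^ ?n * i)" by (rule ennreal_leI)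
      also have "\<dots> = ennreal (C * real L ^ ?n) * ?I" unfolding i(1) using i(2) by (rule ennreal_mult'')
      finally show ?thesis unfolding \<Phi>_def g_def .
    qed
  qed
  show ?thesis
    by (rule exI[of _ C], intro conjI C allI impI, rule main[OF _ _ _ _ _ refl]) auto
qed

text \<open>At a bad point the bound fails for some k, so |G|^2 is at most the sum over k \<ge> 1 of
  \<open>deriv_sq k G u / (4 * \<Lambda>) ^ k\<close>. By \<open>bernstein_iterated\<close> the
  integral of that sum is at most 1/3 of the norm; moving it to the left leaves 3/2.\<close>

lemma good_points_carry_norm:
  fixes G :: "real^'n \<Rightarrow> complex"
  assumes n: "CARD('n) \<ge> 2" and L: "L \<ge> 1" and G: "harm_sum L G"
  defines "\<Lambda> \<equiv> real L * (2 * real L + real CARD('n))"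
  shows "normsq_sph G \<le> 3 / 2 * (\<integral>u. indicator {u. \<forall>k\<le>L. deriv_sq k G u \<le> (4 * \<Lambda>) ^ k * (norm (G u))\<^sup>2} u *\<^sub>R (norm (G u))\<^sup>2 \<partial>sphm)"
proof -
  define Gd where "Gd = {u. \<forall>k\<le>L. deriv_sq k G u \<le> (4 * \<Lambda>) ^ k * (norm (G u))\<^sup>2}"
  have \<Lambda>: "\<Lambda> > 0" unfolding \<Lambda>_def using L by (intro mult_pos_pos add_pos_nonneg) auto
  have cG: "continuous_on UNIV (\<lambda>u. (norm (G u))\<^sup>2)" by (intro continuous_intros harm_sum_continuous[OF G])
  have cd: "continuous_on UNIV (deriv_sq k G)" for k by (rule deriv_sq_continuous[OF G])
  have Gdm: "Gd \<in> sets borel"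
  proof -
    have "Gd = (\<Inter>k\<in>{..L}. {u. deriv_sq k G u \<le> (4 * \<Lambda>) ^ k * (norm (G u))\<^sup>2})" by (auto simp: Gd_def)
    moreover have "closed (\<Inter>k\<in>{..L}. {u. deriv_sq k G u \<le> (4 * \<Lambda>) ^ k * (norm (G u))\<^sup>2})"
      by (intro closed_INT ballI closed_Collect_le cd continuous_intros harm_sum_continuous[OF G])
    ultimately show ?thesis by (simp add: borel_closed)
  qed
  have iG: "integrable sphm (\<lambda>u. (norm (G u))\<^sup>2)" by (rule integrable_sphm[OF cG])
  have i1: "integrable sphm (\<lambda>u. indicator Gd u *\<^sub>R (norm (G u))\<^sup>2)"
  proof (rule Bochner_Integration.integrable_bound[OF iG])
    have "(\<lambda>u. indicator Gd u *\<^sub>R (norm (G u))\<^sup>2) \<in> borel_measurable borel"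
      by (intro borel_measurable_scaleR borel_measurable_indicator Gdm borel_measurable_continuous_onI cG)
    then show "(\<lambda>u. indicator Gd u *\<^sub>R (norm (G u))\<^sup>2) \<in> borel_measurable sphm" by (rule measurable_sphmI)
  qed (auto simp: indicator_def)
  have i2: "integrable sphm (\<lambda>u. \<Sum>k\<in>{1..L}. deriv_sq k G u / (4 * \<Lambda>) ^ k)"
    by (intro Bochner_Integration.integrable_sum integrable_divide integrable_sphm cd)
  have pw: "(norm (G u))\<^sup>2 \<le> indicator Gd u *\<^sub>R (norm (G u))\<^sup>2 + (\<Sum>k\<in>{1..L}. deriv_sq k G u / (4 * \<Lambda>) ^ k)" for u
  proof (cases "u \<in> Gd")
    case True
    then show ?thesis using \<Lambda> by (auto intro!: sum_nonneg divide_nonneg_nonneg simp: deriv_sq_nonneg)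
  next
    case False
    then obtain k where k: "k \<le> L" "deriv_sq k G u > (4 * \<Lambda>) ^ k * (norm (G u))\<^sup>2" by (auto simp: Gd_def not_le)
    \<comment> \<open>For k = 0 both sides are |G|^2, so the condition cannot fail; the geometric
      sum may start at 1.\<close>
    have "k \<noteq> 0" using k(2) by (intro notI) simp
    then have kin: "k \<in> {1..L}" using k(1) by simp
    have "(norm (G u))\<^sup>2 \<le> deriv_sq k G u / (4 * \<Lambda>) ^ k" using k(2) \<Lambda> by (simp add: pos_le_divide_eq mult.commute)
    also have "\<dots> \<le> (\<Sum>k\<in>{1..L}. deriv_sq k G u / (4 * \<Lambda>) ^ k)"
      using \<Lambda> by (intro member_le_sum kin) (auto intro!: divide_nonneg_nonneg simp: deriv_sq_nonneg)
    finally show ?thesis using False by simp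
  qed
  have "normsq_sph G \<le> (\<integral>u. indicator Gd u *\<^sub>R (norm (G u))\<^sup>2 + (\<Sum>k\<in>{1..L}. deriv_sq k G u / (4 * \<Lambda>) ^ k) \<partial>sphm)"
    unfolding normsq_sph_def by (intro integral_mono iG Bochner_Integration.integrable_add i1 i2 pw)
  also have "\<dots> = (\<integral>u. indicator Gd u *\<^sub>R (norm (G u))\<^sup>2 \<partial>sphm) + (\<Sum>k\<in>{1..L}. (\<integral>u. deriv_sq k G u \<partial>sphm) / (4 * \<Lambda>) ^ k)"
  proof -
    have "(\<integral>u. (\<Sum>k\<in>{1..L}. deriv_sq k G u / (4 * \<Lambda>) ^ k) \<partial>sphm) = (\<Sum>k\<in>{1..L}. \<integral>u. deriv_sq k G u / (4 * \<Lambda>) ^ k \<partial>sphm)"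
      by (rule Bochner_Integration.integral_sum) (intro integrable_divide integrable_sphm cd)
    then show ?thesis unfolding Bochner_Integration.integral_add[OF i1 i2] by simp
  qed
  also have "(\<Sum>k\<in>{1..L}. (\<integral>u. deriv_sq k G u \<partial>sphm) / (4 * \<Lambda>) ^ k) \<le> (\<Sum>k\<in>{1..L}. (1/4) ^ k * normsq_sph G)"
  proof (rule sum_mono)
    fix k
    have "(\<integral>u. deriv_sq k G u \<partial>sphm) \<le> \<Lambda> ^ k * normsq_sph G" unfolding \<Lambda>_def by (rule bernstein_iterated[OF n G])
    then have "(\<integral>u. deriv_sq k G u \<partial>sphm) / (4 * \<Lambda>) ^ k \<le> \<Lambda> ^ k * normsq_sph G / (4 * \<Lambda>) ^ k" using \<Lambda> by (intro divide_right_mono) auto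
    also have "\<dots> = (1/4) ^ k * normsq_sph G" using \<Lambda> by (simp add: power_mult_distrib power_one_over)
    finally show "(\<integral>u. deriv_sq k G u \<partial>sphm) / (4 * \<Lambda>) ^ k \<le> (1/4) ^ k * normsq_sph G" .
  qed
  also have "(\<Sum>k\<in>{1..L}. (1/4) ^ k * normsq_sph G) \<le> 1/3 * normsq_sph G"
  proof -
    have "(\<Sum>k\<in>{1..N}. (1/4::real) ^ k) = (1 - (1/4) ^ N) / 3" for N
    proof (induction N)
      case (Suc N)
      have x: "(1 - x) / 3 + 1 / 4 * x = (1 - 1 / 4 * x) / 3" for x :: real by (simp add: field_simps)
      have "(\<Sum>k\<in>{1..Suc N}. (1/4::real) ^ k) = (\<Sum>k\<in>{1..N}. (1/4) ^ k) + (1/4) ^ Suc N" by simp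
      also have "\<dots> = (1 - (1/4) ^ Suc N) / 3" unfolding Suc.IH power_Suc by (rule x)
      finally show ?case .
    qed simp
    then have "(\<Sum>k\<in>{1..L}. (1/4::real) ^ k) \<le> 1/3" by simp
    then show ?thesis unfolding sum_distrib_right[symmetric] by (intro mult_right_mono normsq_sph_nonneg)
  qed
  finally show ?thesis unfolding Gd_def by simp
qed

text \<open>The bound at good points is integrated over x with 1 \<le> |x| \<le> 2. After Fubini
  each y is counted only for x in the ball of radius R around it, whose volume of order L^(-n)
  cancels the factor L^n of \<open>good_point_bound\<close>.\<close>

theorem harmonic_polynomial_bound:
  fixes \<delta> :: real
  assumes n: "CARD('n) \<ge> 2" and \<delta>: "\<delta> > 0"
  shows "\<exists>C>0. \<forall>L (E :: (real^'n) set) G. L \<ge> (1::nat) \<longrightarrow> E \<in> sets borel \<longrightarrow> E \<subseteq> unit_sphere \<longrightarrow>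
    (\<forall>z. norm z = 1 - 1 / real L \<longrightarrow> harmonic_measure z E \<ge> \<delta>) \<longrightarrow> harm_sum L G \<longrightarrow>
    ennreal (normsq_sph G) \<le> ennreal C * (\<integral>\<^sup>+u. ennreal ((norm (G u))\<^sup>2) * indicator E u \<partial>sphm)"
proof -
  let ?n = "CARD('n)"
  let ?v = "unit_ball_vol (real ?n)"
  have n0: "0 < ?n" by (rule zero_less_card_finite)
  have v0: "?v > 0" by (rule unit_ball_vol_pos) simp
  obtain K c \<epsilon> where K: "K \<ge> 2" and c: "c > 0" and \<epsilon>: "0 < \<epsilon>" and dens: "\<And>L E x. L \<ge> (1::nat) \<Longrightarrow> E \<in> sets borel \<Longrightarrow> (E :: (real^'n) set) \<subseteq> unit_sphere \<Longrightarrow>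
    (\<forall>z. norm z = 1 - 1 / real L \<longrightarrow> harmonic_measure z E \<ge> \<delta>) \<Longrightarrow> 1 \<le> norm x \<Longrightarrow> norm x \<le> 2 \<Longrightarrow>
    emeasure lborel (near_cone E (3 * K / real L) \<epsilon> x) \<ge> ennreal (c / real L ^ ?n)"
    using harmonic_density_ball[OF n \<delta>] by blast
  \<comment> \<open>Chosen so that (\<beta> L)^2 is at least 4 \<Lambda>, which turns goodness in
    terms of \<Lambda> into the hypothesis of \<open>good_point_bound\<close>.\<close>
  define \<beta> where "\<beta> = 2 * sqrt (real ?n + 2)"
  have \<beta>: "\<beta> \<ge> 0" by (simp add: \<beta>_def)
  obtain C0 where C0: "C0 > 0" and gp: "\<And>L G E (x :: real^'n). L \<ge> 1 \<Longrightarrow> harm_sum L G \<Longrightarrow> E \<in> sets borel \<Longrightarrow> 1 \<le> norm x \<Longrightarrow>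
    (\<forall>k\<le>L. sqrt (deriv_sq k G (sgn x)) \<le> (\<beta> * real L) ^ k * norm (G (sgn x))) \<Longrightarrow>
    emeasure lborel (near_cone E (3 * K / real L) \<epsilon> x) \<ge> ennreal (c / real L ^ ?n) \<Longrightarrow>
    ennreal ((norm (G (sgn x)))\<^sup>2) \<le> ennreal (C0 * real L ^ ?n) *
      (\<integral>\<^sup>+y. ennreal ((norm (G (sgn y)))\<^sup>2) * indicator (near_cone E (3 * K / real L) \<epsilon> x) y \<partial>lborel)"
    using good_point_bound[OF K \<epsilon> c \<beta>, where 'n='n] by blast
  define D where "D = C0 * (?v * (3 * K) ^ ?n)"
  have D: "D > 0" using C0 v0 K by (simp add: D_def)
  \<comment> \<open>3/2 from the good points, D from cancelling L^n, and 2^n from the ball of radius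
    2 in which the points y range.\<close>
  define C where "C = 3 / 2 * (D * 2 ^ ?n)"
  have C: "C > 0" using D by (simp add: C_def)
  have main: "ennreal (normsq_sph G) \<le> ennreal C * (\<integral>\<^sup>+u. ennreal ((norm (G u))\<^sup>2) * indicator E u \<partial>sphm)"
    if L: "L \<ge> 1" and E: "E \<in> sets borel" "E \<subseteq> unit_sphere" and hm: "\<forall>z. norm z = 1 - 1 / real L \<longrightarrow> harmonic_measure z E \<ge> \<delta>"
      and G: "harm_sum L G" for L G and E :: "(real^'n) set"
  proof -
    have Lr: "real L \<ge> 1" using L by simp
    define R where "R = 3 * K / real L"
    have R: "R > 0" using K Lr by (simp add: R_def)
    define \<Lambda> where "\<Lambda> = real L * (2 * real L + real ?n)"
    define Gd where "Gd = {u. \<forall>k\<le>L. deriv_sq k G u \<le> (4 * \<Lambda>) ^ k * (norm (G u))\<^sup>2}"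
    have cG: "continuous_on UNIV (\<lambda>u. (norm (G u))\<^sup>2)" by (intro continuous_intros harm_sum_continuous[OF G])
    have Gm[measurable]: "G \<in> borel_measurable borel" by (intro borel_measurable_continuous_onI harm_sum_continuous[OF G])
    have Gdm[measurable]: "Gd \<in> sets borel"
    proof -
      have "Gd = (\<Inter>k\<in>{..L}. {u. deriv_sq k G u \<le> (4 * \<Lambda>) ^ k * (norm (G u))\<^sup>2})" by (auto simp: Gd_def)
      moreover have "closed (\<Inter>k\<in>{..L}. {u. deriv_sq k G u \<le> (4 * \<Lambda>) ^ k * (norm (G u))\<^sup>2})"
        by (intro closed_INT ballI closed_Collect_le deriv_sq_continuous[OF G] continuous_intros harm_sum_continuous[OF G])
      ultimately show ?thesis by (simp add: borel_closed)
    qed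
    have Em[measurable]: "E \<in> sets borel" by (rule E)
    have good: "sqrt (deriv_sq k G u) \<le> (\<beta> * real L) ^ k * norm (G u)" if "u \<in> Gd" "k \<le> L" for u k
    proof -
      have "4 * \<Lambda> \<le> (\<beta> * real L)\<^sup>2"
      proof -
        have "(\<beta> * real L)\<^sup>2 = 4 * (real L * (real L * (real ?n + 2)))" by (simp add: \<beta>_def power_mult_distrib power2_eq_square)
        moreover have "2 * real L + real ?n \<le> real L * (real ?n + 2)"
          using mult_right_mono[OF Lr, of "real ?n"] by (simp add: algebra_simps)
        ultimately show ?thesis unfolding \<Lambda>_def by (simp add: mult_left_mono)
      qed
      then have "(4 * \<Lambda>) ^ k \<le> ((\<beta> * real L)\<^sup>2) ^ k" by (intro power_mono) (auto simp: \<Lambda>_def)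
      then have "deriv_sq k G u \<le> ((\<beta> * real L)\<^sup>2) ^ k * (norm (G u))\<^sup>2"
        using that mult_right_mono[of "(4 * \<Lambda>) ^ k" "((\<beta> * real L)\<^sup>2) ^ k" "(norm (G u))\<^sup>2"] by (force simp: Gd_def)
      also have "\<dots> = ((\<beta> * real L) ^ k * norm (G u))\<^sup>2" by (simp add: power_mult_distrib power_mult[symmetric] mult.commute)
      finally show ?thesis using \<beta> by (intro real_le_lsqrt) (auto simp: deriv_sq_nonneg)
    qed
    define g where "g = (\<lambda>u. ennreal ((norm (G u))\<^sup>2) * indicator Gd u)"
    have gm[measurable]: "g \<in> borel_measurable borel" unfolding g_def by measurable
    define \<Phi> where "\<Phi> = (\<lambda>u. ennreal ((norm (G u))\<^sup>2) * indicator E u)"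
    have \<Phi>m[measurable]: "\<Phi> \<in> borel_measurable borel" unfolding \<Phi>_def by measurable
    let ?A = "\<integral>\<^sup>+u. g u \<partial>sphm"
    let ?B = "\<integral>\<^sup>+u. \<Phi> u \<partial>sphm"
    \<comment> \<open>The range of x in \<open>harmonic_density_ball\<close>. Its volume is 2^n - 1
      \<ge> 1 times that of the unit ball, so it carries at least the mass that the unit ball
      would.\<close>
    define sh where "sh = {x::real^'n. 1 \<le> norm x \<and> norm x \<le> 2}"
    have shm[measurable]: "sh \<in> sets borel" unfolding sh_def by measurable
    let ?S = "\<integral>\<^sup>+x. g (sgn x) * indicator sh x \<partial>lborel"
    \<comment> \<open>Finiteness is what allows A to be cancelled in the comparison of balls, and to
      be read as a real number at the end.\<close>
    have Afin: "?A < top"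
    proof -
      have "?A \<le> (\<integral>\<^sup>+u. ennreal ((norm (G u))\<^sup>2) \<partial>sphm)" by (rule nn_integral_mono) (simp add: g_def indicator_def)
      also have "\<dots> = ennreal (normsq_sph G)" unfolding normsq_sph_def by (rule nn_integral_eq_integral[OF integrable_sphm[OF cG]]) simp
      finally show ?thesis by (rule le_less_trans) simp
    qed
    have shell: "?A \<le> of_nat ?n * ?S"
    proof -
      have "ennreal (2 ^ ?n) * ?A = of_nat ?n * (\<integral>\<^sup>+x. g (sgn x) * indicator (cball 0 2) x \<partial>lborel)"
        by (rule nn_integral_cball_sgn[symmetric]) auto
      also have "\<dots> \<le> of_nat ?n * (\<integral>\<^sup>+x. g (sgn x) * indicator sh x + g (sgn x) * indicator (cball 0 1) x \<partial>lborel)"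
        by (rule mult_left_mono, rule nn_integral_mono) (auto simp: sh_def indicator_def)
      also have "\<dots> = of_nat ?n * ?S + of_nat ?n * (\<integral>\<^sup>+x. g (sgn x) * indicator (cball 0 1) x \<partial>lborel)"
        by (subst nn_integral_add) (auto simp: distrib_left)
      also have "of_nat ?n * (\<integral>\<^sup>+x. g (sgn x) * indicator (cball 0 1) x \<partial>lborel) = ?A"
        by (rule nn_integral_sphm[symmetric]) simp
      finally have 1: "ennreal (2 ^ ?n) * ?A \<le> of_nat ?n * ?S + ?A" .
      have "(2::real) ^ 1 \<le> 2 ^ ?n" by (rule power_increasing) (use n in linarith, simp)
      then have "ennreal 2 \<le> ennreal (2 ^ ?n)" by (intro ennreal_leI) (simp only: power_one_right)
      then have "ennreal 2 * ?A \<le> ennreal (2 ^ ?n) * ?A" by (rule mult_right_mono) simp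
      also note 1
      finally have "?A + ?A \<le> ?A + of_nat ?n * ?S" by (simp only: ennreal_numeral mult_2 add.commute)
      moreover have "?A \<noteq> top" using Afin by (simp only: less_top)
      ultimately show ?thesis by (simp only: ennreal_add_left_cancel_le) simp
    qed
    have "?S \<le> (\<integral>\<^sup>+x. ennreal (C0 * real L ^ ?n) * (\<integral>\<^sup>+y. (\<Phi> (sgn y) * indicator (cball 0 2) y) * indicator (cball y R) x \<partial>lborel) \<partial>lborel)"
    proof (rule nn_integral_mono)
      fix x :: "real^'n"
      show "g (sgn x) * indicator sh x \<le> ennreal (C0 * real L ^ ?n) * (\<integral>\<^sup>+y. (\<Phi> (sgn y) * indicator (cball 0 2) y) * indicator (cball y R) x \<partial>lborel)"
      proof (cases "sgn x \<in> Gd \<and> x \<in> sh")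
        case True
        then have x: "1 \<le> norm x" "norm x \<le> 2" by (auto simp: sh_def)
        have "ennreal ((norm (G (sgn x)))\<^sup>2) \<le> ennreal (C0 * real L ^ ?n) *
           (\<integral>\<^sup>+y. ennreal ((norm (G (sgn y)))\<^sup>2) * indicator (near_cone E (3 * K / real L) \<epsilon> x) y \<partial>lborel)"
          using True good by (intro gp[OF L G E(1) x(1)] dens[OF L E hm x]) auto
        also have "\<dots> \<le> ennreal (C0 * real L ^ ?n) * (\<integral>\<^sup>+y. (\<Phi> (sgn y) * indicator (cball 0 2) y) * indicator (cball y R) x \<partial>lborel)"
          by (rule mult_left_mono, rule nn_integral_mono) (auto simp: near_cone_def \<Phi>_def R_def indicator_def dist_norm)
        finally show ?thesis using True by (simp add: g_def)
      qed (auto simp: g_def indicator_def)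
    qed
    also have "\<dots> = ennreal (C0 * real L ^ ?n) * (\<integral>\<^sup>+x. (\<integral>\<^sup>+y. (\<Phi> (sgn y) * indicator (cball 0 2) y) * indicator (cball y R) x \<partial>lborel) \<partial>lborel)"
    proof (rule nn_integral_cmult)
      have "(\<lambda>(x :: real^'n, y). indicator (cball y R) x :: ennreal) = (\<lambda>(x, y). if dist y x \<le> R then 1 else (0::ennreal))"
        by (auto simp: indicator_def fun_eq_iff)
      then have [measurable]: "(\<lambda>(x :: real^'n, y). indicator (cball y R) x :: ennreal) \<in> borel_measurable (lborel \<Otimes>\<^sub>M lborel)" by simp
      show "(\<lambda>x. \<integral>\<^sup>+y. (\<Phi> (sgn y) * indicator (cball 0 2) y) * indicator (cball y R) x \<partial>lborel) \<in> borel_measurable lborel"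
        by measurable
    qed
    also have "(\<integral>\<^sup>+x. (\<integral>\<^sup>+y. (\<Phi> (sgn y) * indicator (cball 0 2) y) * indicator (cball y R) x \<partial>lborel) \<partial>lborel)
       = (\<integral>\<^sup>+y. (\<integral>\<^sup>+x. (\<Phi> (sgn y) * indicator (cball 0 2) y) * indicator (cball y R) x \<partial>lborel) \<partial>lborel)"
    proof -
      have "(\<lambda>(y, x :: real^'n). indicator (cball y R) x :: ennreal) = (\<lambda>(y, x). if dist y x \<le> R then 1 else (0::ennreal))"
        "(\<lambda>(x :: real^'n, y). indicator (cball y R) x :: ennreal) = (\<lambda>(x, y). if dist y x \<le> R then 1 else (0::ennreal))"
        by (auto simp: indicator_def fun_eq_iff)
      then have [measurable]: "(\<lambda>(y, x :: real^'n). indicator (cball y R) x :: ennreal) \<in> borel_measurable (lborel \<Otimes>\<^sub>M lborel)"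
        "(\<lambda>(x :: real^'n, y). indicator (cball y R) x :: ennreal) \<in> borel_measurable (lborel \<Otimes>\<^sub>M lborel)" by simp_all
      show ?thesis by (rule lborel_pair.Fubini'[symmetric]) measurable
    qed
    also have "\<dots> = (\<integral>\<^sup>+y. (\<Phi> (sgn y) * indicator (cball 0 2) y) * ennreal (?v * R ^ ?n) \<partial>lborel)"
    proof (rule nn_integral_cong)
      fix y :: "real^'n"
      have "(\<integral>\<^sup>+x. (\<Phi> (sgn y) * indicator (cball 0 2) y) * indicator (cball y R) x \<partial>lborel) = (\<Phi> (sgn y) * indicator (cball 0 2) y) * emeasure lborel (cball y R)"
        by (subst nn_integral_cmult) auto
      then show "(\<integral>\<^sup>+x. (\<Phi> (sgn y) * indicator (cball 0 2) y) * indicator (cball y R) x \<partial>lborel) = (\<Phi> (sgn y) * indicator (cball 0 2) y) * ennreal (?v * R ^ ?n)"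
        using emeasure_cball_vec[of R y] R by simp
    qed
    also have "\<dots> = (\<integral>\<^sup>+y. \<Phi> (sgn y) * indicator (cball 0 2) y \<partial>lborel) * ennreal (?v * R ^ ?n)"
      by (rule nn_integral_multc) measurable
    finally have S1: "?S \<le> ennreal (C0 * real L ^ ?n) * ((\<integral>\<^sup>+y. \<Phi> (sgn y) * indicator (cball 0 2) y \<partial>lborel) * ennreal (?v * R ^ ?n))" .
    have DD: "ennreal (C0 * real L ^ ?n) * ennreal (?v * R ^ ?n) = ennreal D"
    proof -
      have "C0 * real L ^ ?n * (?v * R ^ ?n) = D" using Lr by (simp add: D_def R_def power_divide)
      then show ?thesis using C0 Lr by (subst ennreal_mult'[symmetric]) auto
    qed
    have "?A \<le> of_nat ?n * (ennreal (C0 * real L ^ ?n) * ((\<integral>\<^sup>+y. \<Phi> (sgn y) * indicator (cball 0 2) y \<partial>lborel) * ennreal (?v * R ^ ?n)))"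
      by (rule order_trans[OF shell mult_left_mono[OF S1]]) simp
    also have "\<dots> = (ennreal (C0 * real L ^ ?n) * ennreal (?v * R ^ ?n)) * (of_nat ?n * (\<integral>\<^sup>+y. \<Phi> (sgn y) * indicator (cball 0 2) y \<partial>lborel))"
      by (simp only: mult_ac)
    also have "\<dots> = ennreal D * (ennreal (2 ^ ?n) * ?B)"
      unfolding DD by (subst nn_integral_cball_sgn) auto
    finally have A: "?A \<le> ennreal D * (ennreal (2 ^ ?n) * ?B)" .
    have int: "(\<integral>u. indicator Gd u *\<^sub>R (norm (G u))\<^sup>2 \<partial>sphm) = enn2real ?A"
    proof -
      have "(\<integral>u. indicator Gd u *\<^sub>R (norm (G u))\<^sup>2 \<partial>sphm) = enn2real (\<integral>\<^sup>+u. ennreal (indicator Gd u *\<^sub>R (norm (G u))\<^sup>2) \<partial>sphm)"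
        by (rule integral_eq_nn_integral) (auto intro!: measurable_sphmI)
      also have "(\<integral>\<^sup>+u. ennreal (indicator Gd u *\<^sub>R (norm (G u))\<^sup>2) \<partial>sphm) = ?A"
        by (rule nn_integral_cong) (auto simp: g_def indicator_def)
      finally show ?thesis .
    qed
    have "normsq_sph G \<le> 3 / 2 * enn2real ?A"
      using good_points_carry_norm[OF n L G] unfolding int[symmetric] Gd_def \<Lambda>_def .
    then have "ennreal (normsq_sph G) \<le> ennreal (3 / 2 * enn2real ?A)" by (rule ennreal_leI)
    also have "\<dots> = ennreal (3 / 2) * ?A" using Afin by (subst ennreal_mult') auto
    also have "\<dots> \<le> ennreal (3 / 2) * (ennreal D * (ennreal (2 ^ ?n) * ?B))" by (rule mult_left_mono[OF A]) simp
    also have "\<dots> = ennreal C * ?B"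
    proof -
      have "ennreal C = ennreal (3 / 2) * ennreal (D * 2 ^ ?n)" unfolding C_def by (rule ennreal_mult') simp
      moreover have "ennreal (D * 2 ^ ?n) = ennreal D * ennreal (2 ^ ?n)" using D by (intro ennreal_mult') simp
      ultimately show ?thesis by (simp only: mult.assoc)
    qed
    finally show ?thesis unfolding \<Phi>_def .
  qed
  show ?thesis using C main by blast
qed

section \<open>The main theorem\<close>

text \<open>Makes the family in the theorem bounded below; only then does its infimum bound each
  member.\<close>

lemma harmonic_measure_nonneg: "norm z \<le> 1 \<Longrightarrow> harmonic_measure z F \<ge> 0"
  unfolding harmonic_measure_def set_lebesgue_integral_def
  by (intro mult_nonneg_nonneg Bochner_Integration.integral_nonneg) (auto simp: power_le_one)

text \<open>The surface measure is completed, so E is only Lebesgue measurable, while the estimates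
  above are for Borel sets. Both harmonic measure and the integral over E ignore a null set.\<close>

lemma sets_borel_version:
  fixes E :: "(real^'n) set"
  assumes E: "E \<in> sets sphm"
  obtains E' where "E' \<in> sets borel" "E' \<subseteq> unit_sphere" "AE u in sphm. u \<in> E \<longleftrightarrow> u \<in> E'"
proof -
  have "(indicator E :: real^'n \<Rightarrow> complex) \<in> borel_measurable sphm" using E by simp
  then obtain g where g: "g \<in> borel_measurable borel" "AE u in sphm. indicator E u = (g u :: complex)"
    using sq_int_borel_version by blast
  define E' where "E' = (g -` {1} \<inter> space borel) \<inter> unit_sphere"
  have "g -` {1} \<inter> space borel \<in> sets (borel :: (real^'n) measure)" by (rule measurable_sets[OF g(1)]) simp
  then have "E' \<in> sets borel" unfolding E'_def by simp
  moreover have "AE u in sphm. u \<in> E \<longleftrightarrow> u \<in> E'"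
    using g(2) AE_space
  proof eventually_elim
    case (elim u)
    then have "norm u = 1" by (simp add: space_sphere_measure)
    then show ?case using elim(1) by (cases "u \<in> E") (auto simp: E'_def)
  qed
  ultimately show ?thesis using that by (auto simp: E'_def)
qed

theorem corollary1p1:
  fixes d :: nat and \<delta> :: real
  assumes "d \<ge> 1" and "CARD('n) = d + 1" and "\<delta> > 0"
  shows "\<exists>C>0. \<forall>(L::nat) (E :: (real ^ 'n) set).
    L \<ge> 1 \<longrightarrow> E \<in> sets sphere_measure \<longrightarrow>
    (INF z \<in> {z. norm z < 1 \<and> 1 - norm z = 1 / real L}. harmonic_measure z E) = \<delta> \<longrightarrow>
    (\<forall>f :: real ^ 'n \<Rightarrow> complex. square_integrable_sphere f \<longrightarrow>
      (\<integral>u. (norm (f u))\<^sup>2 \<partial>sphere_measure)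
        \<le> C * ((LINT u:E|sphere_measure. (norm (f u))\<^sup>2)
               + (\<Sum>\<^sub>\<infinity>l\<in>{L<..}. (L2_norm_sphere (harmonic_projection l f))\<^sup>2)))"
proof -
  have n: "CARD('n) \<ge> 2" using assms by simp
  obtain C where C: "C > 0" and bnd: "\<And>L (E :: (real^'n) set) G. L \<ge> (1::nat) \<Longrightarrow> E \<in> sets borel \<Longrightarrow> E \<subseteq> unit_sphere \<Longrightarrow>
    (\<forall>z. norm z = 1 - 1 / real L \<longrightarrow> harmonic_measure z E \<ge> \<delta>) \<Longrightarrow> harm_sum L G \<Longrightarrow>
    ennreal (normsq_sph G) \<le> ennreal C * (\<integral>\<^sup>+u. ennreal ((norm (G u))\<^sup>2) * indicator E u \<partial>sphm)"
    using harmonic_polynomial_bound[OF n assms(3)] by blast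
  show ?thesis
  \<comment> \<open>With G = f - r and the factors 2 of the square of a sum, the bound is C (2 I + 2
    t) + t, where I is the integral over E and t the tail; the last t is the norm of r
    itself.\<close>
  proof (intro exI[of _ "2 * C + 1"] conjI allI impI)
    show "2 * C + 1 > 0" using C by simp
    fix L :: nat and E :: "(real^'n) set" and f :: "real^'n \<Rightarrow> complex"
    assume L: "L \<ge> 1" and E: "E \<in> sets sphere_measure" and f: "square_integrable_sphere f"
      and inf: "(INF z \<in> {z. norm z < 1 \<and> 1 - norm z = 1 / real L}. harmonic_measure z E) = \<delta>"
    obtain E' where E': "E' \<in> sets borel" "E' \<subseteq> unit_sphere" "AE u in sphm. u \<in> E \<longleftrightarrow> u \<in> E'"
      by (rule sets_borel_version[OF E])
    have E's: "E' \<in> sets sphm" by (rule sets_sphmI[OF E'(1,2)])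
    have set_eq: "(LINT u:E|sphm. h u) = (LINT u:E'|sphm. h u)" if "h \<in> borel_measurable sphm" for h :: "real^'n \<Rightarrow> real"
      unfolding set_lebesgue_integral_def
    proof (rule integral_cong_AE)
      show "AE u in sphm. indicat_real E u *\<^sub>R h u = indicat_real E' u *\<^sub>R h u"
        using E'(3) by eventually_elim (simp add: indicator_def)
    qed (use E E's that in measurable)
    have hm: "harmonic_measure z E' \<ge> \<delta>" if z: "norm z = 1 - 1 / real L" for z
    proof -
      have Pm: "(\<lambda>u :: real^'n. (1 - (norm z)\<^sup>2) / norm (z - u) ^ CARD('n)) \<in> borel_measurable sphm"
        by (rule measurable_sphmI) measurable
      have "1 / real L > 0" using L by simp
      then have "z \<in> {z. norm z < 1 \<and> 1 - norm z = 1 / real L}" using z by simp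
      then have "(INF z \<in> {z. norm z < 1 \<and> 1 - norm z = 1 / real L}. harmonic_measure z E) \<le> harmonic_measure z E"
        by (rule cINF_lower[rotated]) (auto intro!: bdd_belowI2[where m=0] harmonic_measure_nonneg)
      moreover have "harmonic_measure z E = harmonic_measure z E'" unfolding harmonic_measure_def set_eq[OF Pm] ..
      ultimately show ?thesis using inf by simp
    qed
    obtain G where G: "harm_sum L G" "normsq_sph f = normsq_sph G + normsq_sph (\<lambda>u. f u - G u)"
      "normsq_sph (\<lambda>u. f u - G u) \<le> (\<Sum>\<^sub>\<infinity>l\<in>{L<..}. (L2_norm_sphere (harmonic_projection l f))\<^sup>2)"
      by (rule parseval_tail[OF n f])
    define t where "t = (\<Sum>\<^sub>\<infinity>l\<in>{L<..}. (L2_norm_sphere (harmonic_projection l f))\<^sup>2)"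
    define r where "r = (\<lambda>u. f u - G u)"
    have sG: "sq_int G" by (rule sq_int_continuous[OF harm_sum_continuous[OF G(1)]])
    have sr: "sq_int r" unfolding r_def by (rule sq_int_diff[OF f sG])
    have int: "integrable sphm (\<lambda>u. indicator E' u *\<^sub>R (norm (h u))\<^sup>2)" if "sq_int h" for h :: "real^'n \<Rightarrow> complex"
      by (rule integrable_mult_indicator[OF E's sq_int_integrable[OF that]])
    let ?I = "\<lambda>h :: real^'n \<Rightarrow> complex. \<integral>u. indicator E' u *\<^sub>R (norm (h u))\<^sup>2 \<partial>sphm"
    have I0: "?I h \<ge> 0" for h by (rule Bochner_Integration.integral_nonneg) simp
    have "(\<integral>\<^sup>+u. ennreal ((norm (G u))\<^sup>2) * indicator E' u \<partial>sphm) = (\<integral>\<^sup>+u. ennreal (indicator E' u *\<^sub>R (norm (G u))\<^sup>2) \<partial>sphm)"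
      by (rule nn_integral_cong) (simp add: indicator_def)
    also have "\<dots> = ennreal (?I G)" by (rule nn_integral_eq_integral[OF int[OF sG]]) simp
    finally have "ennreal (normsq_sph G) \<le> ennreal C * ennreal (?I G)"
      using bnd[OF L E'(1,2) _ G(1)] hm by simp
    also have "\<dots> = ennreal (C * ?I G)" using C by (intro ennreal_mult'[symmetric]) simp
    finally have 1: "normsq_sph G \<le> C * ?I G" using C I0[of G] by (subst (asm) ennreal_le_iff) auto
    have "?I G \<le> (\<integral>u. 2 * (indicator E' u *\<^sub>R (norm (f u))\<^sup>2) + 2 * (norm (r u))\<^sup>2 \<partial>sphm)"
    proof (rule integral_mono)
      show "integrable sphm (\<lambda>u. indicator E' u *\<^sub>R (norm (G u))\<^sup>2)" by (rule int[OF sG])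
      show "integrable sphm (\<lambda>u. 2 * (indicator E' u *\<^sub>R (norm (f u))\<^sup>2) + 2 * (norm (r u))\<^sup>2)"
        by (intro Bochner_Integration.integrable_add integrable_mult_right int f sq_int_integrable sr)
      fix u
      have "(norm (G u))\<^sup>2 \<le> 2 * (norm (f u))\<^sup>2 + 2 * (norm (r u))\<^sup>2"
        using norm_add_sq_le[of "f u" "- r u"] by (simp add: r_def norm_minus_commute)
      then show "indicator E' u *\<^sub>R (norm (G u))\<^sup>2 \<le> 2 * (indicator E' u *\<^sub>R (norm (f u))\<^sup>2) + 2 * (norm (r u))\<^sup>2"
        by (simp add: indicator_def)
    qed
    also have "\<dots> = 2 * ?I f + 2 * normsq_sph r"
      unfolding normsq_sph_def
        Bochner_Integration.integral_add[OF integrable_mult_right[OF int[OF f], of 2] integrable_mult_right[OF sq_int_integrable[OF sr], of 2]]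
      by simp
    finally have "C * ?I G \<le> C * (2 * ?I f + 2 * normsq_sph r)" using C by (intro mult_left_mono) auto
    with 1 G(2) have "normsq_sph f \<le> C * (2 * ?I f + 2 * normsq_sph r) + normsq_sph r" by (simp add: r_def)
    also have "\<dots> \<le> C * (2 * ?I f + 2 * t) + t"
      using G(3) C unfolding r_def t_def by (intro add_mono mult_left_mono) auto
    also have "\<dots> \<le> (2 * C + 1) * (?I f + t)" using I0[of f] by (simp add: algebra_simps)
    finally have "normsq_sph f \<le> (2 * C + 1) * (?I f + t)" .
    moreover have "?I f = (LINT u:E|sphm. (norm (f u))\<^sup>2)"
      using set_eq[OF borel_measurable_integrable[OF sq_int_integrable[OF f]]] by (simp add: set_lebesgue_integral_def)
    ultimately show "(\<integral>u. (norm (f u))\<^sup>2 \<partial>sphere_measure)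
        \<le> (2 * C + 1) * ((LINT u:E|sphere_measure. (norm (f u))\<^sup>2)
               + (\<Sum>\<^sub>\<infinity>l\<in>{L<..}. (L2_norm_sphere (harmonic_projection l f))\<^sup>2))"
      by (simp add: normsq_sph_def t_def)
  qed
qed

end
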